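(* Let $\alpha:\mathcal P(E)\to(-\infty,\infty]$ be measurable, bounded from below and not identically $+\infty$, let $\mu\in\mathcal P(E)$, and assume there exists $x_0\in E$ with $\int_Ed^2(x,x_0)\,\mu(\mathrm dx)<\infty$. Let $C>0$. The following are equivalent: (1) $W_2^2(\mu,\nu)\le C\,\alpha(\nu)$ for all $\nu\in\mathcal P(E)$. (2) For each $n\in\mathbb N$, $W_1^2(\mu^{\otimes n},\nu)\le C\,\alpha_n(\nu)$ for all $\nu\in\mathcal P(E^n)$. (2') For each $n\in\mathbb N$, $W_1^2(\mu^{\otimes n},\nu)\le C\,\widehat\alpha_n(\nu)$ for all $\nu\in\mathcal P(E^n)$. (3) For each $n\in\mathbb N$, $\lambda\in\mathbb R$ and bounded $1$-Lipschitz $f:E^n\to\mathbb R$, $\rho_n(\lambda f)\le\lambda\int_{E^n}f\,\mathrm d\mu^{\otimes n}+\frac{C\lambda^2}4$. (3') The same as (3) with $\widehat\rho_n$ in place of $\rho_n$.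
   Context: $(E,d)$ is a complete separable metric space; $\mathcal P(E)$ has the weak topology; $E^n$ carries the $\ell^2$-metric $((x_i),(y_i))\mapsto\sqrt{\sum_i d^2(x_i,y_i)}$, used for Lipschitz constants and Wasserstein distances on $E^n$. $W_p(\nu,\mu)=(\inf_\pi\int d^p\,\mathrm d\pi)^{1/p}$ over couplings $\pi$ (value $+\infty$ allowed). For $\nu\in\mathcal P(E^n)$: $\nu_{-k}:E^{n-1}\to\mathcal P(E)$ is the conditional law of the $k$-th coordinate given the others $x_{-k}=(x_i)_{i\ne k}$ (disintegration); $\nu_{0,1}$ is the first marginal and $\nu_{k-1,k}(x_1,\dots,x_{k-1})$ the conditional law of the $k$-th coordinate given the first $k-1$, so that $\nu(\mathrm dx)=\nu_{0,1}(\mathrm dx_1)\prod_{k=2}^n\nu_{k-1,k}(x_1,\dots,x_{k-1})(\mathrm dx_k)$. Define $\alpha_n(\nu)=\int\sum_{k=1}^n\alpha(\nu_{-k}(x_{-k}))\,\nu(\mathrm dx)$, $\widehat\alpha_n(\nu)=\int\sum_{k=1}^n\alpha(\nu_{k-1,k}(x_1,\dots,x_{k-1}))\,\nu(\mathrm dx)$, and for bounded measurable $f$ on $E^n$, $\rho_n(f)=\sup_{\nu\in\mathcal P(E^n)}(\int f\,\mathrm d\nu-\alpha_n(\nu))$, $\widehat\rho_n(f)=\sup_{\nu\in\mathcal P(E^n)}(\int f\,\mathrm d\nu-\widehat\alpha_n(\nu))$. *)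

theory Defs
  imports "HOL-Probability.Probability"
begin

definition enn_powr :: "ennreal \<Rightarrow> real \<Rightarrow> ennreal" where
  "enn_powr x r = (if x = \<infinity> then \<infinity> else ennreal (enn2real x powr r))"

definition couplings :: "'a measure \<Rightarrow> 'b measure \<Rightarrow> ('a \<times> 'b) measure set" where
  "couplings M N = {\<pi>. sets \<pi> = sets (M \<Otimes>\<^sub>M N) \<and> distr \<pi> M fst = M \<and> distr \<pi> N snd = N}"

definition wasserstein :: "real \<Rightarrow> ('a \<Rightarrow> 'a \<Rightarrow> real) \<Rightarrow> 'a measure \<Rightarrow> 'a measure \<Rightarrow> ennreal" where
  "wasserstein p dd M N =
     enn_powr (INF \<pi> \<in> couplings M N. \<integral>\<^sup>+ z. ennreal (dd (fst z) (snd z) powr p) \<partial>\<pi>) (1 / p)"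

text \<open>E^n, represented as extensional functions on {..<n}, with product Borel sigma-algebra.\<close>
definition prodE :: "nat set \<Rightarrow> (nat \<Rightarrow> 'a::topological_space) measure" where
  "prodE I = PiM I (\<lambda>_. borel)"

definition dist_n :: "nat \<Rightarrow> (nat \<Rightarrow> 'a::metric_space) \<Rightarrow> (nat \<Rightarrow> 'a) \<Rightarrow> real" where
  "dist_n n x y = sqrt (\<Sum>i<n. (dist (x i) (y i))\<^sup>2)"

definition pow_measure :: "'a measure \<Rightarrow> nat \<Rightarrow> (nat \<Rightarrow> 'a) measure" where
  "pow_measure \<mu> n = PiM {..<n} (\<lambda>_. \<mu>)"

definition is_cond_law :: "(nat \<Rightarrow> 'a::topological_space) measure \<Rightarrow> nat set \<Rightarrow> nat
    \<Rightarrow> ((nat \<Rightarrow> 'a) \<Rightarrow> 'a measure) \<Rightarrow> bool" where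
  "is_cond_law \<nu> S k K \<longleftrightarrow>
     K \<in> prodE S \<rightarrow>\<^sub>M prob_algebra borel \<and>
     (\<forall>A \<in> sets (prodE S). \<forall>B \<in> sets borel.
        emeasure \<nu> {x \<in> space \<nu>. restrict x S \<in> A \<and> x k \<in> B}
        = (\<integral>\<^sup>+ x. indicator A (restrict x S) * emeasure (K (restrict x S)) B \<partial>\<nu>))"

definition cond_law :: "(nat \<Rightarrow> 'a::topological_space) measure \<Rightarrow> nat set \<Rightarrow> nat
    \<Rightarrow> (nat \<Rightarrow> 'a) \<Rightarrow> 'a measure" where
  "cond_law \<nu> S k = (SOME K. is_cond_law \<nu> S k K)"

text \<open>Integral of an extended-real function (used for functions bounded from below).\<close>
definition eintegral :: "'b measure \<Rightarrow> ('b \<Rightarrow> ereal) \<Rightarrow> ereal" where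
  "eintegral M f = enn2ereal (\<integral>\<^sup>+ x. e2ennreal (f x) \<partial>M) - enn2ereal (\<integral>\<^sup>+ x. e2ennreal (- f x) \<partial>M)"

definition alpha_n :: "('a::topological_space measure \<Rightarrow> ereal) \<Rightarrow> nat \<Rightarrow> (nat \<Rightarrow> 'a) measure \<Rightarrow> ereal" where
  "alpha_n \<alpha> n \<nu> = eintegral \<nu> (\<lambda>x. \<Sum>k<n. \<alpha> (cond_law \<nu> ({..<n} - {k}) k (restrict x ({..<n} - {k}))))"

definition alpha_hat_n :: "('a::topological_space measure \<Rightarrow> ereal) \<Rightarrow> nat \<Rightarrow> (nat \<Rightarrow> 'a) measure \<Rightarrow> ereal" where
  "alpha_hat_n \<alpha> n \<nu> = eintegral \<nu> (\<lambda>x. \<Sum>k<n. \<alpha> (cond_law \<nu> {..<k} k (restrict x {..<k})))"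

definition rho_n :: "('a::topological_space measure \<Rightarrow> ereal) \<Rightarrow> nat \<Rightarrow> ((nat \<Rightarrow> 'a) \<Rightarrow> real) \<Rightarrow> ereal" where
  "rho_n \<alpha> n f = (SUP \<nu> \<in> space (prob_algebra (prodE {..<n})). ereal (\<integral>x. f x \<partial>\<nu>) - alpha_n \<alpha> n \<nu>)"

definition rho_hat_n :: "('a::topological_space measure \<Rightarrow> ereal) \<Rightarrow> nat \<Rightarrow> ((nat \<Rightarrow> 'a) \<Rightarrow> real) \<Rightarrow> ereal" where
  "rho_hat_n \<alpha> n f = (SUP \<nu> \<in> space (prob_algebra (prodE {..<n})). ereal (\<integral>x. f x \<partial>\<nu>) - alpha_hat_n \<alpha> n \<nu>)"

definition bdd_lip1 :: "nat \<Rightarrow> ((nat \<Rightarrow> 'a::metric_space) \<Rightarrow> real) \<Rightarrow> bool" where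
  "bdd_lip1 n f \<longleftrightarrow> f \<in> borel_measurable (prodE {..<n}) \<and>
     bounded (f ` space (prodE {..<n})) \<and>
     (\<forall>x \<in> space (prodE {..<n}). \<forall>y \<in> space (prodE {..<n}). \<bar>f x - f y\<bar> \<le> dist_n n x y)"

end

theory Submission
  imports Defs
begin

text \<open>
  Both conditions on \<open>E\<^sup>n\<close> are tied to \<open>W\<^sub>2\<close> by a finite discretisation: a nearest-point map
  \<open>T\<close> with finite range moves a measure with finite second moment by an arbitrarily small
  \<open>L\<^sup>2\<close> amount, and couplings of the discretised laws lift back to couplings of the original measures.

  From \<open>W\<^sub>2\<close> to the product inequalities: couple the words \<open>T x\<^sub>1 \<dots> T x\<^sub>n\<close> one letter at a time, Knothe
  style. Conditionally on the past letters the next coordinate is a mixture of the conditional laws,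
  so convexity of \<open>W\<^sub>2\<^sup>2(\<mu>, \<cdot>)\<close> bounds the cost of each step. Since the mixture may run over any
  coordinates besides the past ones, this treats \<open>\<alpha>\<^sub>n\<close> and its sequential variant at once, and
  \<open>W\<^sub>1 \<le> W\<^sub>2\<close> by Cauchy-Schwarz. Optimising over \<open>\<lambda>\<close> relates the \<open>W\<^sub>1\<close> and the \<open>\<rho>\<close> inequalities.

  Conversely, test the \<open>\<rho>\<close> inequality on \<open>\<nu>\<^sup>n\<close>, for which the conditional laws are a.s. \<open>\<nu>\<close>, with the
  truncated distance to the set of words typical for \<open>\<mu>\<close>. This yields a \<open>\<mu>\<close>-typical and a \<open>\<nu>\<close>-typical
  word at distance about \<open>(n C \<alpha>(\<nu>))\<^sup>1\<^sup>/\<^sup>2\<close>; the empirical measure of the pairs of letters is nearly a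
  coupling of the discretised measures, and compactness makes it exact.
\<close>

text \<open>What shapes the proof is measurability and attainment. Gluing optimal couplings of \<mu>
  with the conditional laws would require choosing them measurably, and a limit of empirical
  couplings would require tightness. With maps of finite range only finitely many couplings are
  chosen, each optimal up to a small error, and limits are taken in a finite-dimensional space. The
  price is the triangle inequality for squared distances: a factor \<open>1 + \<delta>\<close> on
  the main term and a factor of order \<open>1 / \<delta>\<close> on the discretisation errors.
  Hence \<delta> is fixed before the finite-range map, and the sharp constant \<open>C\<close>
  survives as \<delta> tends to 0.

  Such a map needs second moments, which are assumed of \<mu> only; for the other measures they are
  derived from the inequality at hand.

  The two functionals differ in the set \<open>S n k\<close> of conditioning coordinates. The
  coupling uses that it contains the past of \<open>k\<close>, the test on product measures that it
  omits \<open>k\<close>.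

  The term \<open>C * lam\<^sup>2 / 4\<close> is the convex conjugate of
  \<open>\<Delta>\<^sup>2 / C\<close>, so optimising over \<open>lam\<close> loses nothing.\<close>

abbreviation probs :: "'b measure \<Rightarrow> 'b measure set" where
  "probs M \<equiv> space (prob_algebra M)"

abbreviation sqd :: "'a::metric_space \<Rightarrow> 'a \<Rightarrow> ennreal" where
  "sqd x y \<equiv> ennreal ((dist x y)\<^sup>2)"

abbreviation sq_cost :: "('a::metric_space \<times> 'a) measure \<Rightarrow> ennreal" where
  "sq_cost \<gamma> \<equiv> \<integral>\<^sup>+z. sqd (fst z) (snd z) \<partial>\<gamma>"

abbreviation sq_err :: "('a::metric_space \<Rightarrow> 'a) \<Rightarrow> 'a measure \<Rightarrow> ennreal" where
  "sq_err T M \<equiv> \<integral>\<^sup>+x. sqd x (T x) \<partial>M"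

abbreviation sq_moment :: "'a::metric_space \<Rightarrow> 'a measure \<Rightarrow> ennreal" where
  "sq_moment x0 M \<equiv> \<integral>\<^sup>+x. sqd x x0 \<partial>M"

section \<open>Disintegration on Polish spaces\<close>

text \<open>Base 4 with digits 0 and 1 only leaves room: \<open>v k\<close> is the tail of the
  expansion after \<open>k\<close> digits, at most 1/3, so no carry can occur and the floor function
  recovers each digit. Binary expansions would be ambiguous.\<close>

lemma base4_digits:
  fixes b :: "nat \<Rightarrow> bool"
  defines "v \<equiv> \<lambda>k. \<Sum>j. of_bool (b (j + k)) * (1/4::real) ^ Suc j"
  shows base4_bounds: "0 \<le> v 0" "v 0 < 1"
    and base4_digit: "\<lfloor>4 ^ Suc k * v 0\<rfloor> mod 4 = of_bool (b k)"
proof -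
  have geo: "(\<lambda>j. (1/4::real) ^ Suc j) sums (1/3)"
    using geometric_sums[of "1/4::real"] sums_mult[of "\<lambda>j. (1/4::real)^j" "4/3" "1/4"] by simp
  have sm: "summable (\<lambda>j. of_bool (b (j + k)) * (1/4::real) ^ Suc j)" for k
    by (rule summable_comparison_test'[OF sums_summable[OF geo], of 0]) auto
  have nn: "0 \<le> v k" for k unfolding v_def by (rule suminf_nonneg[OF sm]) auto
  have le: "v k \<le> 1/3" for k
    unfolding v_def sums_unique[OF geo] by (rule suminf_le[OF _ sm sums_summable[OF geo]]) auto
  show "0 \<le> v 0" "v 0 < 1" using nn[of 0] le[of 0] by auto
  have step: "4 * v k = of_bool (b k) + v (Suc k)" for k
  proof -
    have "v k = (\<Sum>j. of_bool (b (Suc j + k)) * (1/4::real) ^ Suc (Suc j)) + of_bool (b k) * (1/4)"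
      unfolding v_def using suminf_split_head[OF sm[of k]] by simp
    also have "(\<Sum>j. of_bool (b (Suc j + k)) * (1/4::real) ^ Suc (Suc j)) = (\<Sum>j. 1/4 * (of_bool (b (j + Suc k)) * (1/4::real) ^ Suc j))"
      by (rule suminf_cong) simp
    also have "\<dots> = 1/4 * v (Suc k)" unfolding v_def by (rule suminf_mult[OF sm])
    finally show ?thesis by simp
  qed
  have rep: "\<exists>N::int. 4 ^ k * v 0 = of_int N + v k" for k
  proof (induction k)
    case 0 then show ?case by (intro exI[of _ 0]) simp
  next
    case (Suc k)
    then obtain N where "4 ^ k * v 0 = of_int N + v k" by auto
    then have "4 ^ Suc k * v 0 = of_int (4 * N + of_bool (b k)) + v (Suc k)"
      using step[of k] by simp
    then show ?case by blast
  qed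
  obtain N where "4 ^ k * v 0 = of_int N + v k" using rep by blast
  then have "4 ^ Suc k * v 0 = of_int (4 * N + of_bool (b k)) + v (Suc k)"
    using step[of k] by simp
  then have "\<lfloor>4 ^ Suc k * v 0\<rfloor> = 4 * N + of_bool (b k)"
    using nn[of "Suc k"] le[of "Suc k"] by (intro floor_unique) auto
  then show "\<lfloor>4 ^ Suc k * v 0\<rfloor> mod 4 = of_bool (b k)"
    by (cases "b k") (auto simp: mod_add_eq)
qed

text \<open>The base-4 digits of \<open>\<phi> y\<close> record which basic balls contain \<open>y\<close>; \<open>\<psi>\<close> recovers \<open>y\<close> as a
  limit of their centres. Thus no Borel isomorphism theorem is needed to transfer disintegrations
  from the real line.\<close>
lemma polish_real_retract:
  obtains \<phi> :: "'b::polish_space \<Rightarrow> real" and \<psi> :: "real \<Rightarrow> 'b"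
  where "\<phi> \<in> borel_measurable borel" "\<psi> \<in> borel_measurable borel"
    "\<And>y. 0 \<le> \<phi> y" "\<And>y. \<phi> y < 1" "\<And>y. \<psi> (\<phi> y) = y"
proof -
  obtain D :: "'b set" where D: "countable D" "\<And>X. open X \<Longrightarrow> X \<noteq> {} \<Longrightarrow> \<exists>d\<in>D. d \<in> X"
    using countable_dense_setE by metis
  have Dne: "D \<noteq> {}" using D(2)[of UNIV] by auto
  define q where "q = from_nat_into D"
  have q: "\<exists>i. dist y (q i) < e" if "e > 0" for y e
  proof -
    have "ball y e \<noteq> {}" using that by simp
    then obtain d where "d \<in> D" "d \<in> ball y e" using D(2)[OF open_ball] by blast
    then show ?thesis using D(1) Dne unfolding q_def
      by (metis from_nat_into_surj mem_ball)
  qed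
  define b where "b y j = (case prod_decode j of (i, m) \<Rightarrow> dist y (q i) < (1/2)^m)" for y j
  define \<phi> where "\<phi> y = (\<Sum>j. of_bool (b y (j + 0)) * (1/4::real) ^ Suc j)" for y
  \<comment> \<open>For \<open>r = \<phi> y\<close> this is the first centre at distance less than
    \<open>(1/2)^m\<close> from \<open>y\<close>. Off the range of \<phi> no such index need exist,
    and its value is then arbitrary.\<close>
  define I where "I r m = (LEAST i. \<lfloor>4 ^ Suc (prod_encode (i, m)) * r\<rfloor> mod 4 = 1)" for r :: real and m :: nat
  \<comment> \<open>Off the range of \<phi> the centres need not converge. The constant sequence put
    in their place makes \<psi> an everywhere defined limit of measurable maps.\<close>
  define s where "s r m = (if Cauchy (\<lambda>m. q (I r m)) then q (I r m) else q 0)" for r m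
  define \<psi> where "\<psi> r = lim (s r)" for r
  have [measurable]: "(\<lambda>y. b y j) \<in> borel \<rightarrow>\<^sub>M count_space UNIV" for j
    unfolding b_def by (cases "prod_decode j") (simp, measurable)
  have mphi: "\<phi> \<in> borel_measurable borel" unfolding \<phi>_def by measurable
  have [measurable]: "(\<lambda>r. I r m) \<in> borel \<rightarrow>\<^sub>M count_space UNIV" for m
    unfolding I_def by measurable
  have mq[measurable]: "(\<lambda>r. q (I r m)) \<in> borel_measurable borel" for m
    by (rule measurable_compose[of _ _ "count_space UNIV"]) measurable
  \<comment> \<open>With tolerances indexed by the naturals, the Cauchy condition uses countable
    quantifiers only and is therefore measurable.\<close>
  have Cau: "Measurable.pred borel (\<lambda>r. Cauchy (\<lambda>m. q (I r m)))"
    unfolding metric_Cauchy_iff2 by measurable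
  have ms: "(\<lambda>r. s r m) \<in> borel_measurable borel" for m
    unfolding s_def using Cau by measurable
  have "Cauchy (s r)" for r
  proof (cases "Cauchy (\<lambda>m. q (I r m))")
    case True
    then have "s r = (\<lambda>m. q (I r m))" unfolding s_def by auto
    then show ?thesis using True by simp
  next
    case False
    then have "s r = (\<lambda>_. q 0)" unfolding s_def by auto
    then show ?thesis by (simp add: convergent_Cauchy convergent_const)
  qed
  then have lim: "s r \<longlonglongrightarrow> \<psi> r" for r
    unfolding \<psi>_def using Cauchy_convergent convergent_LIMSEQ_iff by blast
  have mpsi: "\<psi> \<in> borel_measurable borel"
    by (rule borel_measurable_LIMSEQ_metric[OF ms lim])
  have inv: "\<psi> (\<phi> y) = y" for y
  proof -
    have "dist y (q (I (\<phi> y) m)) < (1/2)^m" for m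
    proof -
      have "(\<lfloor>4 ^ Suc (prod_encode (i, m)) * \<phi> y\<rfloor> mod 4 = 1) \<longleftrightarrow> dist y (q i) < (1/2)^m" for i
        unfolding \<phi>_def base4_digit by (simp add: b_def)
      then have "I (\<phi> y) m = (LEAST i. dist y (q i) < (1/2)^m)" unfolding I_def by simp
      then show ?thesis using LeastI_ex[OF q[of "(1/2)^m" y]] by simp
    qed
    then have le: "dist (q (I (\<phi> y) m)) y \<le> (1/2)^m" for m
      by (metis dist_commute less_imp_le)
    have "(\<lambda>m. dist (q (I (\<phi> y) m)) y) \<longlonglongrightarrow> 0"
      by (rule tendsto_sandwich[of "\<lambda>_. 0" _ _ "\<lambda>m. (1/2::real)^m"])
         (simp_all add: le LIMSEQ_power_zero)
    then have l: "(\<lambda>m. q (I (\<phi> y) m)) \<longlonglongrightarrow> y"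
      by (rule tendsto_dist_iff[THEN iffD2])
    then have "Cauchy (\<lambda>m. q (I (\<phi> y) m))" by (rule LIMSEQ_imp_Cauchy)
    then have "s (\<phi> y) = (\<lambda>m. q (I (\<phi> y) m))" unfolding s_def by auto
    then show ?thesis using lim[of "\<phi> y"] l LIMSEQ_unique by metis
  qed
  show ?thesis
    by (rule that[OF mphi mpsi _ _ inv]) (use base4_bounds[of "b _"] in \<open>auto simp: \<phi>_def\<close>)
qed

text \<open>Test the hypothesis on the set where \<open>f\<close> exceeds \<open>g\<close>: there
  \<open>f - g\<close> is positive but has integral 0. Finiteness of the integral of
  \<open>g\<close> permits subtracting the integrals.\<close>

lemma AE_le_if_set_nn_integral_le:
  assumes [measurable]: "f \<in> borel_measurable M" "g \<in> borel_measurable M"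
    and fin: "integral\<^sup>N M g < \<infinity>"
    and le: "\<And>A. A \<in> sets M \<Longrightarrow> (\<integral>\<^sup>+x. f x * indicator A x \<partial>M) \<le> (\<integral>\<^sup>+x. g x * indicator A x \<partial>M)"
  shows "AE x in M. f x \<le> g x"
proof -
  define A where "A = {x \<in> space M. g x < f x}"
  have A[measurable]: "A \<in> sets M" unfolding A_def by measurable
  have gf: "(\<integral>\<^sup>+x. g x * indicator A x \<partial>M) \<noteq> \<infinity>"
  proof -
    have "(\<integral>\<^sup>+x. g x * indicator A x \<partial>M) \<le> integral\<^sup>N M g"
      by (intro nn_integral_mono) (auto simp: indicator_def)
    then show ?thesis using fin by auto
  qed
  have "(\<integral>\<^sup>+x. f x * indicator A x - g x * indicator A x \<partial>M) = (\<integral>\<^sup>+x. f x * indicator A x \<partial>M) - (\<integral>\<^sup>+x. g x * indicator A x \<partial>M)"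
    by (intro nn_integral_diff gf AE_I2) (auto simp: A_def indicator_def)
  also have "\<dots> = 0"
    using le[OF A] gf by (simp add: diff_eq_0_iff_ennreal less_top order_le_less_trans)
  finally have "AE x in M. f x * indicator A x - g x * indicator A x = 0"
    by (subst (asm) nn_integral_0_iff_AE) auto
  then show ?thesis using AE_space
  proof eventually_elim
    case (elim x)
    then show ?case
      by (cases "x \<in> A") (auto simp: A_def diff_eq_0_iff_ennreal not_less)
  qed
qed

text \<open>Taking the infimum of clipped densities over the rationals above \<open>t\<close> makes \<open>F x\<close> a distribution
  function for every \<open>x\<close>, so no exceptional null set has to be removed.\<close>
lemma conditional_cdf:
  fixes Y :: "'p \<Rightarrow> real"
  assumes P: "prob_space P" and X[measurable]: "X \<in> P \<rightarrow>\<^sub>M N" and Y[measurable]: "Y \<in> borel_measurable P"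
    and Y01: "\<And>\<omega>. 0 \<le> Y \<omega>" "\<And>\<omega>. Y \<omega> < 1"
  obtains F where "\<And>t. (\<lambda>x. F x t) \<in> borel_measurable N"
    "\<And>x s t. s \<le> t \<Longrightarrow> F x s \<le> F x (t::real)"
    "\<And>x t. continuous (at_right t) (F x)"
    "\<And>x t. t < 0 \<Longrightarrow> F x t = 0" "\<And>x t. t \<ge> 1 \<Longrightarrow> F x t = (1::real)"
    "\<And>A t. A \<in> sets N \<Longrightarrow> (\<integral>\<^sup>+x. ennreal (F x t) * indicator A x \<partial>distr P N X) = emeasure P {\<omega> \<in> space P. X \<omega> \<in> A \<and> Y \<omega> \<le> t}"
proof -
  interpret P: prob_space P by fact
  define D where "D = distr P N X"
  interpret D: prob_space D unfolding D_def by (rule P.prob_space_distr) fact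
  have [measurable_cong]: "sets D = sets N" and spD: "space D = space N" by (simp_all add: D_def)
  define H where "H t A = emeasure P {\<omega> \<in> space P. X \<omega> \<in> A \<and> Y \<omega> \<le> t}" for t A
  \<comment> \<open>\<open>M t\<close> is the joint law of \<open>X\<close> and the event
    \<open>Y \<le> t\<close>. It is dominated by the law \<open>D\<close> of \<open>X\<close>, and
    its density \<open>g t\<close> is a version of the conditional distribution function at
    \<open>t\<close>.\<close>
  define M where "M t = distr (density P (indicator {\<omega> \<in> space P. Y \<omega> \<le> t})) N X" for t
  have MH: "emeasure (M t) A = H t A" if [measurable]: "A \<in> sets N" for t A
  proof -
    have "emeasure (M t) A = (\<integral>\<^sup>+\<omega>. indicator {\<omega> \<in> space P. Y \<omega> \<le> t} \<omega> * indicator (X -` A \<inter> space P) \<omega> \<partial>P)"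
      unfolding M_def by (simp add: emeasure_distr emeasure_density)
    also have "\<dots> = (\<integral>\<^sup>+\<omega>. indicator {\<omega> \<in> space P. X \<omega> \<in> A \<and> Y \<omega> \<le> t} \<omega> \<partial>P)"
      by (intro nn_integral_cong) (auto simp: indicator_def)
    finally show ?thesis by (simp add: H_def)
  qed
  have DA: "emeasure D A = emeasure P {\<omega> \<in> space P. X \<omega> \<in> A}" if [measurable]: "A \<in> sets N" for A
    unfolding D_def by (simp add: emeasure_distr vimage_def Int_def conj_commute)
  have HD: "H t A \<le> emeasure D A" if [measurable]: "A \<in> sets N" for t A
    unfolding H_def DA[OF that] by (intro emeasure_mono) auto
  define g where "g t = RN_deriv D (M t)" for t
  have g[measurable]: "g t \<in> borel_measurable N" for t
    using borel_measurable_RN_deriv[of D "M t"] unfolding g_def by simp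
  have gH: "(\<integral>\<^sup>+x. g t x * indicator A x \<partial>D) = H t A" if [measurable]: "A \<in> sets N" for t A
  proof -
    have "absolutely_continuous D (M t)" unfolding absolutely_continuous_def
    proof
      fix B assume "B \<in> null_sets D"
      then have "B \<in> sets N" "emeasure D B = 0" by (auto simp: null_sets_def D_def)
      then show "B \<in> null_sets (M t)" using MH[of B t] HD[of B t] by (auto simp: null_sets_def M_def)
    qed
    then have "density D (g t) = M t" unfolding g_def
      by (rule D.density_RN_deriv) (simp add: M_def D_def)
    then show ?thesis using MH[of A t] by (metis emeasure_density g that \<open>sets D = sets N\<close> measurable_cong_sets)
  qed
  have gfin: "integral\<^sup>N D (g t) < \<infinity>" for t
  proof -
    have "integral\<^sup>N D (g t) = (\<integral>\<^sup>+x. g t x * indicator (space N) x \<partial>D)"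
      by (intro nn_integral_cong) (simp add: spD)
    also have "\<dots> \<le> emeasure D (space N)" using gH[of "space N" t] HD[of "space N" t] by simp
    finally show ?thesis by (rule order_le_less_trans) (simp add: less_top[symmetric])
  qed
  \<comment> \<open>Since \<open>Y\<close> takes values in \<open>[0, 1)\<close>, the forced values
    0 and 1 agree almost everywhere with \<open>g q\<close>. Imposing them for every
    \<open>x\<close> gives \<open>F x\<close> the right limits at both ends without
    exception.\<close>
  define G where "G q x = (if q < 0 then 0 else if q \<ge> 1 then 1 else min 1 (enn2real (g q x)))" for q :: real and x
  have [measurable]: "G q \<in> borel_measurable N" for q
    unfolding G_def by (cases "q < 0"; cases "q \<ge> 1") simp_all
  have G01: "0 \<le> G q x" "G q x \<le> 1" for q x unfolding G_def by auto
  have Gg: "AE x in D. ennreal (G q x) = g q x" for q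
  proof -
    consider "q < 0" | "q \<ge> 1" | "0 \<le> q" "q < 1" by linarith
    then show ?thesis
    proof cases
      case 1
      have "AE x in D. g q x \<le> 0"
      proof (rule AE_le_if_set_nn_integral_le)
        fix A assume "A \<in> sets D"
        then have A: "A \<in> sets N" by (simp add: D_def)
        have e: "{\<omega> \<in> space P. X \<omega> \<in> A \<and> Y \<omega> \<le> q} = {}" using Y01(1) 1 by (auto simp: not_le) (meson less_le_trans not_less)
        then show "(\<integral>\<^sup>+x. g q x * indicator A x \<partial>D) \<le> (\<integral>\<^sup>+x. 0 * indicator A x \<partial>D)"
          unfolding gH[OF A] H_def e by simp
      qed auto
      then show ?thesis by eventually_elim (use 1 in \<open>simp add: G_def\<close>)
    next
      case 2
      have H1: "H q A = emeasure D A" if "A \<in> sets N" for A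
        unfolding H_def DA[OF that] using Y01(2) 2 by (intro arg_cong[of _ _ "emeasure P"]) (auto intro: less_imp_le less_le_trans)
      have "AE x in D. g q x \<le> 1"
      proof (rule AE_le_if_set_nn_integral_le)
        fix A assume "A \<in> sets D"
        then have A: "A \<in> sets N" by (simp add: D_def)
        then show "(\<integral>\<^sup>+x. g q x * indicator A x \<partial>D) \<le> (\<integral>\<^sup>+x. 1 * indicator A x \<partial>D)"
          unfolding gH[OF A] using H1[OF A] by (simp add: D_def)
      qed (auto simp: D.emeasure_space_1)
      moreover have "AE x in D. 1 \<le> g q x"
      proof (rule AE_le_if_set_nn_integral_le)
        fix A assume "A \<in> sets D"
        then have A: "A \<in> sets N" by (simp add: D_def)
        then show "(\<integral>\<^sup>+x. 1 * indicator A x \<partial>D) \<le> (\<integral>\<^sup>+x. g q x * indicator A x \<partial>D)"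
          unfolding gH[OF A] using H1[OF A] by (simp add: D_def)
      qed (use gfin in auto)
      ultimately show ?thesis by eventually_elim (use 2 in \<open>simp add: G_def\<close>)
    next
      case 3
      have "AE x in D. g q x \<le> 1"
      proof (rule AE_le_if_set_nn_integral_le)
        fix A assume "A \<in> sets D"
        then have A: "A \<in> sets N" by (simp add: D_def)
        then show "(\<integral>\<^sup>+x. g q x * indicator A x \<partial>D) \<le> (\<integral>\<^sup>+x. 1 * indicator A x \<partial>D)"
          unfolding gH[OF A] using HD[OF A] by (simp add: D_def)
      qed (auto simp: D.emeasure_space_1)
      then show ?thesis
      proof eventually_elim
        case (elim x)
        then obtain r where "g q x = ennreal r" "0 \<le> r" by (cases "g q x") (auto simp: top_unique)
        then show ?case using elim 3 by (simp add: G_def)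
      qed
    qed
  qed
  have gmono: "AE x in D. g s x \<le> g t x" if "s \<le> t" for s t
  proof (rule AE_le_if_set_nn_integral_le)
    fix A assume "A \<in> sets D"
    then have A[measurable]: "A \<in> sets N" by (simp add: D_def)
    show "(\<integral>\<^sup>+x. g s x * indicator A x \<partial>D) \<le> (\<integral>\<^sup>+x. g t x * indicator A x \<partial>D)"
      unfolding gH[OF A] H_def by (intro emeasure_mono) (use that in auto)
  qed (use gfin in auto)
  \<comment> \<open>The inequality is strict: the infimum over rationals strictly above
    \<open>t\<close> is automatically continuous from the right.\<close>
  define Q where "Q t = {q \<in> \<rat>. t < (q::real)}" for t
  have Qc: "countable (Q t)" for t unfolding Q_def by (rule countable_subset[OF _ countable_rat]) auto
  have Qne: "Q t \<noteq> {}" for t using Rats_dense_in_real[of t "t + 1"] unfolding Q_def by auto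
  define F where "F x t = (INF q\<in>Q t. G q x)" for x t
  have bdd: "bdd_below ((\<lambda>q. G q x) ` A)" for A x by (rule bdd_belowI2[of _ 0]) (rule G01)
  have F_le: "F x t \<le> G q x" if "q \<in> \<rat>" "t < q" for x t q
    unfolding F_def by (rule cINF_lower[OF bdd]) (use that in \<open>simp add: Q_def\<close>)
  have F_ge: "c \<le> F x t" if "\<And>q. q \<in> Q t \<Longrightarrow> c \<le> G q x" for x t c
    unfolding F_def by (rule cINF_greatest[OF Qne that])
  show thesis
  proof (rule that[of F])
    show "(\<lambda>x. F x t) \<in> borel_measurable N" for t
      unfolding F_def by (rule borel_measurable_cINF_real[OF Qc]) measurable
    show mono: "F x s \<le> F x t" if "s \<le> t" for x s t
      by (rule F_ge) (use that in \<open>auto simp: Q_def intro!: F_le\<close>)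
    show "continuous (at_right t) (F x)" for x t
      unfolding continuous_within
    proof (rule tendstoI)
      fix e :: real assume "e > 0"
      have "\<exists>q\<in>Q t. G q x < F x t + e"
        
      proof (rule ccontr)
        assume "\<not> ?thesis"
        then have "F x t + e \<le> F x t" by (intro F_ge) (auto simp: not_less)
        then show False using \<open>e > 0\<close> by simp
      qed
      then obtain q where q: "q \<in> \<rat>" "t < q" "G q x < F x t + e" unfolding Q_def by auto
      have "dist (F x s) (F x t) < e" if "t < s" "s < q" for s
        using F_le[OF q(1) that(2), of x] mono[of t s x] that q(3) by (simp add: dist_real_def)
      then show "\<forall>\<^sub>F s in at_right t. dist (F x s) (F x t) < e"
        unfolding eventually_at_right[OF q(2)] using q(2) by blast
    qed
    show "F x t = 0" if "t < 0" for x t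
    proof (rule antisym)
      obtain q where "q \<in> \<rat>" "t < q" "q < 0" using Rats_dense_in_real[OF \<open>t < 0\<close>] by auto
      then show "F x t \<le> 0" using F_le[of q t x] by (simp add: G_def)
      show "0 \<le> F x t" by (rule F_ge) (rule G01)
    qed
    show "F x t = 1" if "t \<ge> 1" for x t
    proof (rule antisym)
      show "1 \<le> F x t" by (rule F_ge) (use that in \<open>auto simp: Q_def G_def\<close>)
      obtain q where "q \<in> \<rat>" "t < q" using Rats_dense_in_real[of t "t + 1"] by auto
      then show "F x t \<le> 1" using F_le[of q t x] G01(2)[of q x] by simp
    qed
    fix A t assume A[measurable]: "A \<in> sets N"
    have up: "(\<integral>\<^sup>+x. ennreal (F x t) * indicator A x \<partial>D) \<le> H q A" if "q \<in> \<rat>" "t < q" for q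
    proof -
      have "(\<integral>\<^sup>+x. ennreal (F x t) * indicator A x \<partial>D) \<le> (\<integral>\<^sup>+x. g q x * indicator A x \<partial>D)"
      proof (rule nn_integral_mono_AE)
        show "AE x in D. ennreal (F x t) * indicator A x \<le> g q x * indicator A x"
          using Gg[of q]
        proof eventually_elim
          case (elim x)
          then show ?case using ennreal_leI[OF F_le[OF that, of x]] by (auto simp: indicator_def)
        qed
      qed
      then show ?thesis using gH[OF A] by simp
    qed
    \<comment> \<open>\<open>Q t\<close> is countable, so all comparisons hold outside one null set
      and pass to the infimum. This null set may depend on \<open>t\<close>, because the identity to
      be shown is integrated for each \<open>t\<close> separately.\<close>
    have "AE x in D. \<forall>q\<in>Q t. g t x \<le> ennreal (G q x)"
      unfolding AE_ball_countable[OF Qc]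
    proof
      fix q assume "q \<in> Q t"
      then have "t \<le> q" by (simp add: Q_def)
      show "AE x in D. g t x \<le> ennreal (G q x)" using gmono[OF \<open>t \<le> q\<close>] Gg[of q] by eventually_elim simp
    qed
    then have "AE x in D. g t x * indicator A x \<le> ennreal (F x t) * indicator A x"
    proof eventually_elim
      case (elim x)
      obtain q where "q \<in> Q t" using Qne by blast
      then have "g t x \<noteq> \<top>" using elim by (metis ennreal_neq_top neq_top_trans)
      then obtain r where r: "g t x = ennreal r" "0 \<le> r" by (cases "g t x") auto
      have "r \<le> F x t" using elim r by (intro F_ge) (simp add: G01)
      then show ?case using r by (auto simp: indicator_def ennreal_leI)
    qed
    then have lo: "H t A \<le> (\<integral>\<^sup>+x. ennreal (F x t) * indicator A x \<partial>D)"
      unfolding gH[OF A, symmetric] by (rule nn_integral_mono_AE)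
    \<comment> \<open>The upper bound is available only at rationals \<open>q\<close> above
      \<open>t\<close>; continuity from above of the probability closes the gap as \<open>q\<close>
      decreases to \<open>t\<close>.\<close>
    define S where "S n = {\<omega> \<in> space P. X \<omega> \<in> A \<and> Y \<omega> \<le> t + 1 / Suc n}" for n
    have "(\<lambda>n. emeasure P (S n)) \<longlonglongrightarrow> emeasure P (\<Inter>n. S n)"
    proof (rule Lim_emeasure_decseq)
      show "range S \<subseteq> sets P" unfolding S_def by auto
      show "decseq S" unfolding decseq_def S_def
        by (auto intro: order_trans simp: divide_left_mono frac_le)
    qed simp
    also have "(\<Inter>n. S n) = {\<omega> \<in> space P. X \<omega> \<in> A \<and> Y \<omega> \<le> t}"
    proof -
      have "y \<le> t" if "\<And>n. y \<le> t + 1 / Suc n" for y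
      proof (rule LIMSEQ_le_const)
        show "(\<lambda>n. t + 1 / Suc n) \<longlonglongrightarrow> t" using tendsto_add[OF tendsto_const lim_1_over_n[THEN LIMSEQ_Suc], of t] by simp
      qed (use that in auto)
      moreover have "y \<le> t \<Longrightarrow> y \<le> t + 1 / Suc n" for y n by (rule order_trans) auto
      ultimately show ?thesis unfolding S_def by auto
    qed
    finally have lim: "(\<lambda>n. emeasure P (S n)) \<longlonglongrightarrow> H t A" unfolding H_def .
    have "(\<integral>\<^sup>+x. ennreal (F x t) * indicator A x \<partial>D) \<le> H t A"
    proof (rule LIMSEQ_le_const[OF lim], intro exI allI impI)
      fix n
      obtain q where q: "q \<in> \<rat>" "t < q" "q < t + 1 / Suc n" using Rats_dense_in_real[of t "t + 1 / Suc n"] by auto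
      have "H q A \<le> emeasure P (S n)" unfolding H_def S_def by (intro emeasure_mono) (use q(3) in auto)
      then show "(\<integral>\<^sup>+x. ennreal (F x t) * indicator A x \<partial>D) \<le> emeasure P (S n)"
        using up[OF q(1,2)] by simp
    qed
    then show "(\<integral>\<^sup>+x. ennreal (F x t) * indicator A x \<partial>distr P N X) = emeasure P {\<omega> \<in> space P. X \<omega> \<in> A \<and> Y \<omega> \<le> t}"
      using lo unfolding D_def H_def by simp
  qed
qed

text \<open>Each distribution function defines a law through \<open>interval_measure\<close>. For
  fixed \<open>A\<close> both sides are finite measures in \<open>B\<close> (\<open>M1\<close> and
  \<open>M2\<close> below) that agree on half-lines, an intersection-stable generator.\<close>

lemma real_disintegration:
  fixes Y :: "'p \<Rightarrow> real"
  assumes P: "prob_space P" and X[measurable]: "X \<in> P \<rightarrow>\<^sub>M N" and Y[measurable]: "Y \<in> borel_measurable P"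
    and Y01: "\<And>\<omega>. 0 \<le> Y \<omega>" "\<And>\<omega>. Y \<omega> < 1"
  obtains K where "K \<in> N \<rightarrow>\<^sub>M prob_algebra borel"
    "\<And>A B. A \<in> sets N \<Longrightarrow> B \<in> sets borel \<Longrightarrow> emeasure P {\<omega> \<in> space P. X \<omega> \<in> A \<and> Y \<omega> \<in> B}
       = (\<integral>\<^sup>+\<omega>. indicator A (X \<omega>) * emeasure (K (X \<omega>)) B \<partial>P)"
proof -
  interpret P: prob_space P by fact
  from conditional_cdf[OF P X Y Y01] obtain F where F[measurable]: "\<And>t. (\<lambda>x. F x t) \<in> borel_measurable N"
    and mono: "\<And>x s t. s \<le> t \<Longrightarrow> F x s \<le> F x (t::real)"
    and rc: "\<And>x t. continuous (at_right t) (F x)"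
    and F0: "\<And>x t. t < 0 \<Longrightarrow> F x t = 0" and F1: "\<And>x t. t \<ge> 1 \<Longrightarrow> F x t = (1::real)"
    and int: "\<And>A t. A \<in> sets N \<Longrightarrow> (\<integral>\<^sup>+x. ennreal (F x t) * indicator A x \<partial>distr P N X) = emeasure P {\<omega> \<in> space P. X \<omega> \<in> A \<and> Y \<omega> \<le> t}"
    by blast
  define K where "K x = interval_measure (F x)" for x
  have bot: "(F x \<longlongrightarrow> 0) at_bot" for x
    by (rule tendsto_eventually) (auto simp: eventually_at_bot_linorder F0 intro!: exI[of _ "-1"])
  have top: "(F x \<longlongrightarrow> 1) at_top" for x
    by (rule tendsto_eventually) (auto simp: eventually_at_top_linorder F1 intro!: exI[of _ "1"])
  have rd: "real_distribution (K x)" for x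
    unfolding K_def by (rule real_distribution_interval_measure[OF mono rc bot top])
  have KF: "emeasure (K x) {..t} = ennreal (F x t)" for x t
    unfolding K_def by (rule emeasure_interval_measure_Iic[OF mono rc bot])
  have gen: "sets borel = sigma_sets UNIV (range (\<lambda>a::real. {..a}))"
    by (subst borel_eq_atMost) simp
  have stab: "Int_stable (range (\<lambda>a::real. {..a}))"
    by (auto simp: Int_stable_def)
  have K[measurable]: "K \<in> N \<rightarrow>\<^sub>M prob_algebra borel"
  proof (rule measurable_prob_algebra_generated[OF gen stab])
    show "prob_space (K x)" for x using rd[of x] by (simp add: real_distribution_def)
    show "sets (K x) = sets borel" for x by (simp add: K_def)
    show "(\<lambda>x. emeasure (K x) A) \<in> borel_measurable N" if "A \<in> range (\<lambda>a. {..a})" for A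
      using that by (auto simp: KF)
  qed auto
  have KS: "K \<in> N \<rightarrow>\<^sub>M subprob_algebra borel" by (rule measurable_prob_algebraD[OF K])
  have [measurable]: "(\<lambda>x. emeasure (K x) B) \<in> borel_measurable N" if "B \<in> sets borel" for B
    using measurable_compose[OF KS measurable_emeasure_subprob_algebra[OF that]] .
  show thesis
  proof (rule that[OF K])
    fix A B assume A[measurable]: "A \<in> sets N" and B[measurable]: "B \<in> sets (borel :: real measure)"
    define M1 where "M1 = distr (density P (indicator {\<omega> \<in> space P. X \<omega> \<in> A})) borel Y"
    define DA where "DA = density (distr P N X) (indicator A)"
    define M2 where "M2 = DA \<bind> K"
    have [measurable_cong]: "sets DA = sets N" by (simp add: DA_def)
    have M1: "emeasure M1 C = emeasure P {\<omega> \<in> space P. X \<omega> \<in> A \<and> Y \<omega> \<in> C}" if [measurable]: "C \<in> sets borel" for C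
    proof -
      have "emeasure M1 C = (\<integral>\<^sup>+\<omega>. indicator {\<omega> \<in> space P. X \<omega> \<in> A} \<omega> * indicator (Y -` C \<inter> space P) \<omega> \<partial>P)"
        unfolding M1_def by (simp add: emeasure_distr emeasure_density)
      also have "\<dots> = (\<integral>\<^sup>+\<omega>. indicator {\<omega> \<in> space P. X \<omega> \<in> A \<and> Y \<omega> \<in> C} \<omega> \<partial>P)"
        by (intro nn_integral_cong) (auto simp: indicator_def)
      finally show ?thesis by simp
    qed
    have ne: "space DA \<noteq> {}"
      using P.not_empty measurable_space[OF X] by (auto simp: DA_def)
    have M2: "emeasure M2 C = (\<integral>\<^sup>+x. indicator A x * emeasure (K x) C \<partial>distr P N X)" if [measurable]: "C \<in> sets borel" for C
    proof -
      have "emeasure M2 C = (\<integral>\<^sup>+x. emeasure (K x) C \<partial>DA)"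
        unfolding M2_def by (rule emeasure_bind[OF ne _ that]) (use KS in \<open>simp add: measurable_cong_sets[OF \<open>sets DA = sets N\<close> refl]\<close>)
      then show ?thesis unfolding DA_def by (subst (asm) nn_integral_density) auto
    qed
    have "M1 = M2"
    proof (rule measure_eqI_generator_eq[OF stab, where \<Omega>=UNIV and A="\<lambda>i. {..real i}"])
      fix S assume "S \<in> range (\<lambda>a::real. {..a})"
      then obtain t where S: "S = {..t}" by auto
      then show "emeasure M1 S = emeasure M2 S"
        using int[OF A, of t] by (simp add: M1 M2 KF mult.commute)
    next
      show "sets M1 = sigma_sets UNIV (range (\<lambda>a::real. {..a}))" by (simp add: M1_def gen)
      show "sets M2 = sigma_sets UNIV (range (\<lambda>a::real. {..a}))"
        unfolding gen[symmetric] M2_def by (rule sets_bind[OF _ ne]) (simp add: K_def)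
      show "(\<Union>i. {..real i}) = UNIV" by (auto intro: real_arch_simple)
      show "emeasure M1 {..real i} \<noteq> \<infinity>" for i by (simp add: M1)
    qed auto
    then show "emeasure P {\<omega> \<in> space P. X \<omega> \<in> A \<and> Y \<omega> \<in> B} = (\<integral>\<^sup>+\<omega>. indicator A (X \<omega>) * emeasure (K (X \<omega>)) B \<partial>P)"
      using M1[OF B] M2[OF B] by (simp add: nn_integral_distr)
  qed
qed

text \<open>Disintegrate the real variable \<open>\<phi> (Y \<omega>)\<close> and push the kernel
  forward by \<psi>. The identity \<open>\<psi> (\<phi> y) = y\<close> suffices, since then
  \<open>\<phi> (Y \<omega>)\<close> lies in the preimage of \<open>B\<close> under \<psi> exactly
  when \<open>Y \<omega>\<close> lies in \<open>B\<close>.\<close>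

theorem polish_disintegration:
  fixes Y :: "'p \<Rightarrow> 'b::polish_space"
  assumes P: "prob_space P" and X[measurable]: "X \<in> P \<rightarrow>\<^sub>M N" and Y[measurable]: "Y \<in> borel_measurable P"
  obtains K where "K \<in> N \<rightarrow>\<^sub>M prob_algebra borel"
    "\<And>A B. A \<in> sets N \<Longrightarrow> B \<in> sets borel \<Longrightarrow> emeasure P {\<omega> \<in> space P. X \<omega> \<in> A \<and> Y \<omega> \<in> B}
       = (\<integral>\<^sup>+\<omega>. indicator A (X \<omega>) * emeasure (K (X \<omega>)) B \<partial>P)"
proof -
  obtain \<phi> :: "'b \<Rightarrow> real" and \<psi> where [measurable]: "\<phi> \<in> borel_measurable borel" and \<psi>[measurable]: "\<psi> \<in> borel_measurable borel"
    and \<phi>: "\<And>y. 0 \<le> \<phi> y" "\<And>y. \<phi> y < 1" "\<And>y. \<psi> (\<phi> y) = y" by (metis polish_real_retract)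
  have "(\<lambda>\<omega>. \<phi> (Y \<omega>)) \<in> borel_measurable P" by measurable
  from real_disintegration[OF P X this \<phi>(1,2)] obtain K where K: "K \<in> N \<rightarrow>\<^sub>M prob_algebra borel"
    and eq: "\<And>A B. A \<in> sets N \<Longrightarrow> B \<in> sets borel \<Longrightarrow> emeasure P {\<omega> \<in> space P. X \<omega> \<in> A \<and> \<phi> (Y \<omega>) \<in> B}
       = (\<integral>\<^sup>+\<omega>. indicator A (X \<omega>) * emeasure (K (X \<omega>)) B \<partial>P)" by blast
  show thesis
  proof (rule that[of "\<lambda>x. distr (K x) borel \<psi>"])
    show "(\<lambda>x. distr (K x) borel \<psi>) \<in> N \<rightarrow>\<^sub>M prob_algebra borel"
      by (rule measurable_compose[OF K measurable_distr_prob_space[OF \<psi>]])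
    fix A B assume A: "A \<in> sets N" and B: "B \<in> sets (borel :: 'b measure)"
    have B': "\<psi> -` B \<in> sets borel" using measurable_sets[OF \<psi> B] by simp
    have "emeasure (distr (K (X \<omega>)) borel \<psi>) B = emeasure (K (X \<omega>)) (\<psi> -` B)" if "\<omega> \<in> space P" for \<omega>
    proof -
      have "K (X \<omega>) \<in> probs borel" using measurable_space[OF K measurable_space[OF X that]] .
      then have s: "sets (K (X \<omega>)) = sets borel" by (simp add: space_prob_algebra)
      then have "\<psi> \<in> K (X \<omega>) \<rightarrow>\<^sub>M borel" using \<psi> measurable_cong_sets[OF s refl] by blast
      then show ?thesis using sets_eq_imp_space_eq[OF s] B by (simp add: emeasure_distr)
    qed
    then show "emeasure P {\<omega> \<in> space P. X \<omega> \<in> A \<and> Y \<omega> \<in> B} = (\<integral>\<^sup>+\<omega>. indicator A (X \<omega>) * emeasure (distr (K (X \<omega>)) borel \<psi>) B \<partial>P)"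
      using eq[OF A B'] by (simp add: \<phi>(3) cong: nn_integral_cong)
  qed
qed

text \<open>\<open>cond_law\<close> is a Hilbert choice and says something only once a conditional
  law is known to exist; completeness and separability of the space enter here.\<close>

lemma is_cond_law_cond_law:
  fixes \<nu> :: "(nat \<Rightarrow> 'a::polish_space) measure"
  assumes nu: "\<nu> \<in> probs (prodE I)" and S: "S \<subseteq> I" and k: "k \<in> I"
  shows "is_cond_law \<nu> S k (cond_law \<nu> S k)"
proof -
  have P: "prob_space \<nu>" and s[measurable_cong]: "sets \<nu> = sets (prodE I)" using nu by (auto simp: space_prob_algebra)
  have X: "(\<lambda>x. restrict x S) \<in> \<nu> \<rightarrow>\<^sub>M prodE S"
    unfolding measurable_cong_sets[OF s refl] prodE_def by (rule measurable_restrict_subset[OF S])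
  have Y: "(\<lambda>x. x k) \<in> borel_measurable \<nu>"
    unfolding measurable_cong_sets[OF s refl] prodE_def by (rule measurable_component_singleton[OF k])
  from polish_disintegration[OF P X Y] obtain K where "K \<in> prodE S \<rightarrow>\<^sub>M prob_algebra borel"
    "\<And>A B. A \<in> sets (prodE S) \<Longrightarrow> B \<in> sets borel \<Longrightarrow> emeasure \<nu> {x \<in> space \<nu>. restrict x S \<in> A \<and> x k \<in> B}
       = (\<integral>\<^sup>+x. indicator A (restrict x S) * emeasure (K (restrict x S)) B \<partial>\<nu>)" by blast
  then have "is_cond_law \<nu> S k K" unfolding is_cond_law_def by blast
  then show ?thesis unfolding cond_law_def by (rule someI[of "is_cond_law \<nu> S k"])
qed

text \<open>Finite intersections from a countable base; the empty intersection contributes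
  \<open>UNIV\<close>. Countability allows equality of two kernels to be checked outside a single
  null set.\<close>

lemma countable_Int_stable_generator_borel:
  obtains G :: "'a::second_countable_topology set set" where "countable G" "Int_stable G" "UNIV \<in> G" "sets borel = sigma_sets UNIV G"
proof -
  obtain B :: "'a set set" where B: "countable B" "topological_basis B" using ex_countable_basis by blast
  define G where "G = (\<lambda>F. \<Inter>F) ` {F. finite F \<and> F \<subseteq> B}"
  have "countable G" unfolding G_def by (intro countable_image countable_Collect_finite_subset B)
  moreover have "Int_stable G" unfolding Int_stable_def G_def
    by (auto simp: Inter_Un_distrib[symmetric] intro!: imageI)
  moreover have "UNIV \<in> G" unfolding G_def by (auto intro!: image_eqI[of _ _ "{}"])
  moreover have "sets borel = sigma_sets UNIV G"
  proof
    have "sets borel = sigma_sets UNIV B" by (subst borel_eq_countable_basis[OF B]) simp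
    also have "\<dots> \<subseteq> sigma_sets UNIV G"
      by (rule sigma_sets_mono') (auto simp: G_def intro!: image_eqI[of _ _ "{_}"])
    finally show "sets borel \<subseteq> sigma_sets UNIV G" .
    have "G \<subseteq> sets borel"
    proof
      fix g assume "g \<in> G"
      then obtain F where F: "finite F" "F \<subseteq> B" "g = \<Inter>F" unfolding G_def by auto
      then have "open g" using topological_basis_open[OF B(2)] by (auto intro!: open_Inter)
      then show "g \<in> sets borel" by simp
    qed
    then show "sigma_sets UNIV G \<subseteq> sets borel" using sets.sigma_sets_subset[of G borel] by simp
  qed
  ultimately show thesis by (rule that)
qed

text \<open>For fixed \<open>B\<close> both kernels are densities of the same measure with respect
  to the law of the restriction, so they agree almost everywhere; a countable generator makes the
  null set independent of \<open>B\<close>. The functionals are built from an unspecified version of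
  the conditional law, which this lemma makes computable.\<close>

lemma is_cond_law_unique_AE:
  fixes \<nu> :: "(nat \<Rightarrow> 'a::polish_space) measure"
  assumes nu: "\<nu> \<in> probs (prodE I)" and S: "S \<subseteq> I"
    and K: "is_cond_law \<nu> S k K" and L: "is_cond_law \<nu> S k L"
  shows "AE x in \<nu>. K (restrict x S) = L (restrict x S)"
proof -
  interpret prob_space \<nu> using nu by (auto simp: space_prob_algebra)
  have s: "sets \<nu> = sets (prodE I)" using nu by (auto simp: space_prob_algebra)
  have X[measurable]: "(\<lambda>x. restrict x S) \<in> \<nu> \<rightarrow>\<^sub>M prodE S"
    unfolding measurable_cong_sets[OF s refl] prodE_def by (rule measurable_restrict_subset[OF S])
  define D where "D = distr \<nu> (prodE S) (\<lambda>x. restrict x S)"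
  interpret D: prob_space D unfolding D_def by (rule prob_space_distr) fact
  have [measurable_cong]: "sets D = sets (prodE S)" by (simp add: D_def)
  have mK[measurable]: "(\<lambda>x. emeasure (K x) B) \<in> borel_measurable (prodE S)"
    if "B \<in> sets borel" and K: "is_cond_law \<nu> S k K" for B K
    using measurable_compose[OF measurable_prob_algebraD measurable_emeasure_subprob_algebra[OF that(1)]] K
    by (auto simp: is_cond_law_def)
  have pK: "prob_space (K x)" "sets (K x) = sets borel" if "x \<in> space (prodE S)" "is_cond_law \<nu> S k K" for x K
    using that measurable_space[of K "prodE S" "prob_algebra borel" x] by (auto simp: is_cond_law_def space_prob_algebra)
  have le: "AE x in D. emeasure (K x) B \<le> emeasure (L x) B"
    if B[measurable]: "B \<in> sets borel" and K: "is_cond_law \<nu> S k K" and L: "is_cond_law \<nu> S k L" for B K L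
  proof (rule AE_le_if_set_nn_integral_le)
    show "(\<lambda>x. emeasure (K x) B) \<in> borel_measurable D" "(\<lambda>x. emeasure (L x) B) \<in> borel_measurable D"
      using mK[OF B K] mK[OF B L] by (simp_all add: D_def)
    have "(\<integral>\<^sup>+x. emeasure (L x) B \<partial>D) \<le> (\<integral>\<^sup>+x. 1 \<partial>D)"
      by (intro nn_integral_mono) (use pK[OF _ L] in \<open>auto simp: D_def intro: prob_space.emeasure_le_1\<close>)
    then show "(\<integral>\<^sup>+x. emeasure (L x) B \<partial>D) < \<infinity>"
      by (rule order_le_less_trans) (simp add: D.emeasure_space_1)
    fix A assume "A \<in> sets D"
    then have A[measurable]: "A \<in> sets (prodE S)" by (simp add: D_def)
    have "(\<integral>\<^sup>+x. emeasure (K x) B * indicator A x \<partial>D) = emeasure \<nu> {x \<in> space \<nu>. restrict x S \<in> A \<and> x k \<in> B}" if K: "is_cond_law \<nu> S k K" for K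
      unfolding D_def using K mK[OF B K] A B
      by (subst nn_integral_distr) (auto simp: is_cond_law_def mult.commute)
    then show "(\<integral>\<^sup>+x. emeasure (K x) B * indicator A x \<partial>D) \<le> (\<integral>\<^sup>+x. emeasure (L x) B * indicator A x \<partial>D)"
      using K L by simp
  qed
  obtain G :: "'a set set" where G: "countable G" "Int_stable G" "UNIV \<in> G" "sets borel = sigma_sets UNIV G"
    by (rule countable_Int_stable_generator_borel)
  have GB: "B \<in> sets borel" if "B \<in> G" for B using that G(4) by auto
  have "AE x in D. \<forall>B\<in>G. emeasure (K x) B = emeasure (L x) B"
    unfolding AE_ball_countable[OF G(1)]
  proof
    fix B assume "B \<in> G"
    note B = GB[OF this]
    show "AE x in D. emeasure (K x) B = emeasure (L x) B"
      using le[OF B K L] le[OF B L K] by eventually_elim simp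
  qed
  then have "AE x in D. K x = L x" using AE_space
  proof eventually_elim
    case (elim x)
    then have x: "x \<in> space (prodE S)" by (simp add: D_def)
    interpret Kx: prob_space "K x" by (rule pK(1)[OF x K])
    show ?case
      by (rule measure_eqI_generator_eq[OF G(2), where \<Omega>=UNIV and A="\<lambda>_. UNIV"])
         (use elim G pK(2)[OF x K] pK(2)[OF x L] in auto)
  qed
  then show ?thesis unfolding D_def by (rule AE_distrD[OF X])
qed

lemma indep_vars_PiM_coordinates:
  assumes I: "I \<noteq> {}" and M: "\<And>i. i \<in> I \<Longrightarrow> prob_space (M i)"
  shows "prob_space.indep_vars (PiM I M) M (\<lambda>i x. x i) I"
proof -
  interpret prob_space "PiM I M" by (rule prob_space_PiM) fact
  show ?thesis
    using I
  proof (subst indep_vars_iff_distr_eq_PiM')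
    have "distr (PiM I M) (PiM I M) (\<lambda>x. restrict x I) = distr (PiM I M) (PiM I M) (\<lambda>x. x)"
      by (intro distr_cong) (auto simp: space_PiM)
    moreover have "(PiM I (\<lambda>i. distr (PiM I M) (M i) (\<lambda>x. x i))) = PiM I M"
      by (intro PiM_cong refl distr_PiM_component M)
    ultimately show "distr (PiM I M) (PiM I M) (\<lambda>x. \<lambda>i\<in>I. x i) = (PiM I (\<lambda>i. distr (PiM I M) (M i) (\<lambda>x. x i)))"
      by simp
  qed auto
qed

text \<open>The blocks \<open>S\<close> and \<open>{k}\<close> of independent coordinates are
  independent, so the defining identity of a conditional law factorises. This is where
  \<open>k\<close> has to lie outside \<open>S\<close>.\<close>

lemma is_cond_law_pow_measure:
  fixes \<nu> :: "'a::polish_space measure"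
  assumes nu: "\<nu> \<in> probs borel" and S: "S \<subseteq> {..<n}" and k: "k < n" "k \<notin> S"
  shows "is_cond_law (pow_measure \<nu> n) S k (\<lambda>_. \<nu>)"
proof -
  interpret N: prob_space \<nu> using nu by (auto simp: space_prob_algebra)
  have s: "sets \<nu> = sets borel" using nu by (auto simp: space_prob_algebra)
  define P where "P = pow_measure \<nu> n"
  interpret prob_space P unfolding P_def pow_measure_def by (rule prob_space_PiM) (rule N.prob_space_axioms)
  have sS: "sets (PiM S (\<lambda>_. \<nu>)) = sets (prodE S)" unfolding prodE_def by (rule sets_PiM_cong) (simp_all add: s)
  have "indep_vars (\<lambda>_. \<nu>) (\<lambda>i x. x i) {..<n}"
    unfolding P_def pow_measure_def by (rule indep_vars_PiM_coordinates) (use k N.prob_space_axioms in auto)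
  from indep_var_restrict[OF this, of S "{k}"] have
    ind: "indep_var (PiM S (\<lambda>_. \<nu>)) (\<lambda>x. restrict x S) (PiM {k} (\<lambda>_. \<nu>)) (\<lambda>x. restrict x {k})"
    using S k by auto
  have X[measurable]: "(\<lambda>x. restrict x S) \<in> P \<rightarrow>\<^sub>M prodE S"
    using indep_var_rv1[OF ind] measurable_cong_sets[OF refl sS] by blast
  have Z[measurable]: "(\<lambda>x. restrict x {k}) \<in> P \<rightarrow>\<^sub>M PiM {k} (\<lambda>_. \<nu>)"
    by (rule indep_var_rv2[OF ind])
  show ?thesis unfolding is_cond_law_def P_def[symmetric]
  proof safe
    show "(\<lambda>_. \<nu>) \<in> prodE S \<rightarrow>\<^sub>M prob_algebra borel" using nu by simp
    fix A B assume A[measurable]: "A \<in> sets (prodE S :: (nat \<Rightarrow> 'a) measure)" and B: "B \<in> sets (borel :: 'a measure)"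
    define B' where "B' = (\<lambda>x. x k) -` B \<inter> space (PiM {k} (\<lambda>_. \<nu>))"
    have B': "B' \<in> sets (PiM {k} (\<lambda>_. \<nu>))"
      unfolding B'_def by (rule measurable_sets[OF measurable_component_singleton]) (use B s in auto)
    have Zk: "restrict x {k} \<in> B' \<longleftrightarrow> x k \<in> B" if "x \<in> space P" for x
      using measurable_space[OF Z that] by (simp add: B'_def)
    have mk: "(\<lambda>x. x k) \<in> P \<rightarrow>\<^sub>M \<nu>"
      unfolding P_def pow_measure_def by (rule measurable_component_singleton) (use k in simp)
    have "emeasure P {x \<in> space P. restrict x S \<in> A \<and> x k \<in> B} = ennreal (prob ((\<lambda>x. (restrict x S, restrict x {k})) -` (A \<times> B') \<inter> space P))"
      unfolding emeasure_eq_measure by (intro arg_cong[of _ _ "\<lambda>S. ennreal (prob S)"]) (auto simp: Zk)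
    also have "\<dots> = ennreal (prob ((\<lambda>x. restrict x S) -` A \<inter> space P)) * ennreal (prob ((\<lambda>x. restrict x {k}) -` B' \<inter> space P))"
      using A B' by (subst indep_varD[OF ind]) (simp_all add: sS ennreal_mult')
    also have "(\<lambda>x. restrict x {k}) -` B' \<inter> space P = (\<lambda>x. x k) -` B \<inter> space P" by (auto simp: Zk)
    also have "prob \<dots> = measure (distr P \<nu> (\<lambda>x. x k)) B"
      using B by (simp add: measure_distr[OF mk] s)
    also have "distr P \<nu> (\<lambda>x. x k) = \<nu>" unfolding P_def pow_measure_def
      by (rule distr_PiM_component) (use k N.prob_space_axioms in auto)
    also have "ennreal (prob ((\<lambda>x. restrict x S) -` A \<inter> space P)) = (\<integral>\<^sup>+x. indicator A (restrict x S) \<partial>P)"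
      unfolding emeasure_eq_measure[symmetric] nn_integral_indicator[symmetric, OF measurable_sets[OF X A]]
      by (rule nn_integral_cong) (simp add: indicator_def)
    also have "\<dots> * ennreal (measure \<nu> B) = (\<integral>\<^sup>+x. indicator A (restrict x S) * emeasure \<nu> B \<partial>P)"
      unfolding N.emeasure_eq_measure by (rule nn_integral_multc[symmetric]) measurable
    finally show "emeasure P {x \<in> space P. restrict x S \<in> A \<and> x k \<in> B} = (\<integral>\<^sup>+x. indicator A (restrict x S) * emeasure \<nu> B \<partial>P)" .
  qed
qed

section \<open>Discretised couplings\<close>

text \<open>Intended for simple functions \<open>S\<close>: their finite range makes the image
  measure atomic, as \<open>Abs_pmf\<close> requires.\<close>

definition law :: "'b measure \<Rightarrow> ('b \<Rightarrow> 'c) \<Rightarrow> 'c pmf" where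
  "law M S = Abs_pmf (distr M (count_space UNIV) S)"

lemma measure_pmf_law:
  assumes M: "prob_space M" and S: "simple_function M S"
  shows "measure_pmf (law M S) = distr M (count_space UNIV) S"
proof -
  interpret prob_space M by fact
  have m[measurable]: "S \<in> M \<rightarrow>\<^sub>M count_space UNIV" by (rule measurable_simple_function[OF S])
  interpret D: prob_space "distr M (count_space UNIV) S" by (rule prob_space_distr[OF m])
  have fin: "finite (S ` space M)" using S by (simp add: simple_function_def)
  have "AE x in M. measure M (S -` {S x} \<inter> space M) \<noteq> 0"
  proof -
    define Z where "Z = {a \<in> S ` space M. measure M (S -` {a} \<inter> space M) = 0}"
    have "AE x in M. \<forall>a\<in>Z. S x \<noteq> a"
    proof (rule AE_finite_allI)
      show "finite Z" using fin by (simp add: Z_def)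
      fix a assume "a \<in> Z"
      then have "S -` {a} \<inter> space M \<in> null_sets M"
        by (auto simp: Z_def null_sets_def emeasure_eq_measure intro: measurable_sets[OF m])
      from AE_not_in[OF this] show "AE x in M. S x \<noteq> a" using AE_space by eventually_elim auto
    qed
    then show ?thesis using AE_space by eventually_elim (auto simp: Z_def)
  qed
  then have "AE a in distr M (count_space UNIV) S. measure (distr M (count_space UNIV) S) {a} \<noteq> 0"
    by (subst AE_distr_iff[OF m]) (auto simp: measure_distr)
  then show ?thesis unfolding law_def
    by (intro Abs_pmf_inverse) (simp add: D.prob_space_axioms)
qed

lemma nn_integral_law:
  assumes M: "prob_space M" and S: "simple_function M S"
  shows "(\<integral>\<^sup>+a. f a \<partial>measure_pmf (law M S)) = (\<integral>\<^sup>+x. f (S x) \<partial>M)"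
  unfolding measure_pmf_law[OF assms]
  by (rule nn_integral_distr[OF measurable_simple_function[OF S]]) simp

lemma pmf_law:
  assumes M: "prob_space M" and S: "simple_function M S"
  shows "pmf (law M S) a = measure M {x \<in> space M. S x = a}"
  unfolding pmf.rep_eq measure_pmf_law[OF assms]
  by (subst measure_distr[OF measurable_simple_function[OF S]]) (auto intro!: arg_cong[of _ _ "measure M"])

lemma set_law:
  assumes M: "prob_space M" and S: "simple_function M S"
  shows "set_pmf (law M S) \<subseteq> S ` space M"
proof
  fix a assume "a \<in> set_pmf (law M S)"
  then have "measure M {x \<in> space M. S x = a} \<noteq> 0" by (simp add: set_pmf_iff pmf_law[OF assms])
  then have "{x \<in> space M. S x = a} \<noteq> {}" by (metis measure_empty)
  then show "a \<in> S ` space M" by auto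
qed

lemma AE_law:
  assumes M: "prob_space M" and S: "simple_function M S"
  shows "AE x in M. S x \<in> set_pmf (law M S)"
proof (rule AE_distrD[OF measurable_simple_function[OF S]])
  show "AE a in distr M (count_space UNIV) S. a \<in> set_pmf (law M S)"
    unfolding measure_pmf_law[OF assms, symmetric] by (rule AE_measure_pmf)
qed

lemma finite_set_law: "prob_space M \<Longrightarrow> simple_function M S \<Longrightarrow> finite (set_pmf (law M S))"
  using set_law finite_subset simple_functionD(1) by metis

lemma map_pmf_law:
  assumes M: "prob_space M" and S: "simple_function M S"
  shows "map_pmf f (law M S) = law M (\<lambda>x. f (S x))"
proof -
  have S': "simple_function M (\<lambda>x. f (S x))" by (rule simple_function_compose1[OF S])
  show ?thesis
    by (rule measure_pmf_inject[THEN iffD1])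
       (simp add: map_pmf_rep_eq measure_pmf_law[OF M S] measure_pmf_law[OF M S'] distr_distr measurable_simple_function[OF S] comp_def)
qed

lemma law_distr:
  assumes "T \<in> M \<rightarrow>\<^sub>M N" "simple_function N S"
  shows "law (distr M N T) S = law M (\<lambda>x. S (T x))"
  unfolding law_def by (simp add: distr_distr[OF measurable_simple_function[OF assms(2)] assms(1)] comp_def)

lemma pmf_map_fst_eq_sum:
  assumes "finite B" "snd ` set_pmf r \<subseteq> B"
  shows "pmf (map_pmf fst r) a = (\<Sum>b\<in>B. pmf r (a, b))"
proof -
  have "pmf (map_pmf fst r) a = measure r (fst -` {a})" by (simp add: pmf.rep_eq)
  also have "\<dots> = measure r (Pair a ` B)"
    by (rule measure_pmf.finite_measure_eq_AE) (use assms(2) in \<open>force simp: AE_measure_pmf_iff\<close>)+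
  also have "\<dots> = (\<Sum>b\<in>B. pmf r (a, b))"
    using assms(1) by (subst measure_measure_pmf_finite) (auto simp: sum.reindex inj_on_def)
  finally show ?thesis .
qed

lemma pmf_map_snd_eq_sum:
  assumes "finite A" "fst ` set_pmf r \<subseteq> A"
  shows "pmf (map_pmf snd r) b = (\<Sum>a\<in>A. pmf r (a, b))"
proof -
  have "pmf (map_pmf snd r) b = pmf (map_pmf fst (map_pmf prod.swap r)) b"
    by (simp add: pmf.map_comp comp_def)
  also have "\<dots> = (\<Sum>a\<in>A. pmf (map_pmf prod.swap r) (b, a))"
    by (rule pmf_map_fst_eq_sum) (use assms in auto)
  also have "\<dots> = (\<Sum>a\<in>A. pmf r (a, b))"
    using pmf_map_inj'[of prod.swap r "(_, b)"] by (simp add: inj_swap)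
  finally show ?thesis .
qed

text \<open>The integrand is the density, with respect to the product measure, of the coupling in \<open>lift_coupling\<close>.\<close>
lemma nn_integral_conditional_fst:
  fixes r :: "('s \<times> 't) pmf"
  assumes fin: "finite (set_pmf r)" and a: "a \<in> fst ` set_pmf r"
  shows "(\<integral>\<^sup>+b. ennreal (pmf r (a, b) / (pmf (map_pmf fst r) a * pmf (map_pmf snd r) b)) \<partial>map_pmf snd r) = 1"
proof -
  let ?s = "map_pmf fst r" and ?t = "map_pmf snd r"
  have "(\<integral>\<^sup>+b. ennreal (pmf r (a, b) / (pmf ?s a * pmf ?t b)) \<partial>?t) = (\<Sum>b\<in>set_pmf ?t. ennreal (pmf r (a, b) / (pmf ?s a * pmf ?t b)) * pmf ?t b)"
    by (rule nn_integral_measure_pmf_finite) (use fin in auto)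
  also have "\<dots> = (\<Sum>b\<in>set_pmf ?t. ennreal (pmf r (a, b) / pmf ?s a))"
    by (intro sum.cong refl, subst ennreal_mult'[symmetric]) (simp_all add: set_pmf_iff del: set_map_pmf)
  also have "\<dots> = ennreal ((\<Sum>b\<in>set_pmf ?t. pmf r (a, b)) / pmf ?s a)"
    by (simp add: sum_ennreal sum_divide_distrib)
  also have "(\<Sum>b\<in>set_pmf ?t. pmf r (a, b)) = pmf ?s a"
    by (rule pmf_map_fst_eq_sum[symmetric]) (use fin in auto)
  also have "pmf ?s a / pmf ?s a = 1" using a by (simp add: pmf_eq_0_set_pmf)
  finally show ?thesis by simp
qed

lemma nn_integral_conditional_snd:
  fixes r :: "('s \<times> 't) pmf"
  assumes fin: "finite (set_pmf r)" and b: "b \<in> snd ` set_pmf r"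
  shows "(\<integral>\<^sup>+a. ennreal (pmf r (a, b) / (pmf (map_pmf fst r) a * pmf (map_pmf snd r) b)) \<partial>map_pmf fst r) = 1"
proof -
  let ?r = "map_pmf prod.swap r"
  have "pmf ?r (b, a) = pmf r (a, b)" for a using pmf_map_inj'[of prod.swap r "(a, b)"] by (simp add: inj_swap)
  then show ?thesis
    using nn_integral_conditional_fst[of ?r b] fin b
    by (simp add: pmf.map_comp comp_def image_image mult.commute)
qed

text \<open>Given the cells prescribed by \<open>r\<close>, the two points are drawn independently
  from \<open>M\<close> and \<open>N\<close> conditioned on their cells. A coupling of discretised
  laws thus lifts by an explicit density, and functions of the cells keep their integrals.\<close>

theorem lift_coupling:
  fixes r :: "('s \<times> 't) pmf"
  assumes M: "prob_space M" and N: "prob_space N"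
    and S: "simple_function M S" and R: "simple_function N R"
    and r1: "map_pmf fst r = law M S" and r2: "map_pmf snd r = law N R"
  obtains \<gamma> where "\<gamma> \<in> couplings M N"
    "\<And>f. (\<integral>\<^sup>+z. f (S (fst z), R (snd z)) \<partial>\<gamma>) = (\<integral>\<^sup>+z. f z \<partial>measure_pmf r)"
proof -
  interpret M: prob_space M by fact
  interpret N: prob_space N by fact
  interpret MN: pair_prob_space M N ..
  have fin1: "finite (fst ` set_pmf r)" using finite_set_law[OF M S] r1 by (metis set_map_pmf)
  have fin2: "finite (snd ` set_pmf r)" using finite_set_law[OF N R] r2 by (metis set_map_pmf)
  have fin: "finite (set_pmf r)"
    by (rule finite_subset[OF _ finite_cartesian_product[OF fin1 fin2]]) force
  \<comment> \<open>Off the support of the marginal the quotient in \<open>h\<close> is a division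
    by zero, hence 0, and the integral of the density over a fibre is 0 instead of 1. The marginal
    identities therefore hold only almost everywhere.\<close>
  have aeM: "AE x in M. S x \<in> fst ` set_pmf r"
    using AE_law[OF M S] unfolding r1[symmetric] set_map_pmf .
  have aeN: "AE y in N. R y \<in> snd ` set_pmf r"
    using AE_law[OF N R] unfolding r2[symmetric] set_map_pmf .
  define h where "h a b = ennreal (pmf r (a, b) / (pmf (map_pmf fst r) a * pmf (map_pmf snd r) b))" for a b
  have sf: "simple_function (M \<Otimes>\<^sub>M N) (\<lambda>z. g (S (fst z)) (R (snd z)))" for g :: "'s \<Rightarrow> 't \<Rightarrow> ennreal"
    by (rule simple_function_compose2[OF simple_function_comp[OF measurable_fst S] simple_function_comp[OF measurable_snd R]])
  note [measurable] = borel_measurable_simple_function[OF sf]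
  have mx[measurable]: "(\<lambda>x. g (S x)) \<in> borel_measurable M" for g :: "'s \<Rightarrow> ennreal"
    by (rule borel_measurable_simple_function[OF simple_function_compose1[OF S]])
  have my[measurable]: "(\<lambda>y. g (R y)) \<in> borel_measurable N" for g :: "'t \<Rightarrow> ennreal"
    by (rule borel_measurable_simple_function[OF simple_function_compose1[OF R]])
  define \<gamma> where "\<gamma> = density (M \<Otimes>\<^sub>M N) (\<lambda>z. h (S (fst z)) (R (snd z)))"
  have [measurable_cong]: "sets \<gamma> = sets (M \<Otimes>\<^sub>M N)" by (simp add: \<gamma>_def)
  have g: "(\<integral>\<^sup>+z. u z \<partial>\<gamma>) = (\<integral>\<^sup>+z. h (S (fst z)) (R (snd z)) * u z \<partial>(M \<Otimes>\<^sub>M N))"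
    if "u \<in> borel_measurable (M \<Otimes>\<^sub>M N)" for u
    unfolding \<gamma>_def by (rule nn_integral_density) (use that in measurable)
  have "distr \<gamma> M fst = M"
  proof (rule measure_eqI)
    fix A assume "A \<in> sets (distr \<gamma> M fst)"
    then have [measurable]: "A \<in> sets M" by simp
    have "emeasure (distr \<gamma> M fst) A = (\<integral>\<^sup>+z. indicator A (fst z) \<partial>\<gamma>)"
      by (subst nn_integral_indicator[symmetric], simp, subst nn_integral_distr) auto
    also have "\<dots> = (\<integral>\<^sup>+z. h (S (fst z)) (R (snd z)) * indicator A (fst z) \<partial>(M \<Otimes>\<^sub>M N))"
      by (rule g) measurable
    also have "\<dots> = (\<integral>\<^sup>+x. \<integral>\<^sup>+y. h (S x) (R y) * indicator A x \<partial>N \<partial>M)"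
      by (subst N.nn_integral_fst[symmetric]) auto
    also have "\<dots> = (\<integral>\<^sup>+x. indicator A x \<partial>M)"
    proof (rule nn_integral_cong_AE)
      show "AE x in M. (\<integral>\<^sup>+y. h (S x) (R y) * indicator A x \<partial>N) = indicator A x"
        using aeM
      proof eventually_elim
        case (elim x)
        have "(\<integral>\<^sup>+y. h (S x) (R y) * indicator A x \<partial>N) = (\<integral>\<^sup>+y. h (S x) (R y) \<partial>N) * indicator A x"
          by (rule nn_integral_multc) measurable
        also have "(\<integral>\<^sup>+y. h (S x) (R y) \<partial>N) = 1"
          using nn_integral_conditional_fst[OF fin elim]
          unfolding r2 nn_integral_law[OF N R] by (simp add: h_def r2)
        finally show ?case by simp
      qed
    qed
    finally show "emeasure (distr \<gamma> M fst) A = emeasure M A" by simp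
  qed simp
  moreover have "distr \<gamma> N snd = N"
  proof (rule measure_eqI)
    fix A assume "A \<in> sets (distr \<gamma> N snd)"
    then have [measurable]: "A \<in> sets N" by simp
    have "emeasure (distr \<gamma> N snd) A = (\<integral>\<^sup>+z. indicator A (snd z) \<partial>\<gamma>)"
      by (subst nn_integral_indicator[symmetric], simp, subst nn_integral_distr) auto
    also have "\<dots> = (\<integral>\<^sup>+z. h (S (fst z)) (R (snd z)) * indicator A (snd z) \<partial>(M \<Otimes>\<^sub>M N))"
      by (rule g) measurable
    also have "\<dots> = (\<integral>\<^sup>+y. \<integral>\<^sup>+x. h (S x) (R y) * indicator A y \<partial>M \<partial>N)"
      by (subst MN.nn_integral_snd[symmetric]) (auto simp: case_prod_beta)
    also have "\<dots> = (\<integral>\<^sup>+y. indicator A y \<partial>N)"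
    proof (rule nn_integral_cong_AE)
      show "AE y in N. (\<integral>\<^sup>+x. h (S x) (R y) * indicator A y \<partial>M) = indicator A y"
        using aeN
      proof eventually_elim
        case (elim y)
        have "(\<integral>\<^sup>+x. h (S x) (R y) * indicator A y \<partial>M) = (\<integral>\<^sup>+x. h (S x) (R y) \<partial>M) * indicator A y"
          by (rule nn_integral_multc) measurable
        also have "(\<integral>\<^sup>+x. h (S x) (R y) \<partial>M) = 1"
          using nn_integral_conditional_snd[OF fin elim]
          unfolding r1 nn_integral_law[OF M S] by (simp add: h_def r1)
        finally show ?case by simp
      qed
    qed
    finally show "emeasure (distr \<gamma> N snd) A = emeasure N A" by simp
  qed simp
  ultimately have c: "\<gamma> \<in> couplings M N" unfolding couplings_def by (simp add: \<gamma>_def)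
  have "(\<integral>\<^sup>+z. f (S (fst z), R (snd z)) \<partial>\<gamma>) = (\<integral>\<^sup>+z. f z \<partial>measure_pmf r)" for f
  proof -
    have "(\<integral>\<^sup>+z. f (S (fst z), R (snd z)) \<partial>\<gamma>) = (\<integral>\<^sup>+z. h (S (fst z)) (R (snd z)) * f (S (fst z), R (snd z)) \<partial>(M \<Otimes>\<^sub>M N))"
      by (rule g) (rule borel_measurable_simple_function[OF sf[of "\<lambda>a b. f (a, b)"]])
    also have "\<dots> = (\<integral>\<^sup>+x. \<integral>\<^sup>+y. h (S x) (R y) * f (S x, R y) \<partial>N \<partial>M)"
      by (subst N.nn_integral_fst[symmetric])
         (auto intro!: borel_measurable_simple_function[OF sf[of "\<lambda>a b. h a b * f (a, b)"]])
    also have "\<dots> = (\<integral>\<^sup>+a. \<integral>\<^sup>+b. h a b * f (a, b) \<partial>map_pmf snd r \<partial>map_pmf fst r)"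
      unfolding r1 r2 nn_integral_law[OF M S] nn_integral_law[OF N R] ..
    also have "\<dots> = (\<Sum>a\<in>fst ` set_pmf r. (\<Sum>b\<in>snd ` set_pmf r. h a b * f (a, b) * pmf (map_pmf snd r) b) * pmf (map_pmf fst r) a)"
      by (subst nn_integral_measure_pmf_finite, use fin in simp, simp, subst nn_integral_measure_pmf_finite) (use fin in auto)
    also have "\<dots> = (\<Sum>a\<in>fst ` set_pmf r. \<Sum>b\<in>snd ` set_pmf r. f (a, b) * pmf r (a, b))"
      unfolding sum_distrib_right
    proof (intro sum.cong refl)
      fix a b assume "a \<in> fst ` set_pmf r" "b \<in> snd ` set_pmf r"
      then have "pmf (map_pmf fst r) a > 0" "pmf (map_pmf snd r) b > 0" by (simp_all add: pmf_positive_iff)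
      then have "h a b * (ennreal (pmf (map_pmf snd r) b) * ennreal (pmf (map_pmf fst r) a)) = ennreal (pmf r (a, b))"
        unfolding h_def by (simp add: ennreal_mult'[symmetric])
      then show "h a b * f (a, b) * ennreal (pmf (map_pmf snd r) b) * ennreal (pmf (map_pmf fst r) a) = f (a, b) * ennreal (pmf r (a, b))"
        by (metis mult.assoc mult.commute)
    qed
    also have "\<dots> = (\<Sum>z\<in>fst ` set_pmf r \<times> snd ` set_pmf r. f z * pmf r z)"
      by (simp add: sum.cartesian_product)
    also have "\<dots> = (\<Sum>z\<in>set_pmf r. f z * pmf r z)"
    proof (rule sum.mono_neutral_right)
      show "finite (fst ` set_pmf r \<times> snd ` set_pmf r)" using fin by simp
      show "set_pmf r \<subseteq> fst ` set_pmf r \<times> snd ` set_pmf r" by force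
    qed (simp add: set_pmf_iff)
    also have "\<dots> = (\<integral>\<^sup>+z. f z \<partial>measure_pmf r)"
      by (rule nn_integral_measure_pmf_finite[symmetric]) (use fin in auto)
    finally show ?thesis .
  qed
  with c show thesis by (rule that)
qed

text \<open>Bolzano-Weierstrass for the finitely many numbers \<open>pmf (r j) (a, b)\<close>:
  marginals and expected cost are finite sums of them, so they pass to the limit of a subsequence.
  This turns couplings with nearly correct marginals into exact ones at no extra cost.\<close>

lemma pmf_coupling_compact:
  fixes s t :: "'c pmf" and d :: "'c \<times> 'c \<Rightarrow> real" and c :: real
  assumes F: "finite F" and s: "set_pmf s \<subseteq> F" and t: "set_pmf t \<subseteq> F"
    and approx: "\<And>\<eta>. \<eta> > 0 \<Longrightarrow> \<exists>r. set_pmf r \<subseteq> F \<times> F \<and> (\<forall>a\<in>F. \<bar>pmf (map_pmf fst r) a - pmf s a\<bar> \<le> \<eta>)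
       \<and> (\<forall>b\<in>F. \<bar>pmf (map_pmf snd r) b - pmf t b\<bar> \<le> \<eta>) \<and> measure_pmf.expectation r d \<le> c + \<eta>"
  obtains r where "set_pmf r \<subseteq> F \<times> F" "map_pmf fst r = s" "map_pmf snd r = t" "measure_pmf.expectation r d \<le> c"
proof -
  have "\<exists>r. \<forall>j. set_pmf (r j) \<subseteq> F \<times> F \<and> (\<forall>a\<in>F. \<bar>pmf (map_pmf fst (r j)) a - pmf s a\<bar> \<le> 1 / Suc j)
       \<and> (\<forall>b\<in>F. \<bar>pmf (map_pmf snd (r j)) b - pmf t b\<bar> \<le> 1 / Suc j) \<and> measure_pmf.expectation (r j) d \<le> c + 1 / Suc j"
    by (intro choice allI approx) simp
  then obtain r where rF: "\<And>j. set_pmf (r j) \<subseteq> F \<times> F"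
    and rs: "\<And>j a. a \<in> F \<Longrightarrow> \<bar>pmf (map_pmf fst (r j)) a - pmf s a\<bar> \<le> 1 / Suc j"
    and rt: "\<And>j b. b \<in> F \<Longrightarrow> \<bar>pmf (map_pmf snd (r j)) b - pmf t b\<bar> \<le> 1 / Suc j"
    and rd: "\<And>j. measure_pmf.expectation (r j) d \<le> c + 1 / Suc j" by blast
  have "\<forall>\<delta>\<subseteq>F \<times> F. \<exists>l::'c \<times> 'c \<Rightarrow> real. \<exists>k::nat\<Rightarrow>nat. strict_mono k \<and> (\<forall>\<epsilon>>0. eventually (\<lambda>n. \<forall>i\<in>\<delta>. dist (pmf (r (k n)) i) (l i) < \<epsilon>) sequentially)"
    by (rule compact_lemma_general[where proj="\<lambda>f x. f x" and unproj="\<lambda>f. f" and f="\<lambda>n. pmf (r n)"])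
       (use F in \<open>auto intro!: boundedI[where B=1] simp: pmf_le_1\<close>)
  then obtain l k where k: "strict_mono k" and "\<forall>\<epsilon>>0. eventually (\<lambda>n. \<forall>i\<in>F \<times> F. dist (pmf (r (k n)) i) (l i) < \<epsilon>) sequentially"
    by blast
  then have lim: "(\<lambda>n. pmf (r (k n)) i) \<longlonglongrightarrow> l i" if "i \<in> F \<times> F" for i
    by (intro tendstoI) (use that in \<open>auto elim!: eventually_mono\<close>)
  have eta0: "(\<lambda>n. 1 / real (Suc (k n))) \<longlonglongrightarrow> 0"
    using LIMSEQ_subseq_LIMSEQ[OF LIMSEQ_Suc[OF lim_1_over_n] k] by (simp add: comp_def)
  \<comment> \<open>The limit is controlled on \<open>F \<times> F\<close> only; extension by 0
    makes it the mass function of a \<open>pmf\<close>.\<close>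
  define L where "L i = (if i \<in> F \<times> F then l i else 0)" for i
  have lnn: "0 \<le> l i" if "i \<in> F \<times> F" for i
    by (rule LIMSEQ_le_const[OF lim[OF that]]) simp
  have Lnn: "0 \<le> L i" for i using lnn by (auto simp: L_def)
  have sum1: "sum l (F \<times> F) = 1"
  proof (rule LIMSEQ_unique)
    show "(\<lambda>n. \<Sum>i\<in>F \<times> F. pmf (r (k n)) i) \<longlonglongrightarrow> sum l (F \<times> F)" by (intro tendsto_sum lim)
    have "(\<Sum>i\<in>F \<times> F. pmf (r (k n)) i) = 1" for n using F rF by (intro sum_pmf_eq_1) auto
    then show "(\<lambda>n. \<Sum>i\<in>F \<times> F. pmf (r (k n)) i) \<longlonglongrightarrow> 1" by simp
  qed
  have Lint: "(\<integral>\<^sup>+i. ennreal (L i) \<partial>count_space UNIV) = 1"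
  proof -
    have "(\<integral>\<^sup>+i. ennreal (L i) \<partial>count_space UNIV) = (\<Sum>i\<in>F \<times> F. ennreal (L i))"
      by (rule nn_integral_count_space'[OF finite_cartesian_product[OF F F]]) (auto simp: L_def)
    also have "\<dots> = ennreal (sum l (F \<times> F))" by (simp add: sum_ennreal Lnn) (simp add: L_def)
    finally show ?thesis using sum1 by simp
  qed
  define q where "q = embed_pmf L"
  have q: "pmf q i = L i" for i unfolding q_def by (rule pmf_embed_pmf[OF Lnn Lint])
  have qF: "set_pmf q \<subseteq> F \<times> F" by (auto simp: set_pmf_iff q L_def split: if_splits)
  have m1: "pmf (map_pmf fst p) a = (\<Sum>b\<in>F. pmf p (a, b))" if "set_pmf p \<subseteq> F \<times> F" for p a
    by (rule pmf_map_fst_eq_sum[OF F]) (use that in auto)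
  have m2: "pmf (map_pmf snd p) b = (\<Sum>a\<in>F. pmf p (a, b))" if "set_pmf p \<subseteq> F \<times> F" for p b
    by (rule pmf_map_snd_eq_sum[OF F]) (use that in auto)
  have ex: "measure_pmf.expectation p d = (\<Sum>z\<in>F \<times> F. pmf p z * d z)" if "set_pmf p \<subseteq> F \<times> F" for p
    by (subst integral_measure_pmf[OF finite_cartesian_product[OF F F]]) (use that in auto)
  have f1: "map_pmf fst q = s"
  proof (rule pmf_eqI)
    fix a
    show "pmf (map_pmf fst q) a = pmf s a"
    proof (cases "a \<in> F")
      case True
      have "(\<lambda>n. \<bar>(\<Sum>b\<in>F. pmf (r (k n)) (a, b)) - pmf s a\<bar>) \<longlonglongrightarrow> \<bar>(\<Sum>b\<in>F. l (a, b)) - pmf s a\<bar>"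
        by (intro tendsto_intros lim) (use True in auto)
      moreover have "\<bar>(\<Sum>b\<in>F. pmf (r (k n)) (a, b)) - pmf s a\<bar> \<le> 1 / Suc (k n)" for n
        using rs[OF True, of "k n"] m1[OF rF] by simp
      ultimately have "\<bar>(\<Sum>b\<in>F. l (a, b)) - pmf s a\<bar> \<le> 0" by (intro LIMSEQ_le[OF _ eta0]) auto
      then show ?thesis using True unfolding m1[OF qF] q by (simp add: L_def)
    next
      case False
      then have "pmf s a = 0" using s by (auto simp: pmf_eq_0_set_pmf)
      then show ?thesis using False unfolding m1[OF qF] q by (simp add: L_def)
    qed
  qed
  have f2: "map_pmf snd q = t"
  proof (rule pmf_eqI)
    fix a
    show "pmf (map_pmf snd q) a = pmf t a"
    proof (cases "a \<in> F")
      case True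
      have "(\<lambda>n. \<bar>(\<Sum>b\<in>F. pmf (r (k n)) (b, a)) - pmf t a\<bar>) \<longlonglongrightarrow> \<bar>(\<Sum>b\<in>F. l (b, a)) - pmf t a\<bar>"
        by (intro tendsto_intros lim) (use True in auto)
      moreover have "\<bar>(\<Sum>b\<in>F. pmf (r (k n)) (b, a)) - pmf t a\<bar> \<le> 1 / Suc (k n)" for n
        using rt[OF True, of "k n"] m2[OF rF] by simp
      ultimately have "\<bar>(\<Sum>b\<in>F. l (b, a)) - pmf t a\<bar> \<le> 0" by (intro LIMSEQ_le[OF _ eta0]) auto
      then show ?thesis using True unfolding m2[OF qF] q by (simp add: L_def)
    next
      case False
      then have "pmf t a = 0" using t by (auto simp: pmf_eq_0_set_pmf)
      then show ?thesis using False unfolding m2[OF qF] q by (simp add: L_def)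
    qed
  qed
  have "(\<Sum>z\<in>F \<times> F. l z * d z) \<le> c + 0"
  proof (rule LIMSEQ_le)
    show "(\<lambda>n. \<Sum>z\<in>F \<times> F. pmf (r (k n)) z * d z) \<longlonglongrightarrow> (\<Sum>z\<in>F \<times> F. l z * d z)"
      by (intro tendsto_intros lim)
    show "(\<lambda>n. c + 1 / real (Suc (k n))) \<longlonglongrightarrow> c + 0" by (intro tendsto_intros eta0)
    show "\<exists>N. \<forall>n\<ge>N. (\<Sum>z\<in>F \<times> F. pmf (r (k n)) z * d z) \<le> c + 1 / real (Suc (k n))"
      using rd ex[OF rF] by auto
  qed
  then have "measure_pmf.expectation q d \<le> c" unfolding ex[OF qF] q by (simp add: L_def)
  with qF f1 f2 show thesis by (rule that)
qed

section \<open>Nearest-point maps with finite range\<close>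

primrec nearest :: "(nat \<Rightarrow> 'a::metric_space) \<Rightarrow> nat \<Rightarrow> 'a \<Rightarrow> 'a" where
  "nearest q 0 x = q 0"
| "nearest q (Suc m) x = (if dist x (q (Suc m)) < dist x (nearest q m x) then q (Suc m) else nearest q m x)"

lemma nearest_in: "nearest q m x \<in> q ` {..m}"
  by (induction m) (auto simp: le_Suc_eq)

lemma dist_nearest_le: "i \<le> m \<Longrightarrow> dist x (nearest q m x) \<le> dist x (q i)"
  by (induction m) (auto simp: le_Suc_eq)

lemma measurable_nearest[measurable]:
  fixes q :: "nat \<Rightarrow> 'a::{metric_space, second_countable_topology}"
  shows "nearest q m \<in> borel_measurable borel"
proof (induction m)
  case (Suc m)
  note [measurable] = Suc
  show ?case unfolding nearest.simps[abs_def] by measurable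
qed simp

text \<open>The point \<open>x0\<close> comes first in the enumeration of centres, so the distance
  from \<open>x\<close> to its nearest centre never exceeds \<open>dist x x0\<close>. Its square is
  integrable for every measure in \<open>MM\<close> and serves as the dominating function.\<close>

lemma finite_range_approximation:
  fixes x0 :: "'a::polish_space"
  assumes fin: "finite MM" and sets: "\<And>M. M \<in> MM \<Longrightarrow> sets M = sets borel"
    and mom: "\<And>M. M \<in> MM \<Longrightarrow> sq_moment x0 M < \<infinity>" and e: "e > (0::ennreal)"
  obtains T where "T \<in> borel_measurable borel" "finite (range T)"
    "\<And>M. M \<in> MM \<Longrightarrow> sq_err T M < e"
proof -
  obtain D :: "'a set" where D: "countable D" "\<And>X. open X \<Longrightarrow> X \<noteq> {} \<Longrightarrow> \<exists>d\<in>D. d \<in> X"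
    using countable_dense_setE by metis
  have Dne: "D \<noteq> {}" using D(2)[of UNIV] by auto
  define q where "q i = (case i of 0 \<Rightarrow> x0 | Suc j \<Rightarrow> from_nat_into D j)" for i
  have q: "\<exists>i. dist x (q i) < r" if "r > 0" for x r
  proof -
    have "ball x r \<noteq> {}" using that by simp
    then obtain d where d: "d \<in> D" "d \<in> ball x r" using D(2)[OF open_ball] by blast
    then obtain j where "from_nat_into D j = d" using D(1) Dne by (metis from_nat_into_surj)
    then show ?thesis using d(2) by (intro exI[of _ "Suc j"]) (simp add: q_def)
  qed
  have dx0: "dist x (nearest q m x) \<le> dist x x0" for m x
    using dist_nearest_le[of 0 m x q] by (simp add: q_def)
  have lim: "(\<lambda>m. dist x (nearest q m x)) \<longlonglongrightarrow> 0" for x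
  proof (rule LIMSEQ_I)
    fix r :: real assume "r > 0"
    then obtain i where "dist x (q i) < r" using q by blast
    then show "\<exists>no. \<forall>m\<ge>no. norm (dist x (nearest q m x) - 0) < r"
      by (intro exI[of _ i]) (auto intro: order_le_less_trans[OF dist_nearest_le])
  qed
  have "\<forall>\<^sub>F m in sequentially. \<forall>M\<in>MM. (\<integral>\<^sup>+x. sqd x (nearest q m x) \<partial>M) < e"
  proof (rule eventually_ball_finite[OF fin], rule ballI)
    fix M assume M: "M \<in> MM"
    note [measurable_cong] = sets[OF M]
    have "(\<lambda>m. \<integral>\<^sup>+x. sqd x (nearest q m x) \<partial>M) \<longlonglongrightarrow> (\<integral>\<^sup>+x. 0 \<partial>M)"
    proof (rule nn_integral_dominated_convergence[where w="\<lambda>x. sqd x x0"])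
      show "AE x in M. sqd x (nearest q j x) \<le> sqd x x0" for j
        by (intro AE_I2 ennreal_leI power_mono dx0) auto
      show "sq_moment x0 M < \<infinity>" by (rule mom[OF M])
      have "(\<lambda>i. sqd x (nearest q i x)) \<longlonglongrightarrow> ennreal (0\<^sup>2)" for x
        by (intro tendsto_ennrealI tendsto_power lim)
      then show "AE x in M. (\<lambda>i. sqd x (nearest q i x)) \<longlonglongrightarrow> 0" by simp
    qed measurable
    then show "\<forall>\<^sub>F m in sequentially. (\<integral>\<^sup>+x. sqd x (nearest q m x) \<partial>M) < e"
      using e by (intro order_tendstoD(2)[of _ 0]) auto
  qed
  then obtain m where m: "\<forall>M\<in>MM. (\<integral>\<^sup>+x. sqd x (nearest q m x) \<partial>M) < e"
    by (auto simp: eventually_sequentially)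
  show thesis
  proof (rule that[of "nearest q m"])
    show "finite (range (nearest q m))"
      by (rule finite_subset[of _ "q ` {..m}"]) (use nearest_in in auto)
  qed (use m in auto)
qed

lemma simple_function_finite_range:
  fixes T :: "'a::{second_countable_topology, t1_space} \<Rightarrow> 'a"
  assumes "T \<in> borel_measurable M" "finite (range T)"
  shows "simple_function M T"
  unfolding simple_function_def
proof safe
  show "finite (T ` space M)" using assms(2) by (rule finite_subset[rotated]) auto
  show "T -` {T x} \<inter> space M \<in> sets M" for x
    using assms(1) by (rule measurable_sets) simp
qed

section \<open>Typical words\<close>

lemma sets_pow_measure:
  assumes "sets \<nu> = sets borel" shows "sets (pow_measure \<nu> n) = sets (prodE {..<n})"
  unfolding pow_measure_def prodE_def by (rule sets_PiM_cong) (simp_all add: assms)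

lemma measurable_prodE_component:
  assumes "i \<in> I" shows "(\<lambda>x. x i) \<in> prodE I \<rightarrow>\<^sub>M borel"
  unfolding prodE_def by (rule measurable_component_singleton[OF assms])

lemma prob_space_pow_measure: "prob_space \<nu> \<Longrightarrow> prob_space (pow_measure \<nu> n)"
  unfolding pow_measure_def by (rule prob_space_PiM)

lemma pow_measure_in_prob_algebra:
  "\<nu> \<in> probs borel \<Longrightarrow> pow_measure \<nu> n \<in> probs (prodE {..<n})"
  by (auto simp: space_prob_algebra sets_pow_measure prob_space_pow_measure)

lemma distr_pow_measure_component:
  assumes "prob_space \<nu>" "sets \<nu> = sets borel" "i < n"
  shows "distr (pow_measure \<nu> n) borel (\<lambda>x. x i) = \<nu>"
proof -
  have "distr (pow_measure \<nu> n) borel (\<lambda>x. x i) = distr (pow_measure \<nu> n) \<nu> (\<lambda>x. x i)"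
    by (rule distr_cong) (simp_all add: assms)
  also have "\<dots> = \<nu>" unfolding pow_measure_def by (rule distr_PiM_component) (use assms in auto)
  finally show ?thesis .
qed

lemma measurable_pow_measure_component:
  assumes "sets \<nu> = sets borel" "i < n"
  shows "(\<lambda>x. x i) \<in> pow_measure \<nu> n \<rightarrow>\<^sub>M borel"
  unfolding measurable_cong_sets[OF sets_pow_measure[OF assms(1)] refl]
  by (rule measurable_prodE_component) (use assms in simp)

lemma nn_integral_pow_measure_component:
  assumes "prob_space \<nu>" "sets \<nu> = sets borel" "i < n" "g \<in> borel_measurable borel"
  shows "(\<integral>\<^sup>+x. g (x i) \<partial>pow_measure \<nu> n) = (\<integral>\<^sup>+x. g x \<partial>\<nu>)"
proof -
  have "(\<integral>\<^sup>+x. g (x i) \<partial>pow_measure \<nu> n) = (\<integral>\<^sup>+x. g x \<partial>distr (pow_measure \<nu> n) borel (\<lambda>x. x i))"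
    by (rule nn_integral_distr[symmetric]) (use assms measurable_pow_measure_component in auto)
  then show ?thesis by (simp add: distr_pow_measure_component[OF assms(1-3)])
qed

text \<open>A quantitative weak law of large numbers: for centred independent summands the mixed
  moments vanish, and only the \<open>n\<close> diagonal terms remain, each at most
  \<open>B\<^sup>2\<close>.\<close>

lemma pow_measure_mean_square_deviation:
  fixes g :: "'a::polish_space \<Rightarrow> real"
  assumes nu: "prob_space \<nu>" and s: "sets \<nu> = sets borel" and g[measurable]: "g \<in> borel_measurable borel"
    and gB: "\<And>x. 0 \<le> g x" "\<And>x. g x \<le> B" and n: "n \<ge> 1"
  shows "(\<integral>x. ((\<Sum>i<n. g (x i)) / n - (\<integral>x. g x \<partial>\<nu>))\<^sup>2 \<partial>pow_measure \<nu> n) \<le> B\<^sup>2 / n"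
    and "integrable (pow_measure \<nu> n) (\<lambda>x. ((\<Sum>i<n. g (x i)) / n - (\<integral>x. g x \<partial>\<nu>))\<^sup>2)"
proof -
  interpret N: prob_space \<nu> by fact
  interpret P: prob_space "pow_measure \<nu> n" by (rule prob_space_pow_measure[OF nu])
  note [measurable_cong] = s
  have g'[measurable]: "g \<in> borel_measurable \<nu>" by simp
  define z where "z = (\<integral>x. g x \<partial>\<nu>)"
  have ig: "integrable \<nu> g"
    by (rule N.integrable_const_bound[where B=B]) (use gB in auto)
  have z0: "0 \<le> z" unfolding z_def by (rule Bochner_Integration.integral_nonneg) (use gB in auto)
  have zB: "z \<le> B"
    using integral_mono[OF ig, of "\<lambda>_. B"] gB N.prob_space by (simp add: z_def)
  define h where "h x = g x - z" for x
  \<comment> \<open>Both \<open>g x\<close> and its mean lie between 0 and \<open>B\<close>, so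
    centring costs no factor 2.\<close>
  have hB: "\<bar>h x\<bar> \<le> B" for x using gB[of x] z0 zB unfolding h_def by linarith
  have hm[measurable]: "h \<in> borel_measurable borel" unfolding h_def by measurable
  have hn[measurable]: "h \<in> borel_measurable \<nu>" using hm by simp
  have h0: "(\<integral>x. h x \<partial>\<nu>) = 0" unfolding h_def using ig N.prob_space by (simp add: z_def)
  have c[measurable]: "(\<lambda>x. x i) \<in> pow_measure \<nu> n \<rightarrow>\<^sub>M borel" if "i < n" for i
    by (rule measurable_pow_measure_component[OF s that])
  have ih: "integrable (pow_measure \<nu> n) (\<lambda>x. h (x i))" if "i < n" for i
    by (rule P.integrable_const_bound[where B=B]) (use hB that in auto)
  have Eh: "(\<integral>x. h (x i) \<partial>pow_measure \<nu> n) = 0" if "i < n" for i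
  proof -
    have "(\<integral>x. h (x i) \<partial>pow_measure \<nu> n) = (\<integral>x. h x \<partial>distr (pow_measure \<nu> n) borel (\<lambda>x. x i))"
      by (rule integral_distr[symmetric]) (use that in auto)
    then show ?thesis by (simp add: distr_pow_measure_component[OF nu s that] h0)
  qed
  have ihh: "integrable (pow_measure \<nu> n) (\<lambda>x. h (x i) * h (x j))" if "i < n" "j < n" for i j
  proof (rule P.integrable_const_bound[where B="B * B"])
    show "AE x in pow_measure \<nu> n. norm (h (x i) * h (x j)) \<le> B * B"
      by (intro AE_I2) (simp add: abs_mult, intro mult_mono hB order_trans[OF abs_ge_zero hB], auto)
  qed (use that in auto)
  have Ehh: "(\<integral>x. h (x i) * h (x j) \<partial>pow_measure \<nu> n) = 0" if "i < n" "j < n" "i \<noteq> j" for i j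
  proof -
    have ind: "P.indep_vars (\<lambda>_. \<nu>) (\<lambda>i x. x i) {i, j}"
      unfolding pow_measure_def
      by (rule prob_space.indep_vars_subset[OF prob_space_PiM indep_vars_PiM_coordinates]) (use that nu in auto)
    have "P.indep_vars (\<lambda>_. borel) (\<lambda>i x. h (x i)) {i, j}"
      by (rule P.indep_vars_compose2[OF ind]) (rule hn)
    then have "(\<integral>x. (\<Prod>k\<in>{i, j}. h (x k)) \<partial>pow_measure \<nu> n) = (\<Prod>k\<in>{i, j}. (\<integral>x. h (x k) \<partial>pow_measure \<nu> n))"
      by (intro P.indep_vars_lebesgue_integral) (use that ih in auto)
    then show ?thesis using that Eh by simp
  qed
  have sq: "((\<Sum>i<n. g (x i)) / n - z)\<^sup>2 = (\<Sum>i<n. \<Sum>j<n. h (x i) * h (x j)) / (real n)\<^sup>2" for x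
  proof -
    have "(\<Sum>i<n. g (x i)) / n - z = (\<Sum>i<n. h (x i)) / n"
      unfolding h_def using n by (simp add: sum_subtractf field_simps)
    then show ?thesis by (simp add: power_divide power2_eq_square sum_product)
  qed
  have "(\<integral>x. ((\<Sum>i<n. g (x i)) / n - z)\<^sup>2 \<partial>pow_measure \<nu> n) = (\<Sum>i<n. \<Sum>j<n. (\<integral>x. h (x i) * h (x j) \<partial>pow_measure \<nu> n)) / (real n)\<^sup>2"
  proof -
    have "(\<integral>x. (\<Sum>i<n. \<Sum>j<n. h (x i) * h (x j)) \<partial>pow_measure \<nu> n) = (\<Sum>i<n. (\<integral>x. (\<Sum>j<n. h (x i) * h (x j)) \<partial>pow_measure \<nu> n))"
      by (rule Bochner_Integration.integral_sum) (auto intro!: Bochner_Integration.integrable_sum ihh)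
    also have "\<dots> = (\<Sum>i<n. \<Sum>j<n. (\<integral>x. h (x i) * h (x j) \<partial>pow_measure \<nu> n))"
      by (intro sum.cong refl Bochner_Integration.integral_sum ihh) auto
    finally show ?thesis unfolding sq by simp
  qed
  also have "\<dots> \<le> (\<Sum>i<n. \<Sum>j<n. if i = j then B\<^sup>2 else 0) / (real n)\<^sup>2"
  proof (intro divide_right_mono sum_mono)
    fix i j assume ij: "i \<in> {..<n}" "j \<in> {..<n}"
    show "(\<integral>x. h (x i) * h (x j) \<partial>pow_measure \<nu> n) \<le> (if i = j then B\<^sup>2 else 0)"
    proof (cases "i = j")
      case True
      have "(\<integral>x. h (x i) * h (x j) \<partial>pow_measure \<nu> n) \<le> (\<integral>x. B\<^sup>2 \<partial>pow_measure \<nu> n)"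
      proof (rule integral_mono[OF ihh])
        show "h (x i) * h (x j) \<le> B\<^sup>2" for x
          using power_mono[OF hB[of "x i"], of 2] True by (simp add: power2_eq_square)
      qed (use ij in auto)
      then show ?thesis using True P.prob_space by simp
    qed (use Ehh ij in auto)
  qed auto
  also have "\<dots> = B\<^sup>2 / n" using n by (simp add: power2_eq_square)
  finally show "(\<integral>x. ((\<Sum>i<n. g (x i)) / n - (\<integral>x. g x \<partial>\<nu>))\<^sup>2 \<partial>pow_measure \<nu> n) \<le> B\<^sup>2 / n" by (simp add: z_def)
  show "integrable (pow_measure \<nu> n) (\<lambda>x. ((\<Sum>i<n. g (x i)) / n - (\<integral>x. g x \<partial>\<nu>))\<^sup>2)"
    unfolding z_def[symmetric] sq by (intro Bochner_Integration.integrable_divide Bochner_Integration.integrable_sum ihh) auto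
qed

section \<open>The Euclidean product metric\<close>

lemma dist_n_eq_L2_set: "dist_n n x y = L2_set (\<lambda>i. dist (x i) (y i)) {..<n}"
  unfolding dist_n_def L2_set_def ..

lemma dist_n_nonneg: "0 \<le> dist_n n x y" unfolding dist_n_eq_L2_set by (rule L2_set_nonneg)

lemma dist_n_commute: "dist_n n x y = dist_n n y x" unfolding dist_n_def by (simp add: dist_commute)

lemma dist_n_cong: "(\<And>i. i < n \<Longrightarrow> x i = x' i) \<Longrightarrow> (\<And>i. i < n \<Longrightarrow> y i = y' i) \<Longrightarrow> dist_n n x y = dist_n n x' y'"
  unfolding dist_n_def by (auto intro!: sum.cong arg_cong[of _ _ sqrt])

lemma dist_n_triangle: "dist_n n x z \<le> dist_n n x y + dist_n n y z"
proof -
  have "dist_n n x z \<le> L2_set (\<lambda>i. dist (x i) (y i) + dist (y i) (z i)) {..<n}"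
    unfolding dist_n_eq_L2_set by (rule L2_set_mono) (auto intro: dist_triangle)
  also have "\<dots> \<le> dist_n n x y + dist_n n y z"
    unfolding dist_n_eq_L2_set by (rule L2_set_triangle_ineq)
  finally show ?thesis .
qed

lemma dist_n_power2: "(dist_n n x y)\<^sup>2 = (\<Sum>i<n. (dist (x i) (y i))\<^sup>2)"
  unfolding dist_n_def by (simp add: sum_nonneg)

lemma (in prob_space) nn_integral_power2_le:
  assumes [measurable]: "f \<in> borel_measurable M"
  shows "(\<integral>\<^sup>+x. f x \<partial>M)\<^sup>2 \<le> (\<integral>\<^sup>+x. (f x)\<^sup>2 \<partial>M)"
  using Cauchy_Schwarz_nn_integral[of f M "\<lambda>_. 1"] by (simp add: emeasure_space_1)

lemma nn_integral_le_sqrt: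
  assumes M: "prob_space M" and f[measurable]: "f \<in> borel_measurable M" and nn: "\<And>x. 0 \<le> f x"
    and le: "(\<integral>\<^sup>+x. ennreal ((f x)\<^sup>2) \<partial>M) \<le> ennreal (c\<^sup>2)" and c: "0 \<le> c"
  shows "(\<integral>\<^sup>+x. ennreal (f x) \<partial>M) \<le> ennreal c"
proof -
  have "(\<integral>\<^sup>+x. ennreal (f x) \<partial>M)\<^sup>2 \<le> (\<integral>\<^sup>+x. (ennreal (f x))\<^sup>2 \<partial>M)"
    by (rule prob_space.nn_integral_power2_le[OF M]) measurable
  also have "\<dots> \<le> ennreal (c\<^sup>2)" using le by (simp add: ennreal_power nn)
  finally have sq: "(\<integral>\<^sup>+x. ennreal (f x) \<partial>M)\<^sup>2 \<le> ennreal (c\<^sup>2)" .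
  then have "(\<integral>\<^sup>+x. ennreal (f x) \<partial>M)\<^sup>2 \<noteq> \<top>" by (metis ennreal_neq_top top.extremum_unique)
  then have "(\<integral>\<^sup>+x. ennreal (f x) \<partial>M) \<noteq> \<top>" by (simp add: power_eq_top_ennreal)
  then obtain r where r: "(\<integral>\<^sup>+x. ennreal (f x) \<partial>M) = ennreal r" "0 \<le> r" by (cases "\<integral>\<^sup>+x. ennreal (f x) \<partial>M") auto
  then have "r\<^sup>2 \<le> c\<^sup>2" using sq c by (simp add: ennreal_power)
  then have "r \<le> c" by (rule power2_le_imp_le[OF _ c])
  then show ?thesis unfolding r(1) by (rule ennreal_leI)
qed

section \<open>Empirical frequencies and typicality\<close>

definition freq :: "nat \<Rightarrow> (nat \<Rightarrow> 'a) \<Rightarrow> 'a \<Rightarrow> real" where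
  "freq n w a = (\<Sum>i<n. of_bool (w i = a)) / n"

text \<open>Strong typicality in the sense of information theory, with an additive
  tolerance.\<close>

definition typical :: "real \<Rightarrow> 'a pmf \<Rightarrow> 'a set \<Rightarrow> nat \<Rightarrow> (nat \<Rightarrow> 'a) \<Rightarrow> bool" where
  "typical \<eta> p F n w \<longleftrightarrow> (\<forall>a\<in>F. \<bar>freq n w a - pmf p a\<bar> \<le> \<eta>)"

lemma typical_cong: "(\<And>i. i < n \<Longrightarrow> w i = w' i) \<Longrightarrow> typical \<eta> p F n w \<longleftrightarrow> typical \<eta> p F n w'"
proof -
  assume w: "\<And>i. i < n \<Longrightarrow> w i = w' i"
  have "(\<Sum>i<n. of_bool (w i = a)) = (\<Sum>i<n. (of_bool (w' i = a) :: real))" for a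
    by (rule sum.cong) (use w in auto)
  then show ?thesis unfolding typical_def freq_def by presburger
qed

lemma measurable_typical:
  fixes T :: "'a::polish_space \<Rightarrow> 'a"
  assumes T[measurable]: "T \<in> borel_measurable borel" and F: "finite F"
  shows "{x \<in> space (prodE {..<n}). typical \<eta> p F n (\<lambda>i. T (x i))} \<in> sets (prodE {..<n})"
proof -
  have [measurable]: "(\<lambda>x. x i) \<in> prodE {..<n} \<rightarrow>\<^sub>M borel" if "i < n" for i
    by (rule measurable_prodE_component) (use that in simp)
  have [measurable]: "(\<lambda>x. freq n (\<lambda>i. T (x i)) a) \<in> borel_measurable (prodE {..<n})" for a
    unfolding freq_def by measurable
  show ?thesis unfolding typical_def by (rule sets.sets_Collect_finite_All[OF _ F]) measurable
qed

text \<open>Chebyshev's inequality for each letter and a union bound over the finite set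
  \<open>F\<close> give an exceptional probability of at most
  \<open>card F / (\<eta>\<^sup>2 * n)\<close>. One parameter \<eta> serves both as tolerance and as
  bound on the probability.\<close>

lemma eventually_typical:
  fixes T :: "'a::polish_space \<Rightarrow> 'a"
  assumes nu: "prob_space \<nu>" and s: "sets \<nu> = sets borel" and T[measurable]: "T \<in> borel_measurable borel"
    and fin: "finite (range T)" and eta: "\<eta> > 0" and F: "finite F"
  shows "\<forall>\<^sub>F n in sequentially. measure (pow_measure \<nu> n) {x \<in> space (prodE {..<n}). \<not> typical \<eta> (law \<nu> T) F n (\<lambda>i. T (x i))} \<le> \<eta>"
proof -
  interpret N: prob_space \<nu> by fact
  note [measurable_cong] = s
  have sfT: "simple_function \<nu> T" by (rule simple_function_finite_range) (use fin in auto)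
  have bound: "measure (pow_measure \<nu> n) {x \<in> space (prodE {..<n}). \<not> typical \<eta> (law \<nu> T) F n (\<lambda>i. T (x i))} \<le> card F / (\<eta>\<^sup>2 * n)"
    if n: "n \<ge> 1" for n
  proof -
    interpret P: prob_space "pow_measure \<nu> n" by (rule prob_space_pow_measure[OF nu])
    have sp: "space (prodE {..<n}) = space (pow_measure \<nu> n)"
      using sets_eq_imp_space_eq[OF sets_pow_measure[OF s]] by metis
    have [measurable]: "(\<lambda>x. x i) \<in> pow_measure \<nu> n \<rightarrow>\<^sub>M borel" if "i < n" for i
      by (rule measurable_pow_measure_component[OF s that])
    define A where "A a = {x \<in> space (pow_measure \<nu> n). \<eta> < \<bar>freq n (\<lambda>i. T (x i)) a - pmf (law \<nu> T) a\<bar>}" for a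
    have A[measurable]: "A a \<in> sets (pow_measure \<nu> n)" for a unfolding A_def freq_def by measurable
    have Ab: "P.prob (A a) \<le> 1 / (\<eta>\<^sup>2 * n)" for a
    proof -
      let ?g = "\<lambda>x. of_bool (T x = a) :: real"
      have gm: "?g \<in> borel_measurable borel" by measurable
      have "(\<integral>x. ?g x \<partial>\<nu>) = (\<integral>x. indicator {x \<in> space \<nu>. T x = a} x \<partial>\<nu>)"
        by (rule Bochner_Integration.integral_cong) (auto simp: indicator_def)
      also have "\<dots> = pmf (law \<nu> T) a" unfolding pmf_law[OF nu sfT]
        by (simp add: Int_absorb2 subset_eq)
      finally have z: "(\<integral>x. ?g x \<partial>\<nu>) = pmf (law \<nu> T) a" .
      have dev: "(\<integral>x. (freq n (\<lambda>i. T (x i)) a - pmf (law \<nu> T) a)\<^sup>2 \<partial>pow_measure \<nu> n) \<le> 1 / n"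
        and int: "integrable (pow_measure \<nu> n) (\<lambda>x. (freq n (\<lambda>i. T (x i)) a - pmf (law \<nu> T) a)\<^sup>2)"
        using pow_measure_mean_square_deviation[OF nu s gm, of 1 n] n unfolding z freq_def by auto
      have "\<eta>\<^sup>2 * P.prob (A a) = (\<integral>x. \<eta>\<^sup>2 * indicator (A a) x \<partial>pow_measure \<nu> n)" by simp
      also have "\<dots> \<le> (\<integral>x. (freq n (\<lambda>i. T (x i)) a - pmf (law \<nu> T) a)\<^sup>2 \<partial>pow_measure \<nu> n)"
      proof (rule integral_mono[OF _ int])
        fix x
        show "\<eta>\<^sup>2 * indicator (A a) x \<le> (freq n (\<lambda>i. T (x i)) a - pmf (law \<nu> T) a)\<^sup>2"
        proof (cases "x \<in> A a")
          case True
          then have "\<eta> \<le> \<bar>freq n (\<lambda>i. T (x i)) a - pmf (law \<nu> T) a\<bar>" by (simp add: A_def)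
          from power_mono[OF this, of 2] show ?thesis using eta True by simp
        qed simp
      qed (auto intro!: integrable_mult_right integrable_real_indicator A simp: less_top[symmetric])
      finally have "\<eta>\<^sup>2 * P.prob (A a) \<le> 1 / n" using dev by simp
      from divide_right_mono[OF this, of "\<eta>\<^sup>2"] show ?thesis using eta by (simp add: mult.commute)
    qed
    have "{x \<in> space (prodE {..<n}). \<not> typical \<eta> (law \<nu> T) F n (\<lambda>i. T (x i))} = (\<Union>a\<in>F. A a)"
      unfolding sp typical_def A_def by (auto simp: not_le)
    moreover have "P.prob (\<Union>a\<in>F. A a) \<le> (\<Sum>a\<in>F. P.prob (A a))"
      by (rule P.finite_measure_subadditive_finite[OF F]) auto
    moreover have "(\<Sum>a\<in>F. P.prob (A a)) \<le> (\<Sum>a\<in>F. 1 / (\<eta>\<^sup>2 * n))" by (intro sum_mono Ab)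
    ultimately show ?thesis by simp
  qed
  have "(\<lambda>n. card F / \<eta>\<^sup>2 * (1 / real n)) \<longlonglongrightarrow> card F / \<eta>\<^sup>2 * 0" by (intro tendsto_intros lim_1_over_n)
  then have "\<forall>\<^sub>F n in sequentially. card F / \<eta>\<^sup>2 * (1 / real n) < \<eta>" using eta by (intro order_tendstoD(2)) auto
  then show ?thesis using eventually_ge_at_top[of 1]
  proof eventually_elim
    case (elim n)
    then show ?case using bound[of n] by simp
  qed
qed

section \<open>From concentration to transport\<close>

text \<open>Young's inequality
  \<open>2 * u * v \<le> \<delta> * u\<^sup>2 + v\<^sup>2 / \<delta>\<close>. The coefficient of the
  main term has to be close to 1 for the constant \<open>C\<close> to be preserved; the errors may
  carry a large coefficient because the discretisation can be refined afterwards.\<close>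

lemma dist_power2_le:
  fixes \<delta> :: real
  assumes "\<delta> > 0"
  shows "(dist x y)\<^sup>2 \<le> (1 + \<delta>) * (dist a b)\<^sup>2 + (1 + 1 / \<delta>) * (2 * (dist x a)\<^sup>2 + 2 * (dist y b)\<^sup>2)"
proof -
  define u v where "u = dist a b" and "v = dist x a + dist y b"
  have "dist x y \<le> u + v" unfolding u_def v_def
    using dist_triangle[of x y a] dist_triangle[of a y b] by (simp add: dist_commute)
  then have "(dist x y)\<^sup>2 \<le> (u + v)\<^sup>2" by (intro power_mono) auto
  also have "(u + v)\<^sup>2 \<le> (1 + \<delta>) * u\<^sup>2 + (1 + 1 / \<delta>) * v\<^sup>2"
  proof -
    have "0 \<le> (\<delta> * u - v)\<^sup>2 / \<delta>" using assms by simp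
    also have "\<dots> = \<delta> * u\<^sup>2 - 2 * u * v + v\<^sup>2 / \<delta>"
      using assms by (simp add: power2_eq_square field_simps)
    finally show ?thesis by (simp add: power2_eq_square algebra_simps)
  qed
  finally have 1: "(dist x y)\<^sup>2 \<le> (1 + \<delta>) * u\<^sup>2 + (1 + 1 / \<delta>) * v\<^sup>2" .
  have "v\<^sup>2 \<le> 2 * (dist x a)\<^sup>2 + 2 * (dist y b)\<^sup>2"
    using sum_squares_bound[of "dist x a" "dist y b"] unfolding v_def by (simp add: power2_sum)
  then have "(1 + 1 / \<delta>) * v\<^sup>2 \<le> (1 + 1 / \<delta>) * (2 * (dist x a)\<^sup>2 + 2 * (dist y b)\<^sup>2)"
    by (rule mult_left_mono) (use assms in simp)
  then show ?thesis using 1 unfolding u_def by linarith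
qed

lemma ennreal_weighted_sum3:
  fixes p q a b c :: real
  assumes "0 \<le> p" "0 \<le> q" "0 \<le> a" "0 \<le> b" "0 \<le> c"
  shows "ennreal p * ennreal a + (ennreal q * ennreal b + ennreal q * ennreal c) = ennreal (p * a + (q * b + q * c))"
  using assms by (simp add: ennreal_mult')

lemma ennreal_dist_power2_le:
  fixes \<delta> :: real
  assumes d: "\<delta> > 0"
  shows "sqd x y \<le> ennreal (1 + \<delta>) * sqd a b
    + (ennreal (2 * (1 + 1 / \<delta>)) * sqd x a + ennreal (2 * (1 + 1 / \<delta>)) * sqd y b)"
proof -
  have "(dist x y)\<^sup>2 \<le> (1 + \<delta>) * (dist a b)\<^sup>2 + (2 * (1 + 1 / \<delta>) * (dist x a)\<^sup>2 + 2 * (1 + 1 / \<delta>) * (dist y b)\<^sup>2)"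
    using dist_power2_le[OF d, of x y a b] by (simp add: algebra_simps)
  then show ?thesis
    using d by (subst ennreal_weighted_sum3) (auto simp del: ennreal_plus intro: ennreal_leI)
qed

lemma nn_integral_coupling_fst:
  assumes "\<gamma> \<in> couplings M N" "u \<in> borel_measurable M"
  shows "(\<integral>\<^sup>+z. u (fst z) \<partial>\<gamma>) = (\<integral>\<^sup>+x. u x \<partial>M)"
proof -
  have s: "sets \<gamma> = sets (M \<Otimes>\<^sub>M N)" "distr \<gamma> M fst = M" using assms(1) by (auto simp: couplings_def)
  have "fst \<in> \<gamma> \<rightarrow>\<^sub>M M" unfolding measurable_cong_sets[OF s(1) refl] by (rule measurable_fst)
  from nn_integral_distr[OF this, of u] assms(2) s(2) show ?thesis by simp
qed

lemma nn_integral_coupling_snd: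
  assumes "\<gamma> \<in> couplings M N" "u \<in> borel_measurable N"
  shows "(\<integral>\<^sup>+z. u (snd z) \<partial>\<gamma>) = (\<integral>\<^sup>+x. u x \<partial>N)"
proof -
  have s: "sets \<gamma> = sets (M \<Otimes>\<^sub>M N)" "distr \<gamma> N snd = N" using assms(1) by (auto simp: couplings_def)
  have "snd \<in> \<gamma> \<rightarrow>\<^sub>M N" unfolding measurable_cong_sets[OF s(1) refl] by (rule measurable_snd)
  from nn_integral_distr[OF this, of u] assms(2) s(2) show ?thesis by simp
qed

lemma integrable_bdd_lip1:
  assumes f: "bdd_lip1 n f" and P: "P \<in> probs (prodE {..<n})"
  shows "integrable P f"
proof -
  interpret prob_space P using P by (simp add: space_prob_algebra)
  have s: "sets P = sets (prodE {..<n})" using P by (simp add: space_prob_algebra)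
  obtain B where "\<And>x. x \<in> space (prodE {..<n}) \<Longrightarrow> norm (f x) \<le> B"
    using f unfolding bdd_lip1_def bounded_iff by auto
  then show ?thesis
    by (intro integrable_const_bound[where B=B] AE_I2)
       (use f s sets_eq_imp_space_eq[OF s] in \<open>auto simp: bdd_lip1_def cong: measurable_cong_sets\<close>)
qed

lemma nn_integral_dist_n_le:
  fixes T :: "'a::polish_space \<Rightarrow> 'a"
  assumes nu: "prob_space \<nu>" "sets \<nu> = sets borel" and T[measurable]: "T \<in> borel_measurable borel"
    and le: "sq_err T \<nu> \<le> ennreal (\<delta>\<^sup>2)" and d: "0 \<le> \<delta>"
  shows "(\<integral>\<^sup>+x. ennreal (dist_n n x (\<lambda>i. T (x i))) \<partial>pow_measure \<nu> n) \<le> ennreal (sqrt n * \<delta>)"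
proof (rule nn_integral_le_sqrt[OF prob_space_pow_measure[OF nu(1)]])
  have [measurable]: "(\<lambda>x. x i) \<in> pow_measure \<nu> n \<rightarrow>\<^sub>M borel" if "i < n" for i
    by (rule measurable_pow_measure_component[OF nu(2) that])
  show "(\<lambda>x. dist_n n x (\<lambda>i. T (x i))) \<in> borel_measurable (pow_measure \<nu> n)"
    unfolding dist_n_def by measurable
  have "(\<integral>\<^sup>+x. ennreal ((dist_n n x (\<lambda>i. T (x i)))\<^sup>2) \<partial>pow_measure \<nu> n) = (\<integral>\<^sup>+x. (\<Sum>i<n. sqd (x i) (T (x i))) \<partial>pow_measure \<nu> n)"
    by (simp add: dist_n_power2 sum_ennreal)
  also have "\<dots> = (\<Sum>i<n. \<integral>\<^sup>+x. sqd (x i) (T (x i)) \<partial>pow_measure \<nu> n)"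
    by (rule nn_integral_sum) measurable
  also have "\<dots> = (\<Sum>i<n. \<integral>\<^sup>+x. sqd x (T x) \<partial>\<nu>)"
    by (intro sum.cong refl nn_integral_pow_measure_component[OF nu, where g="\<lambda>x. sqd x (T x)"]) auto
  also have "\<dots> \<le> (\<Sum>i<n. ennreal (\<delta>\<^sup>2))" by (intro sum_mono le)
  also have "\<dots> = ennreal ((sqrt n * \<delta>)\<^sup>2)"
    by (simp add: power_mult_distrib ennreal_mult' ennreal_of_nat_eq_real_of_nat)
  finally show "(\<integral>\<^sup>+x. ennreal ((dist_n n x (\<lambda>i. T (x i)))\<^sup>2) \<partial>pow_measure \<nu> n) \<le> ennreal ((sqrt n * \<delta>)\<^sup>2)" .
qed (use d dist_n_nonneg in auto)

text \<open>Truncation at \<open>R\<close> is 1-Lipschitz in each coordinate, and Minkowski's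
  inequality combines the coordinates. Without truncation the norm would not be an admissible test
  function, since it may be unbounded.\<close>

lemma bdd_lip1_truncated_norm:
  fixes x0 :: "'a::polish_space"
  assumes R: "R \<ge> 0"
  shows "bdd_lip1 n (\<lambda>x. sqrt (\<Sum>i<n. (min (dist (x i) x0) R)\<^sup>2))"
  unfolding bdd_lip1_def
proof (intro conjI ballI)
  have [measurable]: "(\<lambda>x. x i) \<in> prodE {..<n} \<rightarrow>\<^sub>M borel" if "i < n" for i
    by (rule measurable_prodE_component) (use that in simp)
  show "(\<lambda>x. sqrt (\<Sum>i<n. (min (dist (x i) x0) R)\<^sup>2)) \<in> borel_measurable (prodE {..<n})" by measurable
  show "bounded ((\<lambda>x. sqrt (\<Sum>i<n. (min (dist (x i) x0) R)\<^sup>2)) ` space (prodE {..<n}))"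
  proof (rule boundedI)
    fix r assume "r \<in> (\<lambda>x. sqrt (\<Sum>i<n. (min (dist (x i) x0) R)\<^sup>2)) ` space (prodE {..<n})"
    then obtain x where r: "r = sqrt (\<Sum>i<n. (min (dist (x i) x0) R)\<^sup>2)" by auto
    have "(\<Sum>i<n. (min (dist (x i) x0) R)\<^sup>2) \<le> (\<Sum>i<n. R\<^sup>2)" by (intro sum_mono power_mono) (use R in auto)
    then show "norm r \<le> sqrt (\<Sum>i<n. R\<^sup>2)" unfolding r by (simp add: sum_nonneg)
  qed
  have one: "sqrt (\<Sum>i<n. (min (dist (x i) x0) R)\<^sup>2) \<le> sqrt (\<Sum>i<n. (min (dist (y i) x0) R)\<^sup>2) + dist_n n x y" for x y
  proof -
    have "L2_set (\<lambda>i. min (dist (x i) x0) R) {..<n} \<le> L2_set (\<lambda>i. min (dist (y i) x0) R + dist (x i) (y i)) {..<n}"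
    proof (rule L2_set_mono)
      fix i
      have "dist (x i) x0 \<le> dist (y i) x0 + dist (x i) (y i)" using dist_triangle[of "x i" x0 "y i"] by simp
      then show "min (dist (x i) x0) R \<le> min (dist (y i) x0) R + dist (x i) (y i)"
        by (cases "dist (y i) x0 \<le> R") (auto simp: min_def intro: add_increasing2)
      show "0 \<le> min (dist (x i) x0) R" using R by simp
    qed
    also have "\<dots> \<le> L2_set (\<lambda>i. min (dist (y i) x0) R) {..<n} + dist_n n x y"
      unfolding dist_n_eq_L2_set by (rule L2_set_triangle_ineq)
    finally show ?thesis unfolding L2_set_def .
  qed
  show "\<bar>sqrt (\<Sum>i<n. (min (dist (x i) x0) R)\<^sup>2) - sqrt (\<Sum>i<n. (min (dist (y i) x0) R)\<^sup>2)\<bar> \<le> dist_n n x y" for x y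
    using one[of x y] one[of y x] dist_n_commute[of n x y] by linarith
qed

lemma nn_integral_bdd_lip1:
  assumes f: "bdd_lip1 n f" and P: "P \<in> probs (prodE {..<n})" and nn: "\<And>x. 0 \<le> f x"
  shows "(\<integral>\<^sup>+x. ennreal (f x) \<partial>P) = ennreal (\<integral>x. f x \<partial>P)"
  by (rule nn_integral_eq_integral[OF integrable_bdd_lip1[OF f P]]) (simp add: nn)

text \<open>Test the hypothesis on the truncated norm of the word. Under \<mu> its mean is at most
  \<open>sqrt n * m\<close>; under \<nu> the law of large numbers makes it about
  \<open>sqrt n * sqrt z\<close>, with \<open>z\<close> the truncated second moment. Hence
  \<open>sqrt z \<le> m + c\<close> for every truncation level, and monotone convergence removes the
  truncation.\<close>

lemma second_moment_le_if_concentration: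
  fixes \<mu> \<nu> :: "'a::polish_space measure"
  assumes mu: "\<mu> \<in> probs borel" and nu: "\<nu> \<in> probs borel"
    and c: "c \<ge> 0" and m: "m \<ge> 0" and mom: "sq_moment x0 \<mu> \<le> ennreal (m\<^sup>2)"
    and conc: "\<And>n f. n \<ge> 1 \<Longrightarrow> bdd_lip1 n f \<Longrightarrow> (\<integral>x. f x \<partial>pow_measure \<nu> n) - (\<integral>x. f x \<partial>pow_measure \<mu> n) \<le> sqrt n * c"
  shows "sq_moment x0 \<nu> \<le> ennreal ((m + c)\<^sup>2)"
proof -
  have pm: "prob_space \<mu>" "sets \<mu> = sets borel" and pn: "prob_space \<nu>" "sets \<nu> = sets borel"
    using mu nu by (auto simp: space_prob_algebra)
  interpret N: prob_space \<nu> by fact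
  note [measurable_cong] = pm(2) pn(2)
  have trunc: "(\<integral>\<^sup>+x. ennreal ((min (dist x x0) R)\<^sup>2) \<partial>\<nu>) \<le> ennreal ((m + c)\<^sup>2)" if R: "R \<ge> 0" for R
  proof -
    define g where "g x = (min (dist x x0) R)\<^sup>2" for x
    have g[measurable]: "g \<in> borel_measurable borel" unfolding g_def by measurable
    have gR: "0 \<le> g x" "g x \<le> R\<^sup>2" for x unfolding g_def using R by (auto intro!: power_mono)
    define z where "z = (\<integral>x. g x \<partial>\<nu>)"
    have z0: "0 \<le> z" unfolding z_def by (rule Bochner_Integration.integral_nonneg) (simp add: gR)
    have intg: "integrable \<nu> g" by (rule N.integrable_const_bound[where B="R\<^sup>2"]) (use gR in auto)
    have key: "z \<le> sqrt z * (m + c) + R\<^sup>2 * sqrt (1 / n)" if n: "n \<ge> 1" for n :: nat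
    proof -
      let ?N = "pow_measure \<nu> n" and ?M = "pow_measure \<mu> n"
      interpret PN: prob_space ?N by (rule prob_space_pow_measure[OF pn(1)])
      interpret PM: prob_space ?M by (rule prob_space_pow_measure[OF pm(1)])
      define f where "f x = sqrt (\<Sum>i<n. g (x i))" for x
      have f: "bdd_lip1 n f" using bdd_lip1_truncated_norm[OF R, of n x0] unfolding f_def g_def .
      have inN: "integrable ?N f" by (rule integrable_bdd_lip1[OF f pow_measure_in_prob_algebra[OF nu]])
      have [measurable]: "(\<lambda>x. x i) \<in> ?M \<rightarrow>\<^sub>M borel" if "i < n" for i
        by (rule measurable_pow_measure_component[OF pm(2) that])
      have [measurable]: "(\<lambda>x. x i) \<in> ?N \<rightarrow>\<^sub>M borel" if "i < n" for i
        by (rule measurable_pow_measure_component[OF pn(2) that])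
      have fnn: "0 \<le> f x" for x unfolding f_def by (simp add: sum_nonneg gR)
      have "(\<integral>\<^sup>+x. ennreal (f x) \<partial>?M) \<le> (\<integral>\<^sup>+x. ennreal (dist_n n x (\<lambda>i. x0)) \<partial>?M)"
        unfolding f_def g_def dist_n_def using R
        by (intro nn_integral_mono ennreal_leI real_sqrt_le_mono sum_mono power_mono) auto
      also have "\<dots> \<le> ennreal (sqrt n * m)"
        using nn_integral_dist_n_le[OF pm, of "\<lambda>_. x0" m n] mom m by simp
      finally have fM: "(\<integral>x. f x \<partial>?M) \<le> sqrt n * m"
        using m unfolding nn_integral_bdd_lip1[OF f pow_measure_in_prob_algebra[OF mu] fnn] by simp
      define Y where "Y x = \<bar>(\<Sum>i<n. g (x i)) / n - z\<bar>" for x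
      have Ym[measurable]: "Y \<in> borel_measurable ?N" unfolding Y_def by measurable
      have dev: "(\<integral>x. (Y x)\<^sup>2 \<partial>?N) \<le> (R\<^sup>2)\<^sup>2 / n" and devi: "integrable ?N (\<lambda>x. (Y x)\<^sup>2)"
        using pow_measure_mean_square_deviation[OF pn g gR n] unfolding Y_def z_def by auto
      have "(\<integral>\<^sup>+x. ennreal (Y x) \<partial>?N) \<le> ennreal (R\<^sup>2 * sqrt (1 / n))"
      proof (rule nn_integral_le_sqrt[OF PN.prob_space_axioms Ym])
        show "(\<integral>\<^sup>+x. ennreal ((Y x)\<^sup>2) \<partial>?N) \<le> ennreal ((R\<^sup>2 * sqrt (1 / n))\<^sup>2)"
          using dev by (subst nn_integral_eq_integral[OF devi]) (auto simp: power_mult_distrib intro!: ennreal_leI)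
      qed (auto simp: Y_def)
      moreover have Yi: "integrable ?N Y"
        by (rule PN.square_integrable_imp_integrable[OF Ym devi])
      moreover have "(\<integral>\<^sup>+x. ennreal (Y x) \<partial>?N) = ennreal (\<integral>x. Y x \<partial>?N)"
        by (rule nn_integral_eq_integral[OF Yi]) (simp add: Y_def)
      ultimately have EY: "(\<integral>x. Y x \<partial>?N) \<le> R\<^sup>2 * sqrt (1 / n)" by simp
      \<comment> \<open>\<open>z - Y x\<close> is at most the smaller of \<open>z\<close> and the
        empirical mean \<open>S\<close>, hence at most their geometric mean. This replaces a lower
        bound on the expectation of a square root.\<close>
      have pw: "z - Y x \<le> sqrt z * (f x / sqrt n)" for x
      proof -
        define S where "S = (\<Sum>i<n. g (x i)) / n"
        have S0: "0 \<le> S" unfolding S_def by (intro divide_nonneg_nonneg sum_nonneg gR) auto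
        have fS: "f x / sqrt n = sqrt S" unfolding f_def S_def by (simp add: real_sqrt_divide)
        show ?thesis
        proof (cases "S \<ge> z")
          case True
          then have "z \<le> sqrt z * sqrt S" using z0 mult_left_mono[OF real_sqrt_le_mono[OF True], of "sqrt z"] by simp
          then show ?thesis unfolding fS Y_def by simp
        next
          case False
          then have "S \<le> sqrt z * sqrt S" using S0 mult_right_mono[of "sqrt S" "sqrt z" "sqrt S"] by simp
          then show ?thesis unfolding fS Y_def S_def[symmetric] using False by simp
        qed
      qed
      have "z - (\<integral>x. Y x \<partial>?N) = (\<integral>x. z - Y x \<partial>?N)" using Yi PN.prob_space by simp
      also have "\<dots> \<le> (\<integral>x. sqrt z * (f x / sqrt n) \<partial>?N)"
        by (rule integral_mono) (use Yi inN pw in auto)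
      also have "\<dots> = sqrt z * ((\<integral>x. f x \<partial>?N) / sqrt n)" by simp
      also have "\<dots> \<le> sqrt z * (m + c)"
      proof (rule mult_left_mono)
        have "(\<integral>x. f x \<partial>?N) \<le> sqrt n * (m + c)" using conc[OF n f] fM by (simp add: algebra_simps)
        then show "(\<integral>x. f x \<partial>?N) / sqrt n \<le> m + c" using n by (simp add: field_simps)
      qed (use z0 in simp)
      finally show ?thesis using EY by simp
    qed
    \<comment> \<open>Here \<open>n\<close> tends to infinity at fixed \<open>R\<close>, because the
      error term grows with \<open>R\<close>.\<close>
    have "z \<le> sqrt z * (m + c) + R\<^sup>2 * sqrt 0"
    proof (rule LIMSEQ_le_const)
      show "(\<lambda>n. sqrt z * (m + c) + R\<^sup>2 * sqrt (1 / real n)) \<longlonglongrightarrow> sqrt z * (m + c) + R\<^sup>2 * sqrt 0"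
        by (intro tendsto_intros lim_1_over_n)
    qed (use key in blast)
    then have "sqrt z * sqrt z \<le> sqrt z * (m + c)" using z0 by simp
    then have "sqrt z \<le> m + c" using z0 m c by (cases "z = 0") (auto simp del: real_sqrt_mult_self simp: mult_le_cancel_left)
    then have "z \<le> (m + c)\<^sup>2" using z0 by (metis real_sqrt_le_iff real_sqrt_unique real_sqrt_pow2 power_mono real_sqrt_ge_zero)
    moreover have "(\<integral>\<^sup>+x. ennreal (g x) \<partial>\<nu>) = ennreal z"
      unfolding z_def by (rule nn_integral_eq_integral[OF intg]) (simp add: gR)
    ultimately show ?thesis unfolding g_def by (simp add: ennreal_leI)
  qed
  have "(\<lambda>R. \<integral>\<^sup>+x. ennreal ((min (dist x x0) (real R))\<^sup>2) \<partial>\<nu>) \<longlonglongrightarrow> sq_moment x0 \<nu>"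
  proof (rule nn_integral_LIMSEQ)
    show "incseq (\<lambda>R x. ennreal ((min (dist x x0) (real R))\<^sup>2))"
      by (auto simp: incseq_def le_fun_def intro!: ennreal_leI power_mono)
    fix x
    have "\<forall>\<^sub>F R in sequentially. ennreal ((min (dist x x0) (real R))\<^sup>2) = sqd x x0"
      using eventually_ge_at_top[of "nat \<lceil>dist x x0\<rceil>"]
      by eventually_elim (auto simp: min_def nat_ceiling_le_eq)
    then show "(\<lambda>R. ennreal ((min (dist x x0) (real R))\<^sup>2)) \<longlonglongrightarrow> sqd x x0"
      by (rule tendsto_eventually)
  qed measurable
  then show ?thesis by (rule LIMSEQ_le_const2) (use trunc in auto)
qed

text \<open>The cap \<open>K\<close> makes the distance to a set bounded, and finiteness of the set
  makes the infimum measurable; both are demanded of test functions.\<close>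

lemma bdd_lip1_set_distance:
  fixes A :: "(nat \<Rightarrow> 'a::polish_space) set"
  assumes A: "finite A" "A \<noteq> {}" and K: "K \<ge> 0"
  shows "bdd_lip1 n (\<lambda>x. INF w\<in>A. min K (dist_n n x w))"
  unfolding bdd_lip1_def
proof (intro conjI ballI)
  have [measurable]: "(\<lambda>x. x i) \<in> prodE {..<n} \<rightarrow>\<^sub>M borel" if "i < n" for i
    by (rule measurable_prodE_component) (use that in simp)
  show "(\<lambda>x. INF w\<in>A. min K (dist_n n x w)) \<in> borel_measurable (prodE {..<n})"
    by (rule borel_measurable_cINF_real) (use A in \<open>auto simp: dist_n_def intro: countable_finite\<close>)
  have bdd: "bdd_below ((\<lambda>w. min K (dist_n n x w)) ` A)" for x
    by (rule bdd_belowI2[of _ 0]) (use K dist_n_nonneg in auto)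
  have lo: "0 \<le> (INF w\<in>A. min K (dist_n n x w))" for x
    by (rule cINF_greatest) (use A K dist_n_nonneg in auto)
  have up: "(INF w\<in>A. min K (dist_n n x w)) \<le> K" for x
  proof -
    obtain w where "w \<in> A" using A by auto
    then show ?thesis by (rule cINF_lower2[OF bdd]) simp
  qed
  show "bounded ((\<lambda>x. INF w\<in>A. min K (dist_n n x w)) ` space (prodE {..<n}))"
    by (rule boundedI[where B=K]) (use lo up in auto)
  have one: "(INF w\<in>A. min K (dist_n n x w)) - dist_n n x y \<le> (INF w\<in>A. min K (dist_n n y w))" for x y
  proof (rule cINF_greatest[OF A(2)])
    fix w assume "w \<in> A"
    then have "(INF w\<in>A. min K (dist_n n x w)) \<le> min K (dist_n n x w)" by (rule cINF_lower[OF bdd])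
    then show "(INF w\<in>A. min K (dist_n n x w)) - dist_n n x y \<le> min K (dist_n n y w)"
      using dist_n_triangle[of n x w y] dist_n_nonneg[of n x y] by (auto simp: min_def split: if_splits)
  qed
  show "\<bar>(INF w\<in>A. min K (dist_n n x w)) - (INF w\<in>A. min K (dist_n n y w))\<bar> \<le> dist_n n x y" for x y
    using one[of x y] one[of y x] dist_n_commute[of n x y] by linarith
qed

lemma (in prob_space) exists_le_of_nn_integral_le:
  assumes [measurable]: "h \<in> borel_measurable M" and le: "(\<integral>\<^sup>+x. h x \<partial>M) \<le> v" and v: "v < \<infinity>"
  shows "\<exists>x\<in>space M. h x \<le> v"
proof (rule ccontr)
  assume "\<not> ?thesis"
  then have gt: "v < h x" if "x \<in> space M" for x using that by (auto simp: not_le)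
  have "(\<integral>\<^sup>+x. v \<partial>M) < (\<integral>\<^sup>+x. h x \<partial>M)"
  proof (rule nn_integral_less)
    show "AE x in M. v \<le> h x" using gt by (intro AE_I2) (auto intro: less_imp_le)
    show "\<not> (AE x in M. h x \<le> v)"
    proof
      assume "AE x in M. h x \<le> v"
      then have "AE x in M. False" using AE_space by eventually_elim (use gt in \<open>auto simp: not_le[symmetric]\<close>)
      then show False by simp
    qed
  qed (use v in \<open>auto simp: emeasure_space_1\<close>)
  then show False using le by (simp add: emeasure_space_1)
qed

text \<open>The test function is the truncated distance to the finite set of \<open>\<mu>\<close>-typical words.\<close>
lemma typical_words_at_small_distance:
  fixes \<mu> \<nu> :: "'a::polish_space measure" and T :: "'a \<Rightarrow> 'a"
  assumes mu: "\<mu> \<in> probs borel" and nu: "\<nu> \<in> probs borel"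
    and T[measurable]: "T \<in> borel_measurable borel" and fin: "finite (range T)"
    and c: "c \<ge> 0" and d: "0 \<le> \<delta>" and eta: "0 \<le> \<eta>" "\<eta> < 1" and R: "c + 2 * \<delta> + 2 * \<eta> * R < R" "0 \<le> R" and n: "n \<ge> 1"
    and Tm: "sq_err T \<mu> \<le> ennreal (\<delta>\<^sup>2)" and Tn: "sq_err T \<nu> \<le> ennreal (\<delta>\<^sup>2)"
    and conc: "\<And>f. bdd_lip1 n f \<Longrightarrow> (\<integral>x. f x \<partial>pow_measure \<nu> n) - (\<integral>x. f x \<partial>pow_measure \<mu> n) \<le> sqrt n * c"
    and tm: "measure (pow_measure \<mu> n) {x \<in> space (prodE {..<n}). \<not> typical \<eta> s (range T) n (\<lambda>i. T (x i))} \<le> \<eta>"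
    and tn: "measure (pow_measure \<nu> n) {x \<in> space (prodE {..<n}). \<not> typical \<eta> t (range T) n (\<lambda>i. T (x i))} \<le> \<eta>"
  shows "\<exists>w w'. (\<forall>i. w i \<in> range T \<or> n \<le> i) \<and> (\<forall>i. w' i \<in> range T) \<and> typical \<eta> s (range T) n w \<and> typical \<eta> t (range T) n w'
           \<and> dist_n n w w' \<le> sqrt n * (c + 2 * \<delta> + 2 * \<eta> * R)"
proof -
  have pm: "prob_space \<mu>" "sets \<mu> = sets borel" and pn: "prob_space \<nu>" "sets \<nu> = sets borel"
    using mu nu by (auto simp: space_prob_algebra)
  let ?N = "pow_measure \<nu> n" and ?M = "pow_measure \<mu> n"
  interpret PN: prob_space ?N by (rule prob_space_pow_measure[OF pn(1)])
  interpret PM: prob_space ?M by (rule prob_space_pow_measure[OF pm(1)])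
  note [measurable_cong] = sets_pow_measure[OF pm(2), of n] sets_pow_measure[OF pn(2), of n]
  have spM: "space ?M = space (prodE {..<n})" and spN: "space ?N = space (prodE {..<n})"
    by (rule sets_eq_imp_space_eq, rule sets_pow_measure, rule pm pn)+
  have [measurable]: "(\<lambda>x. x i) \<in> prodE {..<n} \<rightarrow>\<^sub>M borel" if "i < n" for i
    by (rule measurable_prodE_component) (use that in simp)
  have dm[measurable]: "(\<lambda>x. dist_n n x (\<lambda>i. T (x i))) \<in> borel_measurable (prodE {..<n})"
    unfolding dist_n_def by measurable
  define BM where "BM = {x \<in> space (prodE {..<n}). \<not> typical \<eta> s (range T) n (\<lambda>i. T (x i))}"
  define BN where "BN = {x \<in> space (prodE {..<n}). \<not> typical \<eta> t (range T) n (\<lambda>i. T (x i))}"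
  have BM[measurable]: "BM \<in> sets (prodE {..<n})"
    unfolding BM_def by (rule sets.sets_Collect_neg[OF measurable_typical[OF T fin]])
  have BN[measurable]: "BN \<in> sets (prodE {..<n})"
    unfolding BN_def by (rule sets.sets_Collect_neg[OF measurable_typical[OF T fin]])
  define A where "A = {w \<in> PiE {..<n} (\<lambda>_. range T). typical \<eta> s (range T) n w}"
  have Af: "finite A" unfolding A_def using finite_PiE[of "{..<n}" "\<lambda>_. range T"] fin by simp
  have TA: "restrict (\<lambda>i. T (x i)) {..<n} \<in> A" if "x \<in> space (prodE {..<n})" "x \<notin> BM" for x
    using that typical_cong[of n "\<lambda>i. T (x i)" "restrict (\<lambda>i. T (x i)) {..<n}"] unfolding A_def BM_def by auto
  \<comment> \<open>As \<open>\<eta> < 1\<close>, the atypical words do not fill the space. Hence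
    some typical word exists and the infimum defining \<open>f\<close> runs over a nonempty
    set.\<close>
  have "\<exists>x\<in>space (prodE {..<n}). x \<notin> BM"
  proof (rule ccontr)
    assume "\<not> ?thesis"
    then have "BM = space ?M" unfolding spM BM_def by auto
    then show False using tm eta PM.prob_space unfolding BM_def[symmetric] by simp
  qed
  then have Ane: "A \<noteq> {}" using TA by blast
  \<comment> \<open>The cap scales with \<open>sqrt n\<close> like every distance here. It lies
    above the final bound \<open>v\<close>, so a value of \<open>f\<close> below \<open>v\<close> is
    a genuine distance and not the cap.\<close>
  define K where "K = sqrt n * R"
  have K0: "0 \<le> K" unfolding K_def using R by simp
  define f where "f x = (INF w\<in>A. min K (dist_n n x w))" for x
  have f: "bdd_lip1 n f" unfolding f_def by (rule bdd_lip1_set_distance[OF Af Ane K0])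
  have [measurable]: "f \<in> borel_measurable (prodE {..<n})" using f by (simp add: bdd_lip1_def)
  have fval: "\<exists>w\<in>A. f x = min K (dist_n n x w)" for x
  proof -
    have "f x = Min ((\<lambda>w. min K (dist_n n x w)) ` A)" unfolding f_def
      by (rule cInf_eq_Min) (use Af Ane in auto)
    then have "f x \<in> (\<lambda>w. min K (dist_n n x w)) ` A" using Min_in[of "(\<lambda>w. min K (dist_n n x w)) ` A"] Af Ane by simp
    then show ?thesis by auto
  qed
  have fnn: "0 \<le> f x" for x using fval[of x] K0 dist_n_nonneg[of n x] by auto
  have fle: "f x \<le> min K (dist_n n x w)" if "w \<in> A" for x w
    unfolding f_def by (rule cINF_lower[OF bdd_belowI2[of _ 0] that]) (use K0 dist_n_nonneg in auto)
  have fK: "f x \<le> K" for x using fval[of x] by auto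
  \<comment> \<open>Off \<open>BM\<close> the discretised word itself belongs to \<open>A\<close>,
    so \<open>f\<close> is at most the discretisation error; on the unlikely set \<open>BM\<close>
    only the cap is available.\<close>
  have "(\<integral>\<^sup>+x. ennreal (f x) \<partial>?M) \<le> (\<integral>\<^sup>+x. ennreal (dist_n n x (\<lambda>i. T (x i))) + ennreal K * indicator BM x \<partial>?M)"
  proof (rule nn_integral_mono)
    fix x assume x: "x \<in> space ?M"
    show "ennreal (f x) \<le> ennreal (dist_n n x (\<lambda>i. T (x i))) + ennreal K * indicator BM x"
    proof (cases "x \<in> BM")
      case True
      then show ?thesis using fK[of x] by (simp add: ennreal_leI add_increasing)
    next
      case False
      have "f x \<le> dist_n n x (restrict (\<lambda>i. T (x i)) {..<n})" using fle[OF TA[OF _ False], of x] x by (simp add: spM)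
      also have "\<dots> = dist_n n x (\<lambda>i. T (x i))" by (rule dist_n_cong) auto
      finally show ?thesis using False by (simp add: ennreal_leI)
    qed
  qed
  also have "\<dots> = (\<integral>\<^sup>+x. ennreal (dist_n n x (\<lambda>i. T (x i))) \<partial>?M) + ennreal K * emeasure ?M BM"
    by (subst nn_integral_add) (auto simp: nn_integral_cmult_indicator)
  also have "\<dots> \<le> ennreal (sqrt n * \<delta>) + ennreal K * ennreal \<eta>"
  proof (intro add_mono mult_left_mono)
    show "(\<integral>\<^sup>+x. ennreal (dist_n n x (\<lambda>i. T (x i))) \<partial>?M) \<le> ennreal (sqrt n * \<delta>)"
      by (rule nn_integral_dist_n_le[OF pm T Tm d])
    show "emeasure ?M BM \<le> ennreal \<eta>" using tm unfolding BM_def[symmetric] PM.emeasure_eq_measure by (rule ennreal_leI)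
  qed simp
  also have "\<dots> = ennreal (sqrt n * \<delta> + K * \<eta>)" using d K0 eta by (simp add: ennreal_mult')
  finally have fM: "(\<integral>x. f x \<partial>?M) \<le> sqrt n * \<delta> + K * \<eta>"
    using d K0 eta unfolding nn_integral_bdd_lip1[OF f pow_measure_in_prob_algebra[OF mu] fnn] by (simp del: ennreal_plus)
  define v where "v = sqrt n * (c + 2 * \<delta> + 2 * \<eta> * R)"
  have v0: "0 \<le> v" unfolding v_def using c d eta R by simp
  \<comment> \<open>One function penalises all three defects of a sample from \<nu>: distance to the
    \<mu>-typical words, discretisation error, and atypicality at the price \<open>K\<close>. A
    point with \<open>h y \<le> v < K\<close> is then good in every respect. In \<open>v\<close>,
    one \<delta> and one \<open>\<eta> * R\<close> come from \<mu>, the others from \<nu>.\<close>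
  define h where "h x = f x + dist_n n x (\<lambda>i. T (x i)) + K * indicator BN x" for x
  have hn: "ennreal (h x) = ennreal (f x) + ennreal (dist_n n x (\<lambda>i. T (x i))) + ennreal K * indicator BN x" for x
    unfolding h_def using fnn[of x] dist_n_nonneg[of n x "\<lambda>i. T (x i)"] K0
    by (auto simp: indicator_def)
  have "(\<integral>\<^sup>+x. ennreal (h x) \<partial>?N) = (\<integral>\<^sup>+x. ennreal (f x) \<partial>?N) + (\<integral>\<^sup>+x. ennreal (dist_n n x (\<lambda>i. T (x i))) \<partial>?N) + ennreal K * emeasure ?N BN"
    unfolding hn by (subst nn_integral_add; (subst nn_integral_add)?) (auto simp: nn_integral_cmult_indicator)
  also have "\<dots> \<le> ennreal (sqrt n * c + (sqrt n * \<delta> + K * \<eta>)) + ennreal (sqrt n * \<delta>) + ennreal K * ennreal \<eta>"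
  proof (intro add_mono mult_left_mono)
    show "(\<integral>\<^sup>+x. ennreal (f x) \<partial>?N) \<le> ennreal (sqrt n * c + (sqrt n * \<delta> + K * \<eta>))"
      unfolding nn_integral_bdd_lip1[OF f pow_measure_in_prob_algebra[OF nu] fnn]
      using conc[OF f] fM by (intro ennreal_leI) simp
    show "(\<integral>\<^sup>+x. ennreal (dist_n n x (\<lambda>i. T (x i))) \<partial>?N) \<le> ennreal (sqrt n * \<delta>)"
      by (rule nn_integral_dist_n_le[OF pn T Tn d])
    show "emeasure ?N BN \<le> ennreal \<eta>" using tn unfolding BN_def[symmetric] PN.emeasure_eq_measure by (rule ennreal_leI)
  qed simp
  also have "\<dots> = ennreal v"
  proof -
    have "ennreal (sqrt n * c + (sqrt n * \<delta> + K * \<eta>)) + ennreal (sqrt n * \<delta>) + ennreal K * ennreal \<eta>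
      = ennreal (sqrt n * c + (sqrt n * \<delta> + K * \<eta>) + sqrt n * \<delta> + K * \<eta>)"
      unfolding ennreal_mult'[OF K0, symmetric] using c d K0 eta by (simp add: ennreal_plus[symmetric] del: ennreal_plus)
    also have "sqrt n * c + (sqrt n * \<delta> + K * \<eta>) + sqrt n * \<delta> + K * \<eta> = v"
      unfolding v_def K_def by (simp add: algebra_simps)
    finally show ?thesis .
  qed
  finally have "(\<integral>\<^sup>+x. ennreal (h x) \<partial>?N) \<le> ennreal v" .
  moreover have "(\<lambda>x. ennreal (h x)) \<in> borel_measurable ?N" unfolding hn by measurable
  ultimately obtain y where y: "y \<in> space ?N" "ennreal (h y) \<le> ennreal v"
    using PN.exists_le_of_nn_integral_le[of "\<lambda>x. ennreal (h x)" "ennreal v"] by auto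
  then have hv: "h y \<le> v" using v0 by simp
  have vK: "v < K" unfolding v_def K_def using R n by simp
  have yBN: "y \<notin> BN"
  proof
    assume "y \<in> BN"
    then have "K \<le> h y" unfolding h_def using fnn[of y] dist_n_nonneg[of n y "\<lambda>i. T (y i)"] by simp
    then show False using hv vK by simp
  qed
  then have fy: "f y + dist_n n y (\<lambda>i. T (y i)) \<le> v" using hv by (simp add: h_def)
  obtain w where w: "w \<in> A" "f y = min K (dist_n n y w)" using fval by blast
  have "f y < K" using fy vK dist_n_nonneg[of n y "\<lambda>i. T (y i)"] by simp
  then have "dist_n n w y + dist_n n y (\<lambda>i. T (y i)) \<le> v" using w fy by (simp add: min_def dist_n_commute split: if_splits)
  then have "dist_n n w (\<lambda>i. T (y i)) \<le> v" using dist_n_triangle[of n w "\<lambda>i. T (y i)" y] by simp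
  moreover have "typical \<eta> t (range T) n (\<lambda>i. T (y i))" using yBN y(1) by (simp add: BN_def spN)
  moreover have "typical \<eta> s (range T) n w" "\<forall>i. w i \<in> range T \<or> n \<le> i" using w(1) by (auto simp: A_def PiE_def Pi_def not_le)
  ultimately show ?thesis unfolding v_def by (intro exI[of _ w] exI[of _ "\<lambda>i. T (y i)"]) auto
qed

text \<open>Choosing a position in \<open>{..<n}\<close> uniformly and reading both words there
  gives \<open>r\<close>: its marginals are the letter frequencies, and its expected squared
  distance is the squared distance of the words divided by \<open>n\<close>, which cancels the
  factor \<open>sqrt n\<close>.\<close>

lemma coupling_of_laws_if_concentration:
  fixes \<mu> \<nu> :: "'a::polish_space measure" and T :: "'a \<Rightarrow> 'a"
  assumes mu: "\<mu> \<in> probs borel" and nu: "\<nu> \<in> probs borel"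
    and T[measurable]: "T \<in> borel_measurable borel" and fin: "finite (range T)"
    and c: "c \<ge> 0" and d: "0 \<le> \<delta>" "\<delta> < 1"
    and Tm: "sq_err T \<mu> \<le> ennreal (\<delta>\<^sup>2)" and Tn: "sq_err T \<nu> \<le> ennreal (\<delta>\<^sup>2)"
    and conc: "\<And>n f. n \<ge> 1 \<Longrightarrow> bdd_lip1 n f \<Longrightarrow> (\<integral>x. f x \<partial>pow_measure \<nu> n) - (\<integral>x. f x \<partial>pow_measure \<mu> n) \<le> sqrt n * c"
  obtains r where "set_pmf r \<subseteq> range T \<times> range T" "map_pmf fst r = law \<mu> T" "map_pmf snd r = law \<nu> T"
    "measure_pmf.expectation r (\<lambda>z. (dist (fst z) (snd z))\<^sup>2) \<le> (c + 2 * \<delta>)\<^sup>2"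
proof -
  have pm: "prob_space \<mu>" "sets \<mu> = sets borel" and pn: "prob_space \<nu>" "sets \<nu> = sets borel"
    using mu nu by (auto simp: space_prob_algebra)
  have sf: "simple_function \<mu> T" "simple_function \<nu> T"
    using simple_function_finite_range[OF _ fin] T measurable_cong_sets[OF pm(2) refl] measurable_cong_sets[OF pn(2) refl] by blast+
  have sl: "set_pmf (law \<mu> T) \<subseteq> range T" "set_pmf (law \<nu> T) \<subseteq> range T"
    using set_law[OF pm(1) sf(1)] set_law[OF pn(1) sf(2)] by auto
  show thesis
  proof (rule pmf_coupling_compact[OF fin sl, of "\<lambda>z. (dist (fst z) (snd z))\<^sup>2" "(c + 2 * \<delta>)\<^sup>2"])
    fix e :: real assume e: "e > 0"
    define a where "a = c + 2 * \<delta>"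
    \<comment> \<open>With \<open>\<delta> < 1\<close> and
      \<open>2 * \<eta> * R \<le> x \<le> 1\<close> the bound
      \<open>c + 2 * \<delta> + 2 * \<eta> * R\<close> stays below \<open>c + 3\<close>, hence below
      \<open>R\<close>. The choice of \<open>x\<close> ensures
      \<open>(a + x)\<^sup>2 \<le> a\<^sup>2 + e\<close>. The three terms in the definition of
      \<eta> give, in turn, \<open>2 * \<eta> * R \<le> x\<close>, marginals within
      \<open>e\<close>, and \<open>\<eta> < 1\<close>.\<close>
    define R where "R = c + 4"
    define x where "x = min 1 (e / (2 * a + 1))"
    have a0: "0 \<le> a" unfolding a_def using c d by simp
    have x: "0 < x" "x \<le> 1" using e a0 by (auto simp: x_def)
    have "x \<le> e / (2 * a + 1)" by (simp add: x_def)
    then have xe: "x * (2 * a + 1) \<le> e" using a0 by (subst (asm) pos_le_divide_eq) auto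
    define \<eta> where "\<eta> = min (x / (2 * R)) (min e (1 / 2))"
    have R0: "R > 0" unfolding R_def using c by simp
    have "\<eta> \<le> x / (2 * R)" by (simp add: \<eta>_def)
    then have "\<eta> * (2 * R) \<le> x" using R0 by (subst (asm) pos_le_divide_eq) auto
    moreover have "0 < \<eta>" using x(1) R0 e unfolding \<eta>_def by simp
    ultimately have eta: "0 < \<eta>" "\<eta> < 1" "\<eta> \<le> e" "2 * \<eta> * R \<le> x"
      unfolding \<eta>_def by (auto simp: mult_ac)
    have sq: "(c + 2 * \<delta> + 2 * \<eta> * R)\<^sup>2 \<le> (c + 2 * \<delta>)\<^sup>2 + e"
    proof -
      have "0 \<le> 2 * \<eta> * R" using eta R0 by simp
      then have "(a + 2 * \<eta> * R)\<^sup>2 \<le> (a + x)\<^sup>2" by (intro power_mono add_left_mono eta(4)) (use a0 in auto)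
      also have "(a + x)\<^sup>2 = a\<^sup>2 + x * (2 * a + x)" by (simp add: power2_eq_square algebra_simps)
      also have "x * (2 * a + x) \<le> x * (2 * a + 1)" using x by (intro mult_left_mono) auto
      finally show ?thesis using xe unfolding a_def by simp
    qed
    have "\<forall>\<^sub>F n in sequentially. n \<ge> 1 \<and>
       measure (pow_measure \<mu> n) {x \<in> space (prodE {..<n}). \<not> typical \<eta> (law \<mu> T) (range T) n (\<lambda>i. T (x i))} \<le> \<eta> \<and>
       measure (pow_measure \<nu> n) {x \<in> space (prodE {..<n}). \<not> typical \<eta> (law \<nu> T) (range T) n (\<lambda>i. T (x i))} \<le> \<eta>"
      by (intro eventually_conj eventually_ge_at_top eventually_typical pm pn T fin eta)
    then obtain n where n: "n \<ge> 1"
       and tm: "measure (pow_measure \<mu> n) {x \<in> space (prodE {..<n}). \<not> typical \<eta> (law \<mu> T) (range T) n (\<lambda>i. T (x i))} \<le> \<eta>"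
       and tn: "measure (pow_measure \<nu> n) {x \<in> space (prodE {..<n}). \<not> typical \<eta> (law \<nu> T) (range T) n (\<lambda>i. T (x i))} \<le> \<eta>"
      by (auto simp: eventually_sequentially)
    have Rl: "c + 2 * \<delta> + 2 * \<eta> * R < R" using eta(4) x(2) d(2) unfolding R_def by simp
    obtain w w' where w: "\<forall>i. w i \<in> range T \<or> n \<le> i" "\<forall>i. w' i \<in> range T" "typical \<eta> (law \<mu> T) (range T) n w"
       "typical \<eta> (law \<nu> T) (range T) n w'" "dist_n n w w' \<le> sqrt n * (c + 2 * \<delta> + 2 * \<eta> * R)"
      using typical_words_at_small_distance[OF mu nu T fin c d(1) _ eta(2) Rl _ n Tm Tn conc[OF n] tm tn] eta R0 by auto
    define r where "r = map_pmf (\<lambda>i. (w i, w' i)) (pmf_of_set {..<n})"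
    have ne: "{..<n} \<noteq> {}" using n by (simp add: lessThan_empty_iff)
    have fr: "pmf (map_pmf v (pmf_of_set {..<n})) b = freq n v b" for v :: "nat \<Rightarrow> 'a" and b
    proof -
      have "{..<n} \<inter> v -` {b} = {..<n} \<inter> {i. v i = b}" by auto
      then show ?thesis using ne unfolding freq_def by (simp add: pmf.rep_eq measure_pmf_of_set sum.If_cases of_bool_def)
    qed
    have r1: "map_pmf fst r = map_pmf w (pmf_of_set {..<n})" and r2: "map_pmf snd r = map_pmf w' (pmf_of_set {..<n})"
      unfolding r_def by (simp_all add: pmf.map_comp comp_def)
    have "measure_pmf.expectation r (\<lambda>z. (dist (fst z) (snd z))\<^sup>2) = (dist_n n w w')\<^sup>2 / n"
      unfolding r_def dist_n_power2 using ne by (simp add: integral_pmf_of_set)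
    also have "\<dots> \<le> (sqrt n * (c + 2 * \<delta> + 2 * \<eta> * R))\<^sup>2 / n"
      by (intro divide_right_mono power_mono w(5) dist_n_nonneg) simp
    also have "\<dots> = (c + 2 * \<delta> + 2 * \<eta> * R)\<^sup>2" using n by (simp add: power_mult_distrib)
    finally have ex: "measure_pmf.expectation r (\<lambda>z. (dist (fst z) (snd z))\<^sup>2) \<le> (c + 2 * \<delta>)\<^sup>2 + e" using sq by simp
    have "(w i, w' i) \<in> range T \<times> range T" if "i < n" for i
      using w(1,2) that by (metis SigmaI not_le)
    then have rF: "set_pmf r \<subseteq> range T \<times> range T" unfolding r_def using ne by auto
    have m1: "\<forall>b\<in>range T. \<bar>pmf (map_pmf fst r) b - pmf (law \<mu> T) b\<bar> \<le> e"
      using w(3) eta(3) unfolding r1 fr typical_def by (blast intro: order_trans[OF _ eta(3)])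
    have m2: "\<forall>b\<in>range T. \<bar>pmf (map_pmf snd r) b - pmf (law \<nu> T) b\<bar> \<le> e"
      using w(4) eta(3) unfolding r2 fr typical_def by (blast intro: order_trans[OF _ eta(3)])
    show "\<exists>r. set_pmf r \<subseteq> range T \<times> range T \<and>
             (\<forall>a\<in>range T. \<bar>pmf (map_pmf fst r) a - pmf (law \<mu> T) a\<bar> \<le> e) \<and>
             (\<forall>b\<in>range T. \<bar>pmf (map_pmf snd r) b - pmf (law \<nu> T) b\<bar> \<le> e) \<and>
             measure_pmf.expectation r (\<lambda>z. (dist (fst z) (snd z))\<^sup>2) \<le> (c + 2 * \<delta>)\<^sup>2 + e"
      using rF m1 m2 ex by blast
  qed (rule that)
qed

theorem transport_le_if_concentration:
  fixes \<mu> \<nu> :: "'a::polish_space measure"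
  assumes mu: "\<mu> \<in> probs borel" and nu: "\<nu> \<in> probs borel"
    and mom: "sq_moment x0 \<mu> < \<infinity>" and c: "c \<ge> 0" and e: "e > 0"
    and conc: "\<And>n f. n \<ge> 1 \<Longrightarrow> bdd_lip1 n f \<Longrightarrow> (\<integral>x. f x \<partial>pow_measure \<nu> n) - (\<integral>x. f x \<partial>pow_measure \<mu> n) \<le> sqrt n * c"
  shows "\<exists>\<gamma>\<in>couplings \<mu> \<nu>. sq_cost \<gamma> \<le> ennreal (c\<^sup>2 + e)"
proof -
  have pm: "prob_space \<mu>" "sets \<mu> = sets borel" and pn: "prob_space \<nu>" "sets \<nu> = sets borel"
    using mu nu by (auto simp: space_prob_algebra)
  note [measurable_cong] = pm(2) pn(2)
  obtain M where M: "sq_moment x0 \<mu> = ennreal M" "0 \<le> M"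
    using mom by (cases "\<integral>\<^sup>+x. sqd x x0 \<partial>\<mu>") auto
  have "sq_moment x0 \<nu> \<le> ennreal ((sqrt M + c)\<^sup>2)"
    by (rule second_moment_le_if_concentration[OF mu nu c _ _ conc]) (use M in auto)
  then have mom': "sq_moment x0 \<nu> < \<infinity>" by (rule order_le_less_trans) simp
  \<comment> \<open>This is the final cost as a function of \<delta>. Discretising with squared
    error \<open>\<delta>\<^sup>2\<close> absorbs the coefficient
    \<open>2 * (1 + 1 / \<delta>)\<close>: the two error terms together amount to
    \<open>4 * \<delta>\<^sup>2 + 4 * \<delta>\<close>.\<close>
  have "((\<lambda>\<delta>. (1 + \<delta>) * (c + 2 * \<delta>)\<^sup>2 + 4 * \<delta>\<^sup>2 + 4 * \<delta>) \<longlongrightarrow> (1 + 0) * (c + 2 * 0)\<^sup>2 + 4 * 0\<^sup>2 + 4 * 0) (at_right 0)"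
    by (intro tendsto_intros)
  then have "\<forall>\<^sub>F \<delta> in at_right 0. (1 + \<delta>) * (c + 2 * \<delta>)\<^sup>2 + 4 * \<delta>\<^sup>2 + 4 * \<delta> < c\<^sup>2 + e"
    by (rule order_tendstoD) (use e in simp)
  moreover have "\<forall>\<^sub>F \<delta> in at_right 0. \<delta> \<in> {0<..<1::real}" by (rule eventually_at_right_real) simp
  ultimately have "\<forall>\<^sub>F \<delta> in at_right 0. (1 + \<delta>) * (c + 2 * \<delta>)\<^sup>2 + 4 * \<delta>\<^sup>2 + 4 * \<delta> < c\<^sup>2 + e \<and> \<delta> \<in> {0<..<1::real}"
    by (rule eventually_conj)
  then obtain \<delta> :: real where d: "0 < \<delta>" "\<delta> < 1" "(1 + \<delta>) * (c + 2 * \<delta>)\<^sup>2 + 4 * \<delta>\<^sup>2 + 4 * \<delta> < c\<^sup>2 + e"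
    using eventually_happens[of _ "at_right (0::real)"] by auto
  obtain T :: "'a \<Rightarrow> 'a" where T[measurable]: "T \<in> borel_measurable borel" and fin: "finite (range T)"
    and Tl: "\<And>M. M \<in> {\<mu>, \<nu>} \<Longrightarrow> sq_err T M < ennreal (\<delta>\<^sup>2)"
    by (rule finite_range_approximation[of "{\<mu>, \<nu>}" x0 "ennreal (\<delta>\<^sup>2)"]) (use pm pn mom mom' d in auto)
  have Tm: "sq_err T \<mu> \<le> ennreal (\<delta>\<^sup>2)" and Tn: "sq_err T \<nu> \<le> ennreal (\<delta>\<^sup>2)"
    using Tl by (auto intro: less_imp_le)
  obtain r where r: "set_pmf r \<subseteq> range T \<times> range T" "map_pmf fst r = law \<mu> T" "map_pmf snd r = law \<nu> T"
    "measure_pmf.expectation r (\<lambda>z. (dist (fst z) (snd z))\<^sup>2) \<le> (c + 2 * \<delta>)\<^sup>2"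
    by (rule coupling_of_laws_if_concentration[OF mu nu T fin c less_imp_le[OF d(1)] d(2) Tm Tn conc])
  have sf: "simple_function \<mu> T" "simple_function \<nu> T"
    using simple_function_finite_range[OF _ fin] T measurable_cong_sets[OF pm(2) refl] measurable_cong_sets[OF pn(2) refl] by blast+
  from lift_coupling[OF pm(1) pn(1) sf r(2,3)] obtain \<gamma> where g: "\<gamma> \<in> couplings \<mu> \<nu>"
    and gr: "\<And>f. (\<integral>\<^sup>+z. f (T (fst z), T (snd z)) \<partial>\<gamma>) = (\<integral>\<^sup>+z. f z \<partial>measure_pmf r)" by metis
  have sg[measurable_cong]: "sets \<gamma> = sets (borel \<Otimes>\<^sub>M borel)"
    using g sets_pair_measure_cong[OF pm(2) pn(2)] by (simp add: couplings_def)
  have finr: "finite (set_pmf r)" using r(1) fin by (meson finite_SigmaI finite_subset)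
  have "(\<integral>\<^sup>+z. sqd (T (fst z)) (T (snd z)) \<partial>\<gamma>) = sq_cost (measure_pmf r)"
    using gr[of "\<lambda>z. sqd (fst z) (snd z)"] by simp
  also have "\<dots> = ennreal (measure_pmf.expectation r (\<lambda>z. (dist (fst z) (snd z))\<^sup>2))"
    by (rule nn_integral_eq_integral[OF integrable_measure_pmf_finite[OF finr]]) simp
  also have "\<dots> \<le> ennreal ((c + 2 * \<delta>)\<^sup>2)" by (rule ennreal_leI[OF r(4)])
  finally have A: "(\<integral>\<^sup>+z. sqd (T (fst z)) (T (snd z)) \<partial>\<gamma>) \<le> ennreal ((c + 2 * \<delta>)\<^sup>2)" .
  have B: "(\<integral>\<^sup>+z. sqd (fst z) (T (fst z)) \<partial>\<gamma>) \<le> ennreal (\<delta>\<^sup>2)"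
    using nn_integral_coupling_fst[OF g, of "\<lambda>x. sqd x (T x)"] Tm by simp
  have D: "(\<integral>\<^sup>+z. sqd (snd z) (T (snd z)) \<partial>\<gamma>) \<le> ennreal (\<delta>\<^sup>2)"
    using nn_integral_coupling_snd[OF g, of "\<lambda>x. sqd x (T x)"] Tn by simp
  have "sq_cost \<gamma>
     \<le> (\<integral>\<^sup>+z. ennreal (1 + \<delta>) * sqd (T (fst z)) (T (snd z)) + (ennreal (2 * (1 + 1 / \<delta>)) * sqd (fst z) (T (fst z)) + ennreal (2 * (1 + 1 / \<delta>)) * sqd (snd z) (T (snd z))) \<partial>\<gamma>)"
  proof (rule nn_integral_mono)
    fix z
    show "sqd (fst z) (snd z) \<le> ennreal (1 + \<delta>) * sqd (T (fst z)) (T (snd z)) + (ennreal (2 * (1 + 1 / \<delta>)) * sqd (fst z) (T (fst z)) + ennreal (2 * (1 + 1 / \<delta>)) * sqd (snd z) (T (snd z)))"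
      by (rule ennreal_dist_power2_le[OF d(1)])
  qed
  also have "\<dots> = ennreal (1 + \<delta>) * (\<integral>\<^sup>+z. sqd (T (fst z)) (T (snd z)) \<partial>\<gamma>) + (ennreal (2 * (1 + 1 / \<delta>)) * (\<integral>\<^sup>+z. sqd (fst z) (T (fst z)) \<partial>\<gamma>) + ennreal (2 * (1 + 1 / \<delta>)) * (\<integral>\<^sup>+z. sqd (snd z) (T (snd z)) \<partial>\<gamma>))"
    by (simp add: nn_integral_add nn_integral_cmult)
  also have "\<dots> \<le> ennreal (1 + \<delta>) * ennreal ((c + 2 * \<delta>)\<^sup>2) + (ennreal (2 * (1 + 1 / \<delta>)) * ennreal (\<delta>\<^sup>2) + ennreal (2 * (1 + 1 / \<delta>)) * ennreal (\<delta>\<^sup>2))"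
    by (intro add_mono mult_left_mono A B D) auto
  also have "\<dots> = ennreal ((1 + \<delta>) * (c + 2 * \<delta>)\<^sup>2 + (2 * (1 + 1 / \<delta>) * \<delta>\<^sup>2 + 2 * (1 + 1 / \<delta>) * \<delta>\<^sup>2))"
    by (rule ennreal_weighted_sum3) (use d(1) in auto)
  also have "(1 + \<delta>) * (c + 2 * \<delta>)\<^sup>2 + (2 * (1 + 1 / \<delta>) * \<delta>\<^sup>2 + 2 * (1 + 1 / \<delta>) * \<delta>\<^sup>2) = (1 + \<delta>) * (c + 2 * \<delta>)\<^sup>2 + 4 * \<delta>\<^sup>2 + 4 * \<delta>"
    using d(1) by (simp add: power2_eq_square field_simps)
  also have "ennreal \<dots> \<le> ennreal (c\<^sup>2 + e)" using d(3) by (intro ennreal_leI) simp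
  finally show ?thesis using g by blast
qed

section \<open>Tensorisation\<close>

text \<open>Some point does not exceed the average, stated without division so that extended values
  cause no trouble. It supplies a representative of a cell that costs no more than the cell does on
  average.\<close>

lemma (in prob_space) exists_le_average_on:
  assumes f[measurable]: "f \<in> borel_measurable M" and A[measurable]: "A \<in> sets M" and pos: "emeasure M A \<noteq> 0"
    and fin: "(\<integral>\<^sup>+x. f x \<partial>M) < \<infinity>"
  shows "\<exists>x\<in>A. f x * emeasure M A \<le> (\<integral>\<^sup>+x. f x * indicator A x \<partial>M)"
proof (rule ccontr)
  let ?I = "\<integral>\<^sup>+x. f x * indicator A x \<partial>M"
  assume "\<not> ?thesis"
  then have gt: "?I < f x * emeasure M A" if "x \<in> A" for x using that by (auto simp: not_le)
  have "?I \<le> (\<integral>\<^sup>+x. f x \<partial>M)" by (intro nn_integral_mono) (auto simp: indicator_def)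
  then have Ifin: "?I < \<top>" using fin by (auto simp: order_le_less_trans)
  have e: "(\<integral>\<^sup>+x. ?I * indicator A x \<partial>M) = emeasure M A * ?I"
    by (subst nn_integral_cmult_indicator[OF A]) (rule mult.commute)
  have "(\<integral>\<^sup>+x. ?I * indicator A x \<partial>M) < (\<integral>\<^sup>+x. (f x * emeasure M A) * indicator A x \<partial>M)"
  proof (rule nn_integral_less)
    show "(\<integral>\<^sup>+x. ?I * indicator A x \<partial>M) \<noteq> \<infinity>"
      using Ifin by (simp add: nn_integral_cmult_indicator ennreal_mult_eq_top_iff less_top)
    show "AE x in M. ?I * indicator A x \<le> (f x * emeasure M A) * indicator A x"
      using gt by (intro AE_I2) (auto simp: indicator_def intro: less_imp_le)
    show "\<not> (AE x in M. (f x * emeasure M A) * indicator A x \<le> ?I * indicator A x)"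
    proof
      assume "AE x in M. (f x * emeasure M A) * indicator A x \<le> ?I * indicator A x"
      then have "AE x in M. x \<notin> A"
      proof eventually_elim
        case (elim x)
        then show ?case using gt[of x] by (cases "x \<in> A") (auto simp: not_le[symmetric])
      qed
      then have "A \<in> null_sets M" by (simp add: AE_iff_null_sets[OF A])
      then show False using pos by auto
    qed
  qed measurable
  also have "(\<integral>\<^sup>+x. (f x * emeasure M A) * indicator A x \<partial>M) = (\<integral>\<^sup>+x. emeasure M A * (f x * indicator A x) \<partial>M)"
    by (intro nn_integral_cong) (simp add: mult_ac)
  also have "\<dots> = emeasure M A * ?I" by (rule nn_integral_cmult) measurable
  finally show False unfolding e by simp
qed

lemma prob_kernelD:
  assumes "K \<in> N \<rightarrow>\<^sub>M prob_algebra borel" "\<omega> \<in> space N"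
  shows "prob_space (K \<omega>)" "sets (K \<omega>) = sets borel" "K \<omega> \<in> probs borel"
  using measurable_space[OF assms] by (auto simp: space_prob_algebra)

text \<open>Counterpart of \<open>lift_coupling\<close>: passing from a coupling to its
  discretisation uses the same weighted inequality, with the roles of the points and their images
  under \<open>T\<close> exchanged.\<close>

lemma coupling_law_cost:
  fixes \<mu> \<nu> :: "'a::polish_space measure"
  assumes g: "\<gamma> \<in> couplings \<mu> \<nu>" and pm: "prob_space \<mu>" "sets \<mu> = sets borel" and sn: "sets \<nu> = sets borel"
    and T[measurable]: "T \<in> borel_measurable borel" and fin: "finite (range T)" and d: "\<delta> > 0"
  defines "q \<equiv> law \<gamma> (\<lambda>z. (T (fst z), T (snd z)))"
  shows "set_pmf q \<subseteq> range T \<times> range T" "map_pmf fst q = law \<mu> T" "map_pmf snd q = law \<nu> T"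
    "sq_cost (measure_pmf q) \<le> ennreal (1 + \<delta>) * sq_cost \<gamma>
      + (ennreal (2 * (1 + 1 / \<delta>)) * sq_err T \<mu> + ennreal (2 * (1 + 1 / \<delta>)) * sq_err T \<nu>)"
proof -
  have sg[measurable_cong]: "sets \<gamma> = sets (borel \<Otimes>\<^sub>M borel)"
    using g sets_pair_measure_cong[OF pm(2) sn] by (simp add: couplings_def)
  have d1: "distr \<gamma> \<mu> fst = \<mu>" and d2: "distr \<gamma> \<nu> snd = \<nu>" using g by (auto simp: couplings_def)
  have f1: "fst \<in> \<gamma> \<rightarrow>\<^sub>M \<mu>" and f2: "snd \<in> \<gamma> \<rightarrow>\<^sub>M \<nu>"
    using g unfolding couplings_def by (auto cong: measurable_cong_sets)
  have pg: "prob_space \<gamma>" using prob_space_distrD[OF f1] d1 pm(1) by simp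
  have s1: "simple_function \<mu> T" "simple_function \<nu> T"
    using simple_function_finite_range[OF _ fin] T measurable_cong_sets[OF pm(2) refl] measurable_cong_sets[OF sn refl] by blast+
  have sf: "simple_function \<gamma> (\<lambda>z. (T (fst z), T (snd z)))"
    by (rule simple_function_Pair[OF simple_function_comp[OF f1 s1(1)] simple_function_comp[OF f2 s1(2)]])
  show "set_pmf q \<subseteq> range T \<times> range T"
    using set_law[OF pg sf] unfolding q_def by auto
  show "map_pmf fst q = law \<mu> T"
    unfolding q_def map_pmf_law[OF pg sf] using law_distr[OF f1 s1(1)] d1 by simp
  show "map_pmf snd q = law \<nu> T"
    unfolding q_def map_pmf_law[OF pg sf] using law_distr[OF f2 s1(2)] d2 by simp
  have "sq_cost (measure_pmf q) = (\<integral>\<^sup>+z. sqd (T (fst z)) (T (snd z)) \<partial>\<gamma>)"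
    unfolding q_def nn_integral_law[OF pg sf] by simp
  also have "\<dots> \<le> (\<integral>\<^sup>+z. ennreal (1 + \<delta>) * sqd (fst z) (snd z) + (ennreal (2 * (1 + 1 / \<delta>)) * sqd (fst z) (T (fst z)) + ennreal (2 * (1 + 1 / \<delta>)) * sqd (snd z) (T (snd z))) \<partial>\<gamma>)"
  proof (rule nn_integral_mono)
    fix z
    show "sqd (T (fst z)) (T (snd z)) \<le> ennreal (1 + \<delta>) * sqd (fst z) (snd z) + (ennreal (2 * (1 + 1 / \<delta>)) * sqd (fst z) (T (fst z)) + ennreal (2 * (1 + 1 / \<delta>)) * sqd (snd z) (T (snd z)))"
      using ennreal_dist_power2_le[OF d, of "T (fst z)" "T (snd z)" "fst z" "snd z"]
      unfolding dist_commute[of "T (fst z)" "fst z"] dist_commute[of "T (snd z)" "snd z"] .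
  qed
  also have "\<dots> = ennreal (1 + \<delta>) * sq_cost \<gamma> + (ennreal (2 * (1 + 1 / \<delta>)) * (\<integral>\<^sup>+z. sqd (fst z) (T (fst z)) \<partial>\<gamma>) + ennreal (2 * (1 + 1 / \<delta>)) * (\<integral>\<^sup>+z. sqd (snd z) (T (snd z)) \<partial>\<gamma>))"
    by (simp add: nn_integral_add nn_integral_cmult)
  also have "(\<integral>\<^sup>+z. sqd (fst z) (T (fst z)) \<partial>\<gamma>) = sq_err T \<mu>"
    by (rule nn_integral_coupling_fst[OF g, of "\<lambda>x. sqd x (T x)"]) (simp add: measurable_cong_sets[OF pm(2) refl])
  also have "(\<integral>\<^sup>+z. sqd (snd z) (T (snd z)) \<partial>\<gamma>) = sq_err T \<nu>"
    by (rule nn_integral_coupling_snd[OF g, of "\<lambda>x. sqd x (T x)"]) (simp add: measurable_cong_sets[OF sn refl])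
  finally show "sq_cost (measure_pmf q) \<le> ennreal (1 + \<delta>) * sq_cost \<gamma>
      + (ennreal (2 * (1 + 1 / \<delta>)) * sq_err T \<mu> + ennreal (2 * (1 + 1 / \<delta>)) * sq_err T \<nu>)" .
qed

text \<open>The cube of vectors \<open>p \<omega>\<close> is cut into finitely many cells of side
  \<open>1 / m\<close>. Kernels whose vectors share a cell can stand in for one another, which
  reduces a general mixture to a finite one.\<close>

lemma simple_function_grid:
  fixes p :: "'b \<Rightarrow> 'c \<Rightarrow> real" and m :: nat
  assumes F: "finite F" and p[measurable]: "\<And>a. a \<in> F \<Longrightarrow> (\<lambda>\<omega>. p \<omega> a) \<in> borel_measurable N"
    and p01: "\<And>\<omega> a. \<omega> \<in> space N \<Longrightarrow> a \<in> F \<Longrightarrow> 0 \<le> p \<omega> a \<and> p \<omega> a \<le> 1"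
  shows "simple_function N (\<lambda>\<omega>. restrict (\<lambda>a. \<lfloor>m * p \<omega> a\<rfloor>) F)"
  unfolding simple_function_def
proof safe
  have "(\<lambda>\<omega>. restrict (\<lambda>a. \<lfloor>m * p \<omega> a\<rfloor>) F) ` space N \<subseteq> PiE F (\<lambda>_. {0..int m})"
  proof safe
    fix \<omega> a assume w: "\<omega> \<in> space N" "a \<in> F"
    have "real m * p \<omega> a \<le> real m * 1" using p01[OF w] by (intro mult_left_mono) auto
    then show "restrict (\<lambda>a. \<lfloor>m * p \<omega> a\<rfloor>) F a \<in> {0..int m}" using p01[OF w] w(2) by (auto simp: floor_le_iff)
  qed auto
  then show "finite ((\<lambda>\<omega>. restrict (\<lambda>a. \<lfloor>m * p \<omega> a\<rfloor>) F) ` space N)"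
    by (rule finite_subset) (auto intro: finite_PiE F)
  fix x assume "x \<in> space N"
  have "(\<lambda>\<omega>. restrict (\<lambda>a. \<lfloor>m * p \<omega> a\<rfloor>) F) -` {restrict (\<lambda>a. \<lfloor>m * p x a\<rfloor>) F} \<inter> space N = {\<omega> \<in> space N. \<forall>a\<in>F. \<lfloor>m * p \<omega> a\<rfloor> = \<lfloor>m * p x a\<rfloor>}"
    by (auto simp: fun_eq_iff restrict_def) metis
  also have "\<dots> \<in> sets N"
    by (rule sets.sets_Collect_finite_All[OF _ F]) measurable
  finally show "(\<lambda>\<omega>. restrict (\<lambda>a. \<lfloor>m * p \<omega> a\<rfloor>) F) -` {restrict (\<lambda>a. \<lfloor>m * p x a\<rfloor>) F} \<inter> space N \<in> sets N" .
qed

lemma abs_diff_le_if_floor_eq: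
  assumes "\<lfloor>real m * x\<rfloor> = \<lfloor>real m * y\<rfloor>" "m > 0"
  shows "\<bar>x - y\<bar> \<le> 1 / real m"
proof -
  have "\<bar>real m * x - real m * y\<bar> \<le> 1" using assms(1) by linarith
  then have "real m * \<bar>x - y\<bar> \<le> 1" by (simp add: right_diff_distrib[symmetric] abs_mult)
  then show ?thesis using assms(2) by (simp add: field_simps)
qed

text \<open>Convexity of the squared Wasserstein distance in its second argument, after discretisation by \<open>T\<close>.\<close>
theorem discrete_jensen:
  fixes \<mu> :: "'a::polish_space measure" and K :: "'b \<Rightarrow> 'a measure"
  assumes pm: "prob_space \<mu>" "sets \<mu> = sets borel" and N: "prob_space N" and K: "K \<in> N \<rightarrow>\<^sub>M prob_algebra borel"
    and T[measurable]: "T \<in> borel_measurable borel" and fin: "finite (range T)" and d: "\<delta> > 0"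
    and b[measurable]: "b \<in> borel_measurable N" and bfin: "(\<integral>\<^sup>+\<omega>. b \<omega> \<partial>N) < \<infinity>"
    and le: "\<And>\<omega> e. \<omega> \<in> space N \<Longrightarrow> b \<omega> < \<infinity> \<Longrightarrow> e > 0 \<Longrightarrow>
       \<exists>\<gamma>\<in>couplings \<mu> (K \<omega>). sq_cost \<gamma> \<le> b \<omega> + ennreal e"
    and mT: "sq_err T \<mu> < \<infinity>" and PT: "sq_err T (N \<bind> K) < \<infinity>"
  obtains q where "set_pmf q \<subseteq> range T \<times> range T" "map_pmf fst q = law \<mu> T" "map_pmf snd q = law (N \<bind> K) T"
    "sq_cost (measure_pmf q) \<le> ennreal (1 + \<delta>) * (\<integral>\<^sup>+\<omega>. b \<omega> \<partial>N)
      + (ennreal (2 * (1 + 1 / \<delta>)) * sq_err T \<mu> + ennreal (2 * (1 + 1 / \<delta>)) * sq_err T (N \<bind> K))"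
proof -
  interpret N: prob_space N by fact
  define P where "P = N \<bind> K"
  have NN: "N \<in> space (prob_algebra N)" using N by (simp add: space_prob_algebra)
  have pP: "prob_space P" "sets P = sets borel" unfolding P_def
    using prob_space_bind'[OF NN K] sets_bind'[OF NN K] by auto
  define F where "F = range T"
  define \<kappa> where "\<kappa> = ennreal (2 * (1 + 1 / \<delta>))"
  define MT where "MT = sq_err T \<mu>"
  define D where "D y = sqd y (T y)" for y
  have Dm[measurable]: "D \<in> borel_measurable borel" unfolding D_def by measurable
  have Ks: "K \<in> N \<rightarrow>\<^sub>M subprob_algebra borel" by (rule measurable_prob_algebraD[OF K])
  have [measurable]: "(\<lambda>\<omega>. \<integral>\<^sup>+y. D y \<partial>K \<omega>) \<in> borel_measurable N"
    by (rule measurable_compose[OF Ks nn_integral_measurable_subprob_algebra[OF Dm]])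
  \<comment> \<open>\<open>G \<omega>\<close> bounds the cost of the discretised coupling for the
    single kernel \<open>K \<omega>\<close>. Its integral \<open>C0\<close> is the bound to be
    reached, because the error terms are linear in the kernel.\<close>
  define G where "G \<omega> = ennreal (1 + \<delta>) * b \<omega> + (\<kappa> * MT + \<kappa> * (\<integral>\<^sup>+y. D y \<partial>K \<omega>))" for \<omega>
  have Gm[measurable]: "G \<in> borel_measurable N" unfolding G_def by measurable
  define C0 where "C0 = ennreal (1 + \<delta>) * (\<integral>\<^sup>+\<omega>. b \<omega> \<partial>N) + (\<kappa> * MT + \<kappa> * (\<integral>\<^sup>+x. D x \<partial>P))"
  have IG: "(\<integral>\<^sup>+\<omega>. G \<omega> \<partial>N) = C0"
    unfolding G_def C0_def P_def nn_integral_bind[OF Dm Ks]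
    by (simp add: nn_integral_add nn_integral_cmult N.emeasure_space_1)
  have C0fin: "C0 < \<top>" unfolding C0_def \<kappa>_def using bfin mT PT
    by (simp add: MT_def D_def[abs_def] P_def ennreal_mult_less_top)
  define c0 where "c0 = enn2real C0"
  have c0: "ennreal c0 = C0" "0 \<le> c0" unfolding c0_def using C0fin by auto
  define cost where "cost q = sq_cost (measure_pmf q)" for q :: "('a \<times> 'a) pmf"
  have cost_eq: "cost q = ennreal (measure_pmf.expectation q (\<lambda>z. (dist (fst z) (snd z))\<^sup>2))" if "set_pmf q \<subseteq> F \<times> F" for q
  proof -
    have "finite (set_pmf q)" using that fin unfolding F_def by (meson finite_SigmaI finite_subset)
    then show ?thesis unfolding cost_def
      by (intro nn_integral_eq_integral integrable_measure_pmf_finite) auto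
  qed
  have sf: "simple_function M T" if "sets M = sets borel" for M
    using simple_function_finite_range[OF _ fin, of M] T measurable_cong_sets[OF that refl] by blast
  have sl: "set_pmf (law M T) \<subseteq> F" if "sets M = sets borel" "prob_space M" for M
    using set_law[OF that(2) sf[OF that(1)]] by (auto simp: F_def)
  have Ta: "{y. T y = a} \<in> sets borel" for a using measurable_sets[OF T, of "{a}"] by (simp add: vimage_def)
  define p where "p \<omega> a = measure (K \<omega>) {y. T y = a}" for \<omega> a
  have pl: "p \<omega> a = pmf (law (K \<omega>) T) a" if "\<omega> \<in> space N" for \<omega> a
    using prob_kernelD[OF K that] sets_eq_imp_space_eq[of "K \<omega>" borel] unfolding p_def by (subst pmf_law) (auto intro: sf)
  have pm'[measurable]: "(\<lambda>\<omega>. p \<omega> a) \<in> borel_measurable N" for a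
    unfolding p_def by (rule measurable_compose[OF K measurable_measure_prob_algebra[OF Ta]])
  have p01: "0 \<le> p \<omega> a \<and> p \<omega> a \<le> 1" if "\<omega> \<in> space N" for \<omega> a unfolding pl[OF that] by (simp add: pmf_le_1)
  have Pp: "pmf (law P T) a = (\<integral>\<omega>. p \<omega> a \<partial>N)" for a
  proof -
    have "pmf (law P T) a = measure P {y. T y = a}"
      using pP sets_eq_imp_space_eq[OF pP(2)] by (subst pmf_law) (auto intro: sf)
    also have "\<dots> = (\<integral>\<omega>. p \<omega> a \<partial>N)" unfolding P_def p_def by (rule N.measure_bind[OF Ks Ta])
    finally show ?thesis .
  qed
  obtain q where q: "set_pmf q \<subseteq> F \<times> F" "map_pmf fst q = law \<mu> T" "map_pmf snd q = law P T"
    "measure_pmf.expectation q (\<lambda>z. (dist (fst z) (snd z))\<^sup>2) \<le> c0"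
  proof (rule pmf_coupling_compact[OF _ sl[OF pm(2,1)] sl[OF pP(2,1)], of "\<lambda>z. (dist (fst z) (snd z))\<^sup>2" c0])
    show "finite F" using fin by (simp add: F_def)
    fix \<eta> :: real assume eta: "\<eta> > 0"
    obtain m' where "inverse (real (Suc m')) < \<eta>" using reals_Archimedean[OF eta] by blast
    then obtain m :: nat where m: "m > 0" "1 / m \<le> \<eta>"
      by (metis inverse_eq_divide less_imp_le zero_less_Suc)
    define \<phi> where "\<phi> \<omega> = restrict (\<lambda>a. \<lfloor>m * p \<omega> a\<rfloor>) F" for \<omega>
    have s\<phi>: "simple_function N \<phi>" unfolding \<phi>_def
      by (rule simple_function_grid) (use fin p01 in \<open>auto simp: F_def\<close>)
    define L where "L = law N \<phi>"
    define A where "A v = {\<omega> \<in> space N. \<phi> \<omega> = v}" for v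
    have A[measurable]: "A v \<in> sets N" for v
      using measurable_sets[OF measurable_simple_function[OF s\<phi>], of "{v}"] unfolding A_def
      by (simp add: vimage_def Int_def conj_commute)
    have LA: "ennreal (pmf L v) = emeasure N (A v)" for v
      unfolding L_def A_def pmf_law[OF N s\<phi>] by (simp add: N.emeasure_eq_measure)
    \<comment> \<open>A representative of the cell \<open>v\<close> that is no dearer than the cell
      average, with a discretised coupling for its kernel. Choosing one per cell is a finite choice
      and takes the place of a measurable selection.\<close>
    define good where "good v \<omega> Q \<longleftrightarrow> \<omega> \<in> A v \<and> G \<omega> * emeasure N (A v) \<le> (\<integral>\<^sup>+\<omega>. G \<omega> * indicator (A v) \<omega> \<partial>N)
        \<and> set_pmf Q \<subseteq> F \<times> F \<and> map_pmf fst Q = law \<mu> T \<and> map_pmf snd Q = law (K \<omega>) T \<and> cost Q \<le> G \<omega> + ennreal \<eta>"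
      for v \<omega> Q
    have ex: "\<exists>\<omega> Q. good v \<omega> Q" if v: "v \<in> set_pmf L" for v
    proof -
      have pos: "emeasure N (A v) \<noteq> 0" unfolding LA[symmetric] using v by (simp add: pmf_positive_iff[symmetric] pmf_positive set_pmf_iff)
      obtain \<omega> where w: "\<omega> \<in> A v" "G \<omega> * emeasure N (A v) \<le> (\<integral>\<^sup>+\<omega>. G \<omega> * indicator (A v) \<omega> \<partial>N)"
        using N.exists_le_average_on[OF Gm A pos] C0fin unfolding IG by auto
      have "(\<integral>\<^sup>+\<omega>. G \<omega> * indicator (A v) \<omega> \<partial>N) \<le> C0"
        unfolding IG[symmetric] by (intro nn_integral_mono) (auto simp: indicator_def)
      \<comment> \<open>On a cell of positive mass the selected value of \<open>G\<close> is finite,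
        hence so is \<open>b \<omega>\<close>, as the hypothesis on near-optimal couplings
        demands.\<close>
      then have "G \<omega> * emeasure N (A v) < \<top>" using w(2) C0fin by (meson order_le_less_trans)
      then have "G \<omega> < \<top>" using pos by (auto simp: ennreal_mult_less_top)
      then have bw: "b \<omega> < \<infinity>" unfolding G_def using d by (auto simp: ennreal_mult_less_top)
      have wN: "\<omega> \<in> space N" using w(1) by (simp add: A_def)
      obtain \<gamma> where g: "\<gamma> \<in> couplings \<mu> (K \<omega>)" "sq_cost \<gamma> \<le> b \<omega> + ennreal (\<eta> / (1 + \<delta>))"
        using le[OF wN bw, of "\<eta> / (1 + \<delta>)"] eta d by auto
      define Q where "Q = law \<gamma> (\<lambda>z. (T (fst z), T (snd z)))"
      note Q = coupling_law_cost[OF g(1) pm prob_kernelD(2)[OF K wN] T fin d, folded Q_def]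
      have "cost Q \<le> ennreal (1 + \<delta>) * (b \<omega> + ennreal (\<eta> / (1 + \<delta>))) + (\<kappa> * MT + \<kappa> * (\<integral>\<^sup>+y. D y \<partial>K \<omega>))"
        unfolding cost_def \<kappa>_def MT_def D_def
        by (rule order_trans[OF Q(4)]) (intro add_mono mult_left_mono g(2) order_refl, simp)
      also have "ennreal (1 + \<delta>) * (b \<omega> + ennreal (\<eta> / (1 + \<delta>))) = ennreal (1 + \<delta>) * b \<omega> + ennreal \<eta>"
        unfolding distrib_left by (subst ennreal_mult'[symmetric]) (use d in auto)
      also have "ennreal (1 + \<delta>) * b \<omega> + ennreal \<eta> + (\<kappa> * MT + \<kappa> * (\<integral>\<^sup>+y. D y \<partial>K \<omega>)) = G \<omega> + ennreal \<eta>"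
        unfolding G_def by (simp add: ac_simps)
      finally show ?thesis using w Q(1-3) unfolding F_def good_def by blast
    qed
    then have "\<exists>W. \<forall>v\<in>set_pmf L. \<exists>Q. good v (W v) Q" by (intro bchoice) blast
    then obtain W where "\<forall>v\<in>set_pmf L. \<exists>Q. good v (W v) Q" by blast
    then have "\<exists>Q. \<forall>v\<in>set_pmf L. good v (W v) (Q v)" by (rule bchoice)
    then obtain Q where "\<forall>v\<in>set_pmf L. good v (W v) (Q v)" by blast
    then have WQ: "\<And>v. v \<in> set_pmf L \<Longrightarrow> W v \<in> A v"
      "\<And>v. v \<in> set_pmf L \<Longrightarrow> G (W v) * emeasure N (A v) \<le> (\<integral>\<^sup>+\<omega>. G \<omega> * indicator (A v) \<omega> \<partial>N)"
      "\<And>v. v \<in> set_pmf L \<Longrightarrow> set_pmf (Q v) \<subseteq> F \<times> F" "\<And>v. v \<in> set_pmf L \<Longrightarrow> map_pmf fst (Q v) = law \<mu> T"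
      "\<And>v. v \<in> set_pmf L \<Longrightarrow> map_pmf snd (Q v) = law (K (W v)) T" "\<And>v. v \<in> set_pmf L \<Longrightarrow> cost (Q v) \<le> G (W v) + ennreal \<eta>"
      unfolding good_def by blast+
    define r where "r = bind_pmf L Q"
    have r1: "set_pmf r \<subseteq> F \<times> F" unfolding r_def using WQ(3) by auto
    have "map_pmf fst r = bind_pmf L (\<lambda>v. law \<mu> T)"
      unfolding r_def map_bind_pmf by (intro bind_pmf_cong refl WQ(4)) simp
    then have r2: "map_pmf fst r = law \<mu> T" by simp
    \<comment> \<open>Replacing each kernel by the representative of its cell shifts the second
      marginal by at most \<open>1 / m\<close> per letter. The marginal is thus only approximately
      right, and \<open>pmf_coupling_compact\<close> removes the error.\<close>
    have r3: "\<bar>pmf (map_pmf snd r) a - pmf (law P T) a\<bar> \<le> \<eta>" if a: "a \<in> F" for a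
    proof -
      define u where "u \<omega> = pmf (map_pmf snd (Q (\<phi> \<omega>))) a" for \<omega>
      have [measurable]: "u \<in> borel_measurable N" unfolding u_def
        by (rule borel_measurable_simple_function[OF simple_function_compose1[OF s\<phi>]])
      have "pmf (map_pmf snd r) a = (\<integral>v. pmf (map_pmf snd (Q v)) a \<partial>L)"
        unfolding r_def map_bind_pmf pmf_bind ..
      also have "\<dots> = (\<integral>\<omega>. u \<omega> \<partial>N)"
        unfolding L_def measure_pmf_law[OF N s\<phi>] u_def
        by (rule integral_distr[OF measurable_simple_function[OF s\<phi>]]) simp
      finally have e: "pmf (map_pmf snd r) a - pmf (law P T) a = (\<integral>\<omega>. u \<omega> \<partial>N) - (\<integral>\<omega>. p \<omega> a \<partial>N)"
        unfolding Pp by simp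
      have iu: "integrable N u"
        by (rule N.integrable_const_bound[where B=1]) (auto simp: u_def pmf_le_1)
      have ip: "integrable N (\<lambda>\<omega>. p \<omega> a)"
        by (rule N.integrable_const_bound[where B=1]) (use p01 in auto)
      have "AE \<omega> in N. \<bar>u \<omega> - p \<omega> a\<bar> \<le> 1 / m"
        using AE_law[OF N s\<phi>] AE_space
      proof eventually_elim
        case (elim \<omega>)
        then have v: "\<phi> \<omega> \<in> set_pmf L" by (simp add: L_def)
        note WA = WQ(1)[OF v]
        then have Ws: "W (\<phi> \<omega>) \<in> space N" and eq: "\<phi> (W (\<phi> \<omega>)) = \<phi> \<omega>" by (auto simp: A_def)
        have "u \<omega> = p (W (\<phi> \<omega>)) a" unfolding u_def WQ(5)[OF v] pl[OF Ws] ..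
        moreover have "\<lfloor>m * p (W (\<phi> \<omega>)) a\<rfloor> = \<lfloor>m * p \<omega> a\<rfloor>"
          using fun_cong[OF eq, of a] a unfolding \<phi>_def by simp
        ultimately show ?case using abs_diff_le_if_floor_eq[OF _ m(1)] by simp
      qed
      then have "(\<integral>\<omega>. \<bar>u \<omega> - p \<omega> a\<bar> \<partial>N) \<le> (\<integral>\<omega>. 1 / m \<partial>N)"
        by (intro integral_mono_AE) (use iu ip in auto)
      moreover have "\<bar>(\<integral>\<omega>. u \<omega> \<partial>N) - (\<integral>\<omega>. p \<omega> a \<partial>N)\<bar> \<le> (\<integral>\<omega>. \<bar>u \<omega> - p \<omega> a\<bar> \<partial>N)"
        using integral_abs_bound[of N "\<lambda>\<omega>. u \<omega> - p \<omega> a"] iu ip by simp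
      ultimately show ?thesis unfolding e using m(2) N.prob_space by simp
    qed
    have finL: "finite (set_pmf L)" unfolding L_def by (rule finite_set_law[OF N s\<phi>])
    \<comment> \<open>The cell averages add up to the integral of \<open>G\<close>; the slack \<eta>
      is averaged with total weight 1.\<close>
    have "cost r = (\<integral>\<^sup>+v. cost (Q v) \<partial>L)" unfolding cost_def r_def by simp
    also have "\<dots> = (\<Sum>v\<in>set_pmf L. cost (Q v) * ennreal (pmf L v))"
      by (rule nn_integral_measure_pmf_finite[OF finL]) simp
    also have "\<dots> \<le> (\<Sum>v\<in>set_pmf L. (\<integral>\<^sup>+\<omega>. G \<omega> * indicator (A v) \<omega> \<partial>N) + ennreal \<eta> * ennreal (pmf L v))"
    proof (rule sum_mono)
      fix v assume v: "v \<in> set_pmf L"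
      have "cost (Q v) * ennreal (pmf L v) \<le> (G (W v) + ennreal \<eta>) * ennreal (pmf L v)"
        by (intro mult_right_mono WQ(6)[OF v]) simp
      also have "\<dots> = G (W v) * emeasure N (A v) + ennreal \<eta> * ennreal (pmf L v)" by (simp add: distrib_right LA)
      finally show "cost (Q v) * ennreal (pmf L v) \<le> (\<integral>\<^sup>+\<omega>. G \<omega> * indicator (A v) \<omega> \<partial>N) + ennreal \<eta> * ennreal (pmf L v)"
        using WQ(2)[OF v] by (meson add_right_mono order_trans)
    qed
    also have "\<dots> = (\<integral>\<^sup>+\<omega>. (\<Sum>v\<in>set_pmf L. G \<omega> * indicator (A v) \<omega>) \<partial>N) + ennreal \<eta> * (\<Sum>v\<in>set_pmf L. ennreal (pmf L v))"
      unfolding sum.distrib sum_distrib_left by (subst nn_integral_sum) auto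
    also have "(\<Sum>v\<in>set_pmf L. ennreal (pmf L v)) = 1"
      using sum_pmf_eq_1[OF finL, of L] by (simp add: sum_ennreal)
    also have "(\<integral>\<^sup>+\<omega>. (\<Sum>v\<in>set_pmf L. G \<omega> * indicator (A v) \<omega>) \<partial>N) \<le> (\<integral>\<^sup>+\<omega>. G \<omega> \<partial>N)"
    proof (rule nn_integral_mono)
      fix \<omega> assume w: "\<omega> \<in> space N"
      have "(\<Sum>v\<in>set_pmf L. G \<omega> * indicator (A v) \<omega>) = (\<Sum>v\<in>set_pmf L. if v = \<phi> \<omega> then G \<omega> else 0)"
        by (rule sum.cong) (use w in \<open>auto simp: A_def indicator_def\<close>)
      then show "(\<Sum>v\<in>set_pmf L. G \<omega> * indicator (A v) \<omega>) \<le> G \<omega>" using finL by simp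
    qed
    finally have "cost r \<le> ennreal (c0 + \<eta>)" unfolding IG c0(1)[symmetric] using c0(2) eta by simp
    then have "measure_pmf.expectation r (\<lambda>z. (dist (fst z) (snd z))\<^sup>2) \<le> c0 + \<eta>"
      unfolding cost_eq[OF r1] using c0(2) eta by (simp del: ennreal_plus)
    then show "\<exists>r. set_pmf r \<subseteq> F \<times> F \<and> (\<forall>a\<in>F. \<bar>pmf (map_pmf fst r) a - pmf (law \<mu> T) a\<bar> \<le> \<eta>) \<and>
         (\<forall>b\<in>F. \<bar>pmf (map_pmf snd r) b - pmf (law P T) b\<bar> \<le> \<eta>) \<and>
         measure_pmf.expectation r (\<lambda>z. (dist (fst z) (snd z))\<^sup>2) \<le> c0 + \<eta>"
      using r1 r2 r3 eta by (intro exI[of _ r]) auto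
  qed
  have "cost q \<le> C0" unfolding cost_eq[OF q(1)] c0(1)[symmetric] by (rule ennreal_leI[OF q(4)])
  then show thesis
    using q(1-3) by (intro that[of q]) (simp_all add: F_def P_def cost_def C0_def \<kappa>_def MT_def D_def)
qed

section \<open>Conditioning on the cells of a simple function\<close>

definition cell :: "'b measure \<Rightarrow> ('b \<Rightarrow> 'c) \<Rightarrow> 'c \<Rightarrow> 'b set" where
  "cell M U a = {x \<in> space M. U x = a}"

lemma sets_cell: "simple_function M U \<Longrightarrow> cell M U a \<in> sets M"
  using measurable_sets[OF measurable_simple_function, of M U "{a}"] unfolding cell_def
  by (simp add: vimage_def Int_def conj_commute)

lemma emeasure_cell: "prob_space M \<Longrightarrow> simple_function M U \<Longrightarrow> emeasure M (cell M U a) = ennreal (pmf (law M U) a)"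
  by (simp add: cell_def pmf_law finite_measure.emeasure_eq_measure prob_space.finite_measure)

lemma emeasure_cell_pos: "prob_space M \<Longrightarrow> simple_function M U \<Longrightarrow> a \<in> set_pmf (law M U) \<Longrightarrow> emeasure M (cell M U a) \<noteq> 0"
  by (simp add: emeasure_cell set_pmf_iff)

lemma prob_space_uniform_cell:
  assumes M: "prob_space M" and "simple_function M U" "a \<in> set_pmf (law M U)"
  shows "prob_space (uniform_measure M (cell M U a))"
  by (rule prob_space_uniform_measure)
     (use assms emeasure_cell_pos[OF assms] in \<open>auto simp: finite_measure.emeasure_finite[OF prob_space.finite_measure]\<close>)

lemma simple_function_uniform: "simple_function M V \<Longrightarrow> simple_function (uniform_measure M A) V"
  by (simp add: simple_function_def)

text \<open>The chain rule for discrete laws. Cells of mass zero have weight zero in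
  \<open>bind_pmf\<close>, so the meaningless \<open>uniform_measure\<close> on them does no
  harm.\<close>

lemma law_Pair_eq_bind:
  assumes M: "prob_space M" and U: "simple_function M U" and V: "simple_function M V"
  shows "law M (\<lambda>x. (U x, V x)) = bind_pmf (law M U) (\<lambda>a. map_pmf (Pair a) (law (uniform_measure M (cell M U a)) V))"
proof (rule pmf_eqI)
  interpret prob_space M by fact
  fix z :: "'b \<times> 'c"
  obtain a b where z: "z = (a, b)" by (cases z)
  have UV: "simple_function M (\<lambda>x. (U x, V x))" using U V by simp
  define u where "u a' = pmf (map_pmf (Pair a') (law (uniform_measure M (cell M U a')) V)) (a, b)" for a'
  have u0: "u a' = 0" if "a' \<noteq> a" for a' unfolding u_def using that by (auto simp: pmf_eq_0_set_pmf)
  have "pmf (bind_pmf (law M U) (\<lambda>a. map_pmf (Pair a) (law (uniform_measure M (cell M U a)) V))) (a, b) = (\<integral>a'. u a' \<partial>law M U)"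
    unfolding pmf_bind u_def ..
  also have "\<dots> = pmf (law M U) a * u a"
    by (subst integral_measure_pmf[of "{a}"]) (use u0 in auto)
  also have "\<dots> = measure M {x \<in> space M. (U x, V x) = (a, b)}"
  proof (cases "a \<in> set_pmf (law M U)")
    case True
    have "u a = pmf (law (uniform_measure M (cell M U a)) V) b" unfolding u_def
      by (rule pmf_map_inj') (simp add: inj_on_def)
    also have "\<dots> = measure (uniform_measure M (cell M U a)) {x \<in> space M. V x = b}"
      by (subst pmf_law[OF prob_space_uniform_cell[OF M U True] simple_function_uniform[OF V]]) simp
    also have "\<dots> = measure M (cell M U a \<inter> {x \<in> space M. V x = b}) / measure M (cell M U a)"
      by (rule measure_uniform_measure)
         (use emeasure_cell_pos[OF M U True] sets_cell[OF V, of b] in \<open>auto simp: cell_def\<close>)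
    also have "cell M U a \<inter> {x \<in> space M. V x = b} = {x \<in> space M. (U x, V x) = (a, b)}" by (auto simp: cell_def)
    also have "measure M (cell M U a) = pmf (law M U) a" by (simp add: cell_def pmf_law[OF M U])
    finally show ?thesis using True by (simp add: set_pmf_iff)
  next
    case False
    then have "measure M (cell M U a) = 0" by (simp add: cell_def pmf_law[OF M U, symmetric] pmf_eq_0_set_pmf)
    moreover have "{x \<in> space M. (U x, V x) = (a, b)} \<subseteq> cell M U a" by (auto simp: cell_def)
    from finite_measure_mono[OF this sets_cell[OF U]]
    have "measure M {x \<in> space M. (U x, V x) = (a, b)} \<le> measure M (cell M U a)" .
    ultimately have "measure M {x \<in> space M. (U x, V x) = (a, b)} = 0" by (simp add: measure_le_0_iff)
    then show ?thesis using False by (simp add: pmf_eq_0_set_pmf)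
  qed
  also have "\<dots> = pmf (law M (\<lambda>x. (U x, V x))) (a, b)" by (rule pmf_law[OF M UV, symmetric])
  finally show "pmf (law M (\<lambda>x. (U x, V x))) z = pmf (bind_pmf (law M U) (\<lambda>a. map_pmf (Pair a) (law (uniform_measure M (cell M U a)) V))) z"
    unfolding z by simp
qed

lemma nn_integral_total:
  assumes M: "prob_space M" and U: "simple_function M U" and g[measurable]: "g \<in> borel_measurable M"
  shows "(\<integral>\<^sup>+a. (\<integral>\<^sup>+x. g x \<partial>uniform_measure M (cell M U a)) \<partial>law M U) = (\<integral>\<^sup>+x. g x \<partial>M)"
proof -
  interpret prob_space M by fact
  note [measurable] = sets_cell[OF U]
  have fin: "finite (set_pmf (law M U))" by (rule finite_set_law[OF M U])
  have "(\<integral>\<^sup>+a. (\<integral>\<^sup>+x. g x \<partial>uniform_measure M (cell M U a)) \<partial>law M U) = (\<Sum>a\<in>set_pmf (law M U). (\<integral>\<^sup>+x. g x \<partial>uniform_measure M (cell M U a)) * ennreal (pmf (law M U) a))"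
    by (rule nn_integral_measure_pmf_finite[OF fin]) simp
  also have "\<dots> = (\<Sum>a\<in>set_pmf (law M U). \<integral>\<^sup>+x. g x * indicator (cell M U a) x \<partial>M)"
  proof (rule sum.cong[OF refl])
    fix a assume a: "a \<in> set_pmf (law M U)"
    have one: "emeasure M (cell M U a) / emeasure M (cell M U a) = 1"
      using emeasure_cell_pos[OF M U a] by (simp add: divide_eq_1_ennreal)
    have "(\<integral>\<^sup>+x. g x \<partial>uniform_measure M (cell M U a)) = (\<integral>\<^sup>+x. g x * indicator (cell M U a) x \<partial>M) / emeasure M (cell M U a)"
      by (rule nn_integral_uniform_measure) measurable
    then show "(\<integral>\<^sup>+x. g x \<partial>uniform_measure M (cell M U a)) * ennreal (pmf (law M U) a) = (\<integral>\<^sup>+x. g x * indicator (cell M U a) x \<partial>M)"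
      unfolding emeasure_cell[OF M U, symmetric] by (simp add: ennreal_divide_times one)
  qed
  also have "\<dots> = (\<integral>\<^sup>+x. (\<Sum>a\<in>set_pmf (law M U). g x * indicator (cell M U a) x) \<partial>M)"
    by (rule nn_integral_sum[symmetric]) measurable
  also have "\<dots> = (\<integral>\<^sup>+x. g x \<partial>M)"
  proof (rule nn_integral_cong_AE)
    show "AE x in M. (\<Sum>a\<in>set_pmf (law M U). g x * indicator (cell M U a) x) = g x"
      using AE_law[OF M U] AE_space
    proof eventually_elim
      case (elim x)
      have "(\<Sum>a\<in>set_pmf (law M U). g x * indicator (cell M U a) x) = (\<Sum>a\<in>set_pmf (law M U). if a = U x then g x else 0)"
        by (rule sum.cong) (use elim(2) in \<open>auto simp: cell_def indicator_def\<close>)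
      then show ?case using fin elim(1) by simp
    qed
  qed
  finally show ?thesis .
qed

lemma measurable_restrict_prodE:
  assumes "\<nu> \<in> probs (prodE I)" "S \<subseteq> I"
  shows "(\<lambda>x. restrict x S) \<in> \<nu> \<rightarrow>\<^sub>M prodE S"
proof -
  have s: "sets \<nu> = sets (prodE I)" using assms by (auto simp: space_prob_algebra)
  show ?thesis unfolding measurable_cong_sets[OF s refl] prodE_def by (rule measurable_restrict_subset[OF assms(2)])
qed

lemma measurable_component_prob_algebra:
  assumes "\<nu> \<in> probs (prodE I)" "k \<in> I"
  shows "(\<lambda>x. x k) \<in> borel_measurable \<nu>"
proof -
  have s: "sets \<nu> = sets (prodE I)" using assms by (auto simp: space_prob_algebra)
  show ?thesis unfolding measurable_cong_sets[OF s refl] by (rule measurable_prodE_component[OF assms(2)])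
qed

lemma measurable_cond_kernel:
  assumes "\<nu> \<in> probs (prodE I)" "S \<subseteq> I" "is_cond_law \<nu> S k K"
  shows "(\<lambda>x. K (restrict x S)) \<in> \<nu> \<rightarrow>\<^sub>M prob_algebra borel"
  by (rule measurable_compose[OF measurable_restrict_prodE[OF assms(1,2)]]) (use assms(3) in \<open>simp add: is_cond_law_def\<close>)

text \<open>The event \<open>C\<close> depends on the coordinates in \<open>S\<close> only, so the
  defining identity of the conditional law can be integrated over it. Consequently, given an event
  of the past, coordinate \<open>k\<close> is a mixture of its conditional laws given
  \<open>S\<close>, even if \<open>S\<close> is larger than the past.\<close>

lemma bind_cond_law:
  fixes \<nu> :: "(nat \<Rightarrow> 'a::polish_space) measure"
  assumes nu: "\<nu> \<in> probs (prodE I)" and S: "S \<subseteq> I" and k: "k \<in> I" and K: "is_cond_law \<nu> S k K"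
    and A: "A \<in> sets (prodE S)" and C: "C = {x \<in> space \<nu>. restrict x S \<in> A}" and pos: "emeasure \<nu> C \<noteq> 0"
  shows "uniform_measure \<nu> C \<bind> (\<lambda>x. K (restrict x S)) = distr (uniform_measure \<nu> C) borel (\<lambda>x. x k)"
proof -
  interpret prob_space \<nu> using nu by (simp add: space_prob_algebra)
  note [measurable] = measurable_restrict_prodE[OF nu S] measurable_component_prob_algebra[OF nu k]
  have CS[measurable]: "C \<in> sets \<nu>" unfolding C using A by measurable
  define N where "N = uniform_measure \<nu> C"
  have sN: "sets N = sets \<nu>" "space N = space \<nu>" by (simp_all add: N_def)
  have KN: "(\<lambda>x. K (restrict x S)) \<in> N \<rightarrow>\<^sub>M prob_algebra borel"
    using measurable_cond_kernel[OF nu S K] measurable_cong_sets[OF sN(1) refl] by blast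
  have ne: "space N \<noteq> {}" using not_empty sN by simp
  have yk: "(\<lambda>x. x k) \<in> borel_measurable N"
    using measurable_component_prob_algebra[OF nu k] measurable_cong_sets[OF sN(1) refl] by blast
  show ?thesis unfolding N_def[symmetric]
  proof (rule measure_eqI)
    show "sets (N \<bind> (\<lambda>x. K (restrict x S))) = sets (distr N borel (\<lambda>x. x k))"
      using sets_bind[of N "\<lambda>x. K (restrict x S)" borel] prob_kernelD(2)[OF KN] ne by simp
    fix B assume "B \<in> sets (N \<bind> (\<lambda>x. K (restrict x S)))"
    then have B[measurable]: "B \<in> sets borel"
      using sets_bind[of N "\<lambda>x. K (restrict x S)" borel] prob_kernelD(2)[OF KN] ne by simp
    have Km: "(\<lambda>x. emeasure (K (restrict x S)) B) \<in> borel_measurable \<nu>"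
      by (rule measurable_compose[OF measurable_prob_algebraD[OF measurable_cond_kernel[OF nu S K]] measurable_emeasure_subprob_algebra[OF B]])
    have "emeasure (N \<bind> (\<lambda>x. K (restrict x S))) B = (\<integral>\<^sup>+x. emeasure (K (restrict x S)) B \<partial>N)"
      by (rule emeasure_bind[OF ne measurable_prob_algebraD[OF KN] B])
    also have "\<dots> = (\<integral>\<^sup>+x. emeasure (K (restrict x S)) B * indicator C x \<partial>\<nu>) / emeasure \<nu> C"
      unfolding N_def by (rule nn_integral_uniform_measure[OF Km CS])
    also have "(\<integral>\<^sup>+x. emeasure (K (restrict x S)) B * indicator C x \<partial>\<nu>) = (\<integral>\<^sup>+x. indicator A (restrict x S) * emeasure (K (restrict x S)) B \<partial>\<nu>)"
      by (intro nn_integral_cong) (auto simp: C indicator_def)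
    also have "\<dots> = emeasure \<nu> {x \<in> space \<nu>. restrict x S \<in> A \<and> x k \<in> B}"
      using K A B by (simp add: is_cond_law_def)
    also have "{x \<in> space \<nu>. restrict x S \<in> A \<and> x k \<in> B} = C \<inter> ((\<lambda>x. x k) -` B \<inter> space \<nu>)" by (auto simp: C)
    also have "emeasure \<nu> \<dots> / emeasure \<nu> C = emeasure N ((\<lambda>x. x k) -` B \<inter> space \<nu>)"
      unfolding N_def by (rule emeasure_uniform_measure[symmetric]) measurable
    also have "\<dots> = emeasure (distr N borel (\<lambda>x. x k)) B"
      using yk B by (simp add: emeasure_distr sN)
    finally show "emeasure (N \<bind> (\<lambda>x. K (restrict x S))) B = emeasure (distr N borel (\<lambda>x. x k)) B" .
  qed
qed

lemma uniform_measure_space: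
  assumes "prob_space M" shows "uniform_measure M (space M) = M"
proof (rule measure_eqI)
  fix A assume "A \<in> sets (uniform_measure M (space M))"
  then show "emeasure (uniform_measure M (space M)) A = emeasure M A"
    using sets.sets_into_space[of A M] prob_space.emeasure_space_1[OF assms]
    by (subst emeasure_uniform_measure) (auto simp: Int_absorb1 divide_ennreal_def)
qed simp

lemma bind_cond_law_space:
  fixes \<nu> :: "(nat \<Rightarrow> 'a::polish_space) measure"
  assumes nu: "\<nu> \<in> probs (prodE I)" and S: "S \<subseteq> I" and k: "k \<in> I" and K: "is_cond_law \<nu> S k K"
  shows "\<nu> \<bind> (\<lambda>x. K (restrict x S)) = distr \<nu> borel (\<lambda>x. x k)"
proof -
  have p: "prob_space \<nu>" using nu by (simp add: space_prob_algebra)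
  have "space \<nu> = {x \<in> space \<nu>. restrict x S \<in> space (prodE S)}"
    using measurable_space[OF measurable_restrict_prodE[OF nu S]] by auto
  from bind_cond_law[OF nu S k K sets.top this] show ?thesis
    by (simp add: uniform_measure_space[OF p] prob_space.emeasure_space_1[OF p])
qed

section \<open>Step-by-step coupling of discretised words\<close>

abbreviation word :: "('a \<Rightarrow> 'a) \<Rightarrow> nat \<Rightarrow> (nat \<Rightarrow> 'a) \<Rightarrow> 'a list" where
  "word T k x \<equiv> map (\<lambda>i. T (x i)) [0..<k]"

lemma simple_function_word:
  fixes T :: "'a::polish_space \<Rightarrow> 'a"
  assumes T: "T \<in> borel_measurable borel" and fin: "finite (range T)"
    and nu: "\<nu> \<in> probs (prodE I)" and k: "{..<k} \<subseteq> I"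
  shows "simple_function \<nu> (word T k)"
  using k
proof (induction k)
  case (Suc k)
  have "simple_function \<nu> (\<lambda>x. T (x k))"
    by (rule simple_function_comp[OF measurable_component_prob_algebra[OF nu] simple_function_finite_range[OF T fin]]) (use Suc in auto)
  moreover have "{..<k} \<subseteq> I" using Suc.prems by auto
  then have "simple_function \<nu> (word T k)" by (rule Suc.IH)
  ultimately show ?case using simple_function_compose2[of \<nu> "word T k" "\<lambda>x. T (x k)" "\<lambda>a b. a @ [b]"] by simp
qed simp

lemma law_word_Suc:
  fixes T :: "'a::polish_space \<Rightarrow> 'a"
  assumes T: "T \<in> borel_measurable borel" and fin: "finite (range T)"
    and nu: "\<nu> \<in> probs (prodE I)" and k: "{..<Suc k} \<subseteq> I"
  shows "law \<nu> (word T (Suc k)) = bind_pmf (law \<nu> (word T k))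
    (\<lambda>a. map_pmf (\<lambda>b. a @ [b]) (law (distr (uniform_measure \<nu> (cell \<nu> (word T k) a)) borel (\<lambda>x. x k)) T))"
proof -
  have p: "prob_space \<nu>" using nu by (simp add: space_prob_algebra)
  have kI: "k \<in> I" using k by auto
  have sk: "simple_function \<nu> (\<lambda>x. T (x k))"
    by (rule simple_function_comp[OF measurable_component_prob_algebra[OF nu kI] simple_function_finite_range[OF T fin]])
  have sw: "simple_function \<nu> (word T k)" by (rule simple_function_word[OF T fin nu]) (use k in auto)
  have "law \<nu> (word T (Suc k)) = map_pmf (\<lambda>(a, b). a @ [b]) (law \<nu> (\<lambda>x. (word T k x, T (x k))))"
    by (subst map_pmf_law[OF p simple_function_Pair[OF sw sk]]) simp
  also have "\<dots> = bind_pmf (law \<nu> (word T k)) (\<lambda>a. map_pmf (\<lambda>b. a @ [b]) (law (uniform_measure \<nu> (cell \<nu> (word T k) a)) (\<lambda>x. T (x k))))"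
    unfolding law_Pair_eq_bind[OF p sw sk] by (simp add: map_bind_pmf pmf.map_comp comp_def)
  also have "(\<lambda>a. law (uniform_measure \<nu> (cell \<nu> (word T k) a)) (\<lambda>x. T (x k))) = (\<lambda>a. law (distr (uniform_measure \<nu> (cell \<nu> (word T k) a)) borel (\<lambda>x. x k)) T)"
    by (rule ext, rule law_distr[symmetric])
       (use measurable_component_prob_algebra[OF nu kI] simple_function_finite_range[OF T fin] in auto)
  finally show ?thesis by meson
qed

text \<open>The inclusion \<open>{..<k} \<subseteq> S\<close> makes a cell of past words an event of
  the coordinates in \<open>S\<close>, the form that \<open>bind_cond_law\<close> asks for. This is
  where conditioning on at least the past matters.\<close>

lemma cell_word_eq:
  fixes T :: "'a::polish_space \<Rightarrow> 'a"
  assumes T[measurable]: "T \<in> borel_measurable borel" and fin: "finite (range T)" and k: "{..<k} \<subseteq> S"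
    and nu: "\<nu> \<in> probs (prodE I)" and S: "S \<subseteq> I"
  obtains A where "A \<in> sets (prodE S)" "cell \<nu> (word T k) a = {x \<in> space \<nu>. restrict x S \<in> A}"
proof -
  define A where "A = {x \<in> space (prodE S). word T k x = a}"
  have "A = (if length a = k then {x \<in> space (prodE S). \<forall>i\<in>{..<k}. T (x i) = a ! i} else {})"
    unfolding A_def by (auto simp: list_eq_iff_nth_eq)
  also have "\<dots> \<in> sets (prodE S)"
  proof -
    have "{x \<in> space (prodE S). \<forall>i\<in>{..<k}. T (x i) = a ! i} \<in> sets (prodE S)"
    proof (rule sets.sets_Collect_finite_All)
      fix i assume "i \<in> {..<k}"
      then have [measurable]: "(\<lambda>x. x i) \<in> prodE S \<rightarrow>\<^sub>M borel" using k by (intro measurable_prodE_component) auto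
      show "{x \<in> space (prodE S). T (x i) = a ! i} \<in> sets (prodE S)" by measurable
    qed simp
    then show ?thesis by simp
  qed
  finally have "A \<in> sets (prodE S)" .
  moreover have "cell \<nu> (word T k) a = {x \<in> space \<nu>. restrict x S \<in> A}"
  proof -
    have "word T k (restrict x S) = word T k x" for x using k by auto
    then show ?thesis using measurable_space[OF measurable_restrict_prodE[OF nu S]]
      unfolding cell_def A_def by auto
  qed
  ultimately show thesis by (rule that)
qed

text \<open>Each new pair is drawn knowing the past second components only. If the first marginal of
  every \<open>q k a\<close> is one and the same law, the first components become independent, as
  the product measure requires.\<close>

primrec chain_pmf :: "(nat \<Rightarrow> 'a list \<Rightarrow> ('a \<times> 'a) pmf) \<Rightarrow> nat \<Rightarrow> ('a \<times> 'a) list pmf" where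
  "chain_pmf q 0 = return_pmf []"
| "chain_pmf q (Suc k) = bind_pmf (chain_pmf q k) (\<lambda>w. map_pmf (\<lambda>z. w @ [z]) (q k (map snd w)))"

lemma length_chain_pmf: "w \<in> set_pmf (chain_pmf q k) \<Longrightarrow> length w = k"
  by (induction k arbitrary: w) auto

lemma chain_pmf_snd:
  fixes T :: "'a::polish_space \<Rightarrow> 'a"
  assumes T: "T \<in> borel_measurable borel" and fin: "finite (range T)"
    and nu: "\<nu> \<in> probs (prodE {..<n})" and k: "k \<le> n"
    and q: "\<And>k a. k < n \<Longrightarrow> a \<in> set_pmf (law \<nu> (word T k)) \<Longrightarrow>
       map_pmf snd (q k a) = law (distr (uniform_measure \<nu> (cell \<nu> (word T k) a)) borel (\<lambda>x. x k)) T"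
  shows "map_pmf (map snd) (chain_pmf q k) = law \<nu> (word T k)"
  using k
proof (induction k)
  case 0
  have p: "prob_space \<nu>" using nu by (simp add: space_prob_algebra)
  show ?case
  proof (rule pmf_eqI)
    fix l :: "'a list"
    have "pmf (law \<nu> (word T 0)) l = measure \<nu> {x \<in> space \<nu>. [] = l}" by (subst pmf_law[OF p]) auto
    also have "\<dots> = indicator {l} []"
      using prob_space.prob_space[OF p] by (cases "l = []") auto
    finally show "pmf (map_pmf (map snd) (chain_pmf q 0)) l = pmf (law \<nu> (word T 0)) l" by (simp add: indicator_def)
  qed
next
  case (Suc k)
  then have IH: "map_pmf (map snd) (chain_pmf q k) = law \<nu> (word T k)" by simp
  have "map_pmf (map snd) (chain_pmf q (Suc k)) = bind_pmf (map_pmf (map snd) (chain_pmf q k)) (\<lambda>a. map_pmf (\<lambda>b. a @ [b]) (map_pmf snd (q k a)))"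
    by (simp add: map_bind_pmf bind_map_pmf pmf.map_comp comp_def)
  also have "\<dots> = law \<nu> (word T (Suc k))"
    unfolding IH using Suc.prems
    by (subst law_word_Suc[OF T fin nu]) (auto intro!: bind_pmf_cong simp: q)
  finally show ?case .
qed

text \<open>The product measure is treated by the same recursion \<open>law_word_Suc\<close> as
  \<nu>: the constant kernel \<mu> is a conditional law for it, so given any past word of positive
  probability the next coordinate has law \<mu>.\<close>

lemma chain_pmf_fst:
  fixes T :: "'a::polish_space \<Rightarrow> 'a" and \<mu> :: "'a measure"
  assumes T: "T \<in> borel_measurable borel" and fin: "finite (range T)"
    and mu: "\<mu> \<in> probs borel" and k: "k \<le> n"
    and q: "\<And>k w. k < n \<Longrightarrow> w \<in> set_pmf (chain_pmf q k) \<Longrightarrow> map_pmf fst (q k (map snd w)) = law \<mu> T"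
  shows "map_pmf (map fst) (chain_pmf q k) = law (pow_measure \<mu> n) (word T k)"
  using k
proof (induction k)
  case 0
  have p: "prob_space (pow_measure \<mu> n)" using mu by (simp add: space_prob_algebra prob_space_pow_measure)
  show ?case
  proof (rule pmf_eqI)
    fix l :: "'a list"
    have "pmf (law (pow_measure \<mu> n) (word T 0)) l = measure (pow_measure \<mu> n) {x \<in> space (pow_measure \<mu> n). [] = l}" by (subst pmf_law[OF p]) auto
    also have "\<dots> = indicator {l} []"
      using prob_space.prob_space[OF p] by (cases "l = []") auto
    finally show "pmf (map_pmf (map fst) (chain_pmf q 0)) l = pmf (law (pow_measure \<mu> n) (word T 0)) l" by (simp add: indicator_def)
  qed
next
  case (Suc k)
  let ?M = "pow_measure \<mu> n"
  have M: "?M \<in> probs (prodE {..<n})" by (rule pow_measure_in_prob_algebra[OF mu])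
  have pM: "prob_space ?M" using M by (simp add: space_prob_algebra)
  have kn: "k < n" "{..<Suc k} \<subseteq> {..<n}" "{..<k} \<subseteq> {..<n}" using Suc.prems by auto
  have sw: "simple_function ?M (word T k)" by (rule simple_function_word[OF T fin M kn(3)])
  have dist: "distr (uniform_measure ?M (cell ?M (word T k) a)) borel (\<lambda>x. x k) = \<mu>"
    if a: "a \<in> set_pmf (law ?M (word T k))" for a
  proof -
    obtain A where A: "A \<in> sets (prodE {..<k})" "cell ?M (word T k) a = {x \<in> space ?M. restrict x {..<k} \<in> A}"
      by (rule cell_word_eq[OF T fin order_refl M kn(3)])
    have kk: "k \<notin> {..<k}" "k \<in> {..<n}" using kn by auto
    have "uniform_measure ?M (cell ?M (word T k) a) \<bind> (\<lambda>x. \<mu>) = distr (uniform_measure ?M (cell ?M (word T k) a)) borel (\<lambda>x. x k)"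
      using bind_cond_law[OF M kn(3) kk(2) is_cond_law_pow_measure[OF mu kn(3,1) kk(1)] A emeasure_cell_pos[OF pM sw a]] .
    moreover have "uniform_measure ?M (cell ?M (word T k) a) \<bind> (\<lambda>x. \<mu>) = \<mu>"
      by (rule bind_const'[OF prob_space_uniform_cell[OF pM sw a]])
         (use mu in \<open>auto simp: space_prob_algebra intro: prob_space_imp_subprob_space\<close>)
    ultimately show ?thesis by simp
  qed
  have IH: "map_pmf (map fst) (chain_pmf q k) = law ?M (word T k)" using Suc by simp
  have "map_pmf (map fst) (chain_pmf q (Suc k)) = bind_pmf (chain_pmf q k) (\<lambda>w. map_pmf (\<lambda>b. map fst w @ [b]) (map_pmf fst (q k (map snd w))))"
    by (simp add: map_bind_pmf bind_map_pmf pmf.map_comp comp_def)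
  also have "\<dots> = bind_pmf (chain_pmf q k) (\<lambda>w. map_pmf (\<lambda>b. map fst w @ [b]) (law \<mu> T))"
    using q[OF kn(1)] by (intro bind_pmf_cong refl) simp
  also have "\<dots> = bind_pmf (map_pmf (map fst) (chain_pmf q k)) (\<lambda>a. map_pmf (\<lambda>b. a @ [b]) (law \<mu> T))"
    by (simp add: bind_map_pmf)
  also have "\<dots> = law ?M (word T (Suc k))"
    unfolding IH by (subst law_word_Suc[OF T fin M kn(2)]) (auto intro!: bind_pmf_cong simp: dist)
  finally show ?case .
qed

definition list_cost :: "('a::metric_space \<times> 'a) list \<Rightarrow> ennreal" where
  "list_cost w = (\<Sum>z\<leftarrow>w. sqd (fst z) (snd z))"

lemma list_cost_snoc: "list_cost (w @ [z]) = list_cost w + sqd (fst z) (snd z)"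
  by (simp only: list_cost_def map_append sum_list_append list.map sum_list.Cons sum_list.Nil add_0_right)

text \<open>Squared distances add up along a word, and the expected cost of step \<open>j\<close>
  depends on the past through the second components only. This additivity is why the Euclidean
  product metric goes with squared costs.\<close>

lemma chain_pmf_cost:
  "(\<integral>\<^sup>+w. list_cost w \<partial>chain_pmf q k) = (\<Sum>j<k. \<integral>\<^sup>+a. sq_cost (q j a) \<partial>map_pmf (map snd) (chain_pmf q j))"
proof (induction k)
  case (Suc k)
  have "(\<integral>\<^sup>+w. list_cost w \<partial>chain_pmf q (Suc k)) = (\<integral>\<^sup>+w. (\<integral>\<^sup>+z. list_cost w + sqd (fst z) (snd z) \<partial>q k (map snd w)) \<partial>chain_pmf q k)"
    by (simp add: list_cost_snoc)
  also have "\<dots> = (\<integral>\<^sup>+w. list_cost w + sq_cost (q k (map snd w)) \<partial>chain_pmf q k)"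
    by (intro nn_integral_cong) (simp add: nn_integral_add)
  also have "\<dots> = (\<integral>\<^sup>+w. list_cost w \<partial>chain_pmf q k) + (\<integral>\<^sup>+w. sq_cost (q k (map snd w)) \<partial>chain_pmf q k)"
    by (rule nn_integral_add) auto
  finally show ?case using Suc by simp
qed (simp add: list_cost_def)

lemma list_cost_eq_sum:
  "length w = n \<Longrightarrow> list_cost w = (\<Sum>i<n. sqd (map fst w ! i) (map snd w ! i))"
  unfolding list_cost_def by (subst sum_list_sum_nth) (auto intro: sum.cong simp: lessThan_atLeast0)

lemma ennreal_dist_n_power2: "ennreal ((dist_n n x y)\<^sup>2) = (\<Sum>i<n. sqd (x i) (y i))"
  unfolding dist_n_power2 by (simp add: sum_ennreal)

lemma nn_integral_uniform_cell_finite: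
  assumes M: "prob_space M" and U: "simple_function M U" and a: "a \<in> set_pmf (law M U)"
    and g[measurable]: "g \<in> borel_measurable M" and fin: "(\<integral>\<^sup>+x. g x \<partial>M) < \<infinity>"
  shows "(\<integral>\<^sup>+x. g x \<partial>uniform_measure M (cell M U a)) < \<infinity>"
proof -
  note [measurable] = sets_cell[OF U]
  have "(\<integral>\<^sup>+x. g x \<partial>uniform_measure M (cell M U a)) = (\<integral>\<^sup>+x. g x * indicator (cell M U a) x \<partial>M) / emeasure M (cell M U a)"
    by (rule nn_integral_uniform_measure) measurable
  also have "\<dots> < \<infinity>"
  proof -
    have "(\<integral>\<^sup>+x. g x * indicator (cell M U a) x \<partial>M) \<le> (\<integral>\<^sup>+x. g x \<partial>M)"
      by (intro nn_integral_mono) (auto simp: indicator_def)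
    then have "(\<integral>\<^sup>+x. g x * indicator (cell M U a) x \<partial>M) < \<infinity>" using fin by (rule order_le_less_trans)
    then show ?thesis using emeasure_cell_pos[OF M U a] by (auto simp: ennreal_divide_eq_top_iff less_top[symmetric])
  qed
  finally show ?thesis .
qed

text \<open>Knothe-type coupling of the discretised words; the kernels may depend on more than the past coordinates.\<close>
lemma chain_coupling_discrete:
  fixes \<mu> :: "'a::polish_space measure" and \<nu> :: "(nat \<Rightarrow> 'a) measure" and \<beta> :: "'a measure \<Rightarrow> ennreal"
  assumes mu: "\<mu> \<in> probs borel" and nu: "\<nu> \<in> probs (prodE {..<n})"
    and S: "\<And>k. k < n \<Longrightarrow> {..<k} \<subseteq> S k" "\<And>k. k < n \<Longrightarrow> S k \<subseteq> {..<n}"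
    and K: "\<And>k. k < n \<Longrightarrow> is_cond_law \<nu> (S k) k (K k)"
    and \<beta>[measurable]: "\<beta> \<in> borel_measurable (prob_algebra borel)"
    and le: "\<And>p e. p \<in> probs borel \<Longrightarrow> \<beta> p < \<infinity> \<Longrightarrow> e > 0 \<Longrightarrow>
       \<exists>\<gamma>\<in>couplings \<mu> p. sq_cost \<gamma> \<le> \<beta> p + ennreal e"
    and bfin: "\<And>k. k < n \<Longrightarrow> (\<integral>\<^sup>+x. \<beta> (K k (restrict x (S k))) \<partial>\<nu>) < \<infinity>"
    and T[measurable]: "T \<in> borel_measurable borel" and fin: "finite (range T)" and d: "\<delta> > 0"
    and mT: "sq_err T \<mu> < \<infinity>"
    and nT: "\<And>k. k < n \<Longrightarrow> (\<integral>\<^sup>+x. sqd (x k) (T (x k)) \<partial>\<nu>) < \<infinity>"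
  shows "\<exists>r. map_pmf (map fst) r = law (pow_measure \<mu> n) (word T n) \<and> map_pmf (map snd) r = law \<nu> (word T n)
    \<and> (\<forall>w\<in>set_pmf r. length w = n)
    \<and> (\<integral>\<^sup>+w. list_cost w \<partial>measure_pmf r) \<le> (\<Sum>k<n. ennreal (1 + \<delta>) * (\<integral>\<^sup>+x. \<beta> (K k (restrict x (S k))) \<partial>\<nu>)
        + (ennreal (2 * (1 + 1 / \<delta>)) * sq_err T \<mu>
          + ennreal (2 * (1 + 1 / \<delta>)) * (\<integral>\<^sup>+x. sqd (x k) (T (x k)) \<partial>\<nu>)))"
proof -
  have pm: "prob_space \<mu>" "sets \<mu> = sets borel" using mu by (auto simp: space_prob_algebra)
  have pn: "prob_space \<nu>" using nu by (auto simp: space_prob_algebra)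
  define \<kappa> where "\<kappa> = ennreal (2 * (1 + 1 / \<delta>))"
  define D where "D y = sqd y (T y)" for y
  have Dm[measurable]: "D \<in> borel_measurable borel" unfolding D_def by measurable
  define MT where "MT = (\<integral>\<^sup>+x. D x \<partial>\<mu>)"
  define N where "N k a = uniform_measure \<nu> (cell \<nu> (word T k) a)" for k a
  define b where "b k x = \<beta> (K k (restrict x (S k)))" for k x
  have bm: "b k \<in> borel_measurable \<nu>" if "k < n" for k
    unfolding b_def by (rule measurable_compose[OF measurable_cond_kernel[OF nu S(2)[OF that] K[OF that]] \<beta>])
  define R where "R k a = ennreal (1 + \<delta>) * (\<integral>\<^sup>+x. b k x \<partial>N k a) + (\<kappa> * MT + \<kappa> * (\<integral>\<^sup>+x. D (x k) \<partial>N k a))" for k a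
  have sw: "simple_function \<nu> (word T k)" if "k < n" for k
    by (rule simple_function_word[OF T fin nu]) (use that in auto)
  have cm: "(\<lambda>x. x k) \<in> borel_measurable \<nu>" if "k < n" for k
    by (rule measurable_component_prob_algebra[OF nu]) (use that in simp)
  define good where "good k a q \<longleftrightarrow> map_pmf fst q = law \<mu> T \<and> map_pmf snd q = law (distr (N k a) borel (\<lambda>x. x k)) T
      \<and> sq_cost (measure_pmf q) \<le> R k a" for k a q
  have ex: "\<exists>q. good k a q" if k: "k < n" and a: "a \<in> set_pmf (law \<nu> (word T k))" for k a
  proof -
    have kI: "k \<in> {..<n}" using k by simp
    obtain A where A: "A \<in> sets (prodE (S k))" "cell \<nu> (word T k) a = {x \<in> space \<nu>. restrict x (S k) \<in> A}"
      by (rule cell_word_eq[OF T fin S(1)[OF k] nu S(2)[OF k]])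
    \<comment> \<open>Given the past word \<open>a\<close>, coordinate \<open>k\<close> is a mixture
      of the laws \<open>K k\<close> with mixing measure \<open>N k a\<close>; this is the situation
      of \<open>discrete_jensen\<close>.\<close>
    have bind: "N k a \<bind> (\<lambda>x. K k (restrict x (S k))) = distr (N k a) borel (\<lambda>x. x k)"
      unfolding N_def by (rule bind_cond_law[OF nu S(2)[OF k] kI K[OF k] A emeasure_cell_pos[OF pn sw[OF k] a]])
    have pN: "prob_space (N k a)" unfolding N_def by (rule prob_space_uniform_cell[OF pn sw[OF k] a])
    have sN: "sets (N k a) = sets \<nu>" by (simp add: N_def)
    have spN: "space (N k a) = space \<nu>" by (simp add: N_def)
    have kern: "(\<lambda>x. K k (restrict x (S k))) \<in> N k a \<rightarrow>\<^sub>M prob_algebra borel"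
      using measurable_cond_kernel[OF nu S(2)[OF k] K[OF k]] measurable_cong_sets[OF sN refl] by blast
    have bN: "b k \<in> borel_measurable (N k a)" using bm[OF k] measurable_cong_sets[OF sN refl] by blast
    have cN: "(\<lambda>x. x k) \<in> borel_measurable (N k a)" using cm[OF k] measurable_cong_sets[OF sN refl] by blast
    have DN: "(\<integral>\<^sup>+x. D x \<partial>distr (N k a) borel (\<lambda>x. x k)) = (\<integral>\<^sup>+x. D (x k) \<partial>N k a)"
      by (rule nn_integral_distr[OF cN]) simp
    have Dfin: "(\<integral>\<^sup>+x. D (x k) \<partial>N k a) < \<infinity>" unfolding N_def
      by (rule nn_integral_uniform_cell_finite[OF pn sw[OF k] a measurable_compose[OF cm[OF k] Dm]])
         (use nT[OF k] in \<open>simp add: D_def\<close>)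
    have bNfin: "(\<integral>\<^sup>+x. b k x \<partial>N k a) < \<infinity>" unfolding N_def
      by (rule nn_integral_uniform_cell_finite[OF pn sw[OF k] a bm[OF k]]) (use bfin[OF k] in \<open>simp add: b_def\<close>)
    show ?thesis
    proof (rule discrete_jensen[OF pm pN kern T fin d bN bNfin])
      fix x and e :: real assume x: "x \<in> space (N k a)" "b k x < \<infinity>" "e > 0"
      show "\<exists>\<gamma>\<in>couplings \<mu> (K k (restrict x (S k))). sq_cost \<gamma> \<le> b k x + ennreal e"
        unfolding b_def by (rule le) (use x prob_kernelD(3)[OF kern] in \<open>auto simp: b_def\<close>)
    next
      show "sq_err T \<mu> < \<infinity>" by (rule mT)
      show "(\<integral>\<^sup>+x. sqd x (T x) \<partial>(N k a \<bind> (\<lambda>x. K k (restrict x (S k))))) < \<infinity>"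
        unfolding bind using DN Dfin by (simp add: D_def)
    next
      fix q assume "map_pmf fst q = law \<mu> T" "map_pmf snd q = law (N k a \<bind> (\<lambda>x. K k (restrict x (S k)))) T"
        "sq_cost (measure_pmf q) \<le> ennreal (1 + \<delta>) * (\<integral>\<^sup>+x. b k x \<partial>N k a)
          + (ennreal (2 * (1 + 1 / \<delta>)) * sq_err T \<mu>
            + ennreal (2 * (1 + 1 / \<delta>)) * (\<integral>\<^sup>+x. sqd x (T x) \<partial>(N k a \<bind> (\<lambda>x. K k (restrict x (S k))))))"
      then have "good k a q" unfolding good_def R_def bind \<kappa>_def MT_def using DN by (simp add: D_def[abs_def])
      then show ?thesis by blast
    qed
  qed
  define q where "q k a = (SOME q. good k a q)" for k a
  have q: "good k a (q k a)" if "k < n" "a \<in> set_pmf (law \<nu> (word T k))" for k a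
    unfolding q_def by (rule someI_ex[OF ex[OF that]])
  define r where "r = chain_pmf q n"
  have snd: "map_pmf (map snd) (chain_pmf q k) = law \<nu> (word T k)" if "k \<le> n" for k
    by (rule chain_pmf_snd[OF T fin nu that]) (use q in \<open>auto simp: good_def N_def\<close>)
  have "map_pmf (map fst) r = law (pow_measure \<mu> n) (word T n)"
    unfolding r_def
  proof (rule chain_pmf_fst[OF T fin mu order_refl])
    fix k w assume k: "k < n" and w: "w \<in> set_pmf (chain_pmf q k)"
    have "map snd w \<in> set_pmf (map_pmf (map snd) (chain_pmf q k))" using w by simp
    then have "map snd w \<in> set_pmf (law \<nu> (word T k))" using snd[of k] k by simp
    then show "map_pmf fst (q k (map snd w)) = law \<mu> T" using q[OF k] by (simp add: good_def)
  qed
  moreover have "map_pmf (map snd) r = law \<nu> (word T n)" unfolding r_def by (rule snd) simp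
  moreover have "\<forall>w\<in>set_pmf r. length w = n" using length_chain_pmf unfolding r_def by blast
  moreover have "(\<integral>\<^sup>+w. list_cost w \<partial>measure_pmf r) \<le> (\<Sum>k<n. ennreal (1 + \<delta>) * (\<integral>\<^sup>+x. b k x \<partial>\<nu>) + (\<kappa> * MT + \<kappa> * (\<integral>\<^sup>+x. D (x k) \<partial>\<nu>)))"
    unfolding r_def chain_pmf_cost
  proof (rule sum_mono)
    fix k assume "k \<in> {..<n}"
    then have k: "k < n" by simp
    have cDm: "(\<lambda>x. D (x k)) \<in> borel_measurable \<nu>" by (rule measurable_compose[OF cm[OF k] Dm])
    have "(\<integral>\<^sup>+a. sq_cost (q k a) \<partial>map_pmf (map snd) (chain_pmf q k))
      \<le> (\<integral>\<^sup>+a. R k a \<partial>law \<nu> (word T k))"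
      unfolding snd[OF less_imp_le[OF k]]
    proof (rule nn_integral_mono_AE)
      show "AE a in law \<nu> (word T k). sq_cost (q k a) \<le> R k a"
        using q[OF k] by (auto simp: AE_measure_pmf_iff good_def)
    qed
    also have "\<dots> = ennreal (1 + \<delta>) * (\<integral>\<^sup>+a. (\<integral>\<^sup>+x. b k x \<partial>N k a) \<partial>law \<nu> (word T k)) + (\<kappa> * MT + \<kappa> * (\<integral>\<^sup>+a. (\<integral>\<^sup>+x. D (x k) \<partial>N k a) \<partial>law \<nu> (word T k)))"
      unfolding R_def by (simp add: nn_integral_add nn_integral_cmult measure_pmf.emeasure_space_1)
    \<comment> \<open>Averaging the conditional bounds over the past words restores the integrals
      under \<nu>, so conditioning loses nothing.\<close>
    also have "\<dots> = ennreal (1 + \<delta>) * (\<integral>\<^sup>+x. b k x \<partial>\<nu>) + (\<kappa> * MT + \<kappa> * (\<integral>\<^sup>+x. D (x k) \<partial>\<nu>))"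
      unfolding N_def nn_integral_total[OF pn sw[OF k] bm[OF k]] nn_integral_total[OF pn sw[OF k] cDm] ..
    finally show "(\<integral>\<^sup>+a. sq_cost (q k a) \<partial>map_pmf (map snd) (chain_pmf q k))
      \<le> ennreal (1 + \<delta>) * (\<integral>\<^sup>+x. b k x \<partial>\<nu>) + (\<kappa> * MT + \<kappa> * (\<integral>\<^sup>+x. D (x k) \<partial>\<nu>))" .
  qed
  ultimately show ?thesis
    by (intro exI[of _ r]) (simp add: \<kappa>_def MT_def D_def[abs_def] b_def)
qed

section \<open>From discretised words to couplings on the product space\<close>

lemma second_moment_le_coupling:
  fixes \<mu> \<nu> :: "'a::polish_space measure"
  assumes g: "\<gamma> \<in> couplings \<mu> \<nu>" and s: "sets \<mu> = sets borel" "sets \<nu> = sets borel"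
  shows "sq_moment x0 \<nu> \<le> 2 * sq_cost \<gamma> + 2 * sq_moment x0 \<mu>"
proof -
  have [measurable_cong]: "sets \<gamma> = sets (borel \<Otimes>\<^sub>M borel)"
    using g sets_pair_measure_cong[OF s] by (simp add: couplings_def)
  have m: "(\<lambda>x. sqd x x0) \<in> borel_measurable \<mu>" "(\<lambda>x. sqd x x0) \<in> borel_measurable \<nu>"
    by (simp_all add: measurable_cong_sets[OF s(1) refl] measurable_cong_sets[OF s(2) refl])
  have "sq_moment x0 \<nu> = (\<integral>\<^sup>+z. sqd (snd z) x0 \<partial>\<gamma>)"
    by (rule nn_integral_coupling_snd[OF g m(2), symmetric])
  also have "\<dots> \<le> (\<integral>\<^sup>+z. 2 * sqd (fst z) (snd z) + 2 * sqd (fst z) x0 \<partial>\<gamma>)"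
  proof (rule nn_integral_mono)
    fix z :: "'a \<times> 'a"
    let ?a = "dist (fst z) (snd z)" and ?b = "dist (fst z) x0"
    have "dist (snd z) x0 \<le> ?a + ?b" using dist_triangle[of "snd z" x0 "fst z"] by (simp add: dist_commute)
    then have "(dist (snd z) x0)\<^sup>2 \<le> (?a + ?b)\<^sup>2" by (intro power_mono) auto
    also have "\<dots> \<le> 2 * ?a\<^sup>2 + 2 * ?b\<^sup>2" using sum_squares_bound[of ?a ?b] by (simp add: power2_sum)
    finally have "sqd (snd z) x0 \<le> ennreal (2 * ?a\<^sup>2 + 2 * ?b\<^sup>2)" by (rule ennreal_leI)
    then show "sqd (snd z) x0 \<le> 2 * ennreal (?a\<^sup>2) + 2 * ennreal (?b\<^sup>2)" by (simp add: ennreal_mult')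
  qed
  also have "\<dots> = 2 * sq_cost \<gamma> + 2 * (\<integral>\<^sup>+z. sqd (fst z) x0 \<partial>\<gamma>)"
    by (simp add: nn_integral_add nn_integral_cmult)
  also have "(\<integral>\<^sup>+z. sqd (fst z) x0 \<partial>\<gamma>) = sq_moment x0 \<mu>"
    by (rule nn_integral_coupling_fst[OF g m(1)])
  finally show ?thesis .
qed

text \<open>Almost every conditional law has finite \<beta> and hence a coupling with \<mu> of cost
  at most \<open>\<beta> p + 1\<close>, which bounds its second moment by that of \<mu>. Integrating
  over the mixture bounds the marginal.\<close>

lemma second_moment_component:
  fixes \<mu> :: "'a::polish_space measure" and \<nu> :: "(nat \<Rightarrow> 'a) measure" and \<beta> :: "'a measure \<Rightarrow> ennreal"
  assumes mu: "\<mu> \<in> probs borel" and nu: "\<nu> \<in> probs (prodE I)"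
    and S: "S \<subseteq> I" and k: "k \<in> I" and K: "is_cond_law \<nu> S k K"
    and \<beta>[measurable]: "\<beta> \<in> borel_measurable (prob_algebra borel)"
    and le: "\<And>p e. p \<in> probs borel \<Longrightarrow> \<beta> p < \<infinity> \<Longrightarrow> e > 0 \<Longrightarrow>
       \<exists>\<gamma>\<in>couplings \<mu> p. sq_cost \<gamma> \<le> \<beta> p + ennreal e"
    and bfin: "(\<integral>\<^sup>+x. \<beta> (K (restrict x S)) \<partial>\<nu>) < \<infinity>"
    and mom: "sq_moment x0 \<mu> < \<infinity>"
  shows "sq_moment x0 (distr \<nu> borel (\<lambda>x. x k)) < \<infinity>"
proof -
  interpret prob_space \<nu> using nu by (simp add: space_prob_algebra)
  let ?m = "\<integral>\<^sup>+x. sqd x x0 \<partial>\<mu>"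
  note kern = measurable_cond_kernel[OF nu S K]
  have bm[measurable]: "(\<lambda>x. \<beta> (K (restrict x S))) \<in> borel_measurable \<nu>"
    by (rule measurable_compose[OF kern \<beta>])
  have "sq_moment x0 (distr \<nu> borel (\<lambda>x. x k)) = (\<integral>\<^sup>+x. sq_moment x0 (K (restrict x S)) \<partial>\<nu>)"
    unfolding bind_cond_law_space[OF nu S k K, symmetric]
    by (rule nn_integral_bind[OF _ measurable_prob_algebraD[OF kern]]) simp
  also have "\<dots> \<le> (\<integral>\<^sup>+x. 2 * (\<beta> (K (restrict x S)) + 1) + 2 * ?m \<partial>\<nu>)"
  proof (rule nn_integral_mono_AE)
    have "AE x in \<nu>. \<beta> (K (restrict x S)) \<noteq> \<infinity>"
      by (rule nn_integral_PInf_AE[OF bm]) (use bfin in auto)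
    then show "AE x in \<nu>. sq_moment x0 (K (restrict x S)) \<le> 2 * (\<beta> (K (restrict x S)) + 1) + 2 * ?m"
      using AE_space
    proof eventually_elim
      case (elim x)
      note Kx = prob_kernelD[OF kern elim(2)]
      obtain \<gamma> where g: "\<gamma> \<in> couplings \<mu> (K (restrict x S))" "sq_cost \<gamma> \<le> \<beta> (K (restrict x S)) + ennreal 1"
        using le[OF Kx(3), of 1] elim(1) by (auto simp: less_top)
      have "sq_moment x0 (K (restrict x S)) \<le> 2 * sq_cost \<gamma> + 2 * ?m"
        by (rule second_moment_le_coupling[OF g(1)]) (use mu Kx(2) in \<open>auto simp: space_prob_algebra\<close>)
      also have "\<dots> \<le> 2 * (\<beta> (K (restrict x S)) + 1) + 2 * ?m"
        by (intro add_mono mult_left_mono order_refl) (use g(2) in auto)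
      finally show ?case .
    qed
  qed
  also have "\<dots> = 2 * ((\<integral>\<^sup>+x. \<beta> (K (restrict x S)) \<partial>\<nu>) + 1) + 2 * ?m"
    by (simp add: nn_integral_add nn_integral_cmult emeasure_space_1)
  also have "\<dots> < \<infinity>" using bfin mom by (simp add: ennreal_mult_less_top)
  finally show ?thesis .
qed

text \<open>The factor \<open>1 + \<delta>\<close> is paid twice: once when the couplings with the
  conditional laws are discretised, once when the coupling of words is lifted back. The order of
  choice is \<delta>, then the discretisation error \<epsilon>, then \<open>T\<close>.\<close>

theorem tensorised_coupling:
  fixes \<mu> :: "'a::polish_space measure" and \<nu> :: "(nat \<Rightarrow> 'a) measure" and \<beta> :: "'a measure \<Rightarrow> ennreal"
  assumes mu: "\<mu> \<in> probs borel" and nu: "\<nu> \<in> probs (prodE {..<n})"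
    and S: "\<And>k. k < n \<Longrightarrow> {..<k} \<subseteq> S k" "\<And>k. k < n \<Longrightarrow> S k \<subseteq> {..<n}"
    and K: "\<And>k. k < n \<Longrightarrow> is_cond_law \<nu> (S k) k (K k)"
    and \<beta>: "\<beta> \<in> borel_measurable (prob_algebra borel)"
    and le: "\<And>p e. p \<in> probs borel \<Longrightarrow> \<beta> p < \<infinity> \<Longrightarrow> e > 0 \<Longrightarrow>
       \<exists>\<gamma>\<in>couplings \<mu> p. sq_cost \<gamma> \<le> \<beta> p + ennreal e"
    and bfin: "(\<Sum>k<n. \<integral>\<^sup>+x. \<beta> (K k (restrict x (S k))) \<partial>\<nu>) < \<infinity>"
    and mom: "sq_moment x0 \<mu> < \<infinity>" and e: "e > 0"
  shows "\<exists>\<gamma>\<in>couplings (pow_measure \<mu> n) \<nu>. (\<integral>\<^sup>+z. ennreal ((dist_n n (fst z) (snd z))\<^sup>2) \<partial>\<gamma>)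
     \<le> (\<Sum>k<n. \<integral>\<^sup>+x. \<beta> (K k (restrict x (S k))) \<partial>\<nu>) + ennreal e"
proof -
  have pm: "prob_space \<mu>" "sets \<mu> = sets borel" using mu by (auto simp: space_prob_algebra)
  have pn: "prob_space \<nu>" and sn: "sets \<nu> = sets (prodE {..<n})" using nu by (auto simp: space_prob_algebra)
  let ?M = "pow_measure \<mu> n"
  have M: "?M \<in> probs (prodE {..<n})" by (rule pow_measure_in_prob_algebra[OF mu])
  have pM: "prob_space ?M" using M by (simp add: space_prob_algebra)
  define I where "I k = (\<integral>\<^sup>+x. \<beta> (K k (restrict x (S k))) \<partial>\<nu>)" for k
  have Ifin: "I k < \<infinity>" if "k < n" for k
  proof -
    have "I k \<le> (\<Sum>k<n. I k)" by (rule member_le_sum) (use that in auto)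
    then show ?thesis using bfin unfolding I_def by (rule order_le_less_trans)
  qed
  define b where "b = enn2real (\<Sum>k<n. I k)"
  have b: "(\<Sum>k<n. I k) = ennreal b" "0 \<le> b" unfolding b_def using bfin by (auto simp: I_def)
  \<comment> \<open>For \<open>\<delta> \<le> 1\<close> one has
    \<open>(1 + \<delta>)\<^sup>2 * b \<le> (1 + 3 * \<delta>) * b\<close>, and the second bound
    gives \<open>3 * \<delta> * b \<le> e / 2\<close>. Writing \<open>b + 1\<close> avoids division
    by zero.\<close>
  define \<delta> where "\<delta> = min 1 (e / (6 * (b + 1)))"
  have d: "0 < \<delta>" "\<delta> \<le> 1" unfolding \<delta>_def using e b by auto
  have "\<delta> \<le> e / (6 * (b + 1))" unfolding \<delta>_def by simp
  then have db: "\<delta> * (6 * (b + 1)) \<le> e" using b by (subst (asm) pos_le_divide_eq) auto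
  define \<kappa> where "\<kappa> = 2 * (1 + 1 / \<delta>)"
  have k0: "0 < \<kappa>" unfolding \<kappa>_def using d by (simp add: add_pos_pos)
  \<comment> \<open>The errors sum to at most \<open>6 * n * \<kappa> * \<epsilon>\<close>: four
    parts from the discrete cost, doubled by \<open>1 + \<delta> \<le> 2\<close>, and two from
    lifting. They take the other half of \<open>e\<close>; the summand 1 keeps the denominator
    positive for \<open>n = 0\<close>.\<close>
  define \<epsilon> where "\<epsilon> = e / (2 * (6 * n * \<kappa> + 1))"
  have eps: "0 < \<epsilon>" unfolding \<epsilon>_def using e k0 by (intro divide_pos_pos mult_pos_pos add_nonneg_pos) auto
  have "\<epsilon> \<le> e / (2 * (6 * n * \<kappa> + 1))" unfolding \<epsilon>_def by simp
  then have "\<epsilon> * (2 * (6 * n * \<kappa> + 1)) \<le> e" using k0 by (subst (asm) pos_le_divide_eq) (auto intro: add_nonneg_pos)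
  then have epsb: "6 * n * \<kappa> * \<epsilon> \<le> e / 2" using eps by (simp add: algebra_simps)
  have cm[measurable]: "(\<lambda>x. x k) \<in> borel_measurable \<nu>" if "k < n" for k
    by (rule measurable_component_prob_algebra[OF nu]) (use that in simp)
  have cM[measurable]: "(\<lambda>x. x k) \<in> borel_measurable ?M" if "k < n" for k
    by (rule measurable_component_prob_algebra[OF M]) (use that in simp)
  define MM where "MM = insert \<mu> ((\<lambda>k. distr \<nu> borel (\<lambda>x. x k)) ` {..<n})"
  obtain T :: "'a \<Rightarrow> 'a" where T[measurable]: "T \<in> borel_measurable borel" and fin: "finite (range T)"
    and Tl: "\<And>M. M \<in> MM \<Longrightarrow> sq_err T M < ennreal \<epsilon>"
  proof (rule finite_range_approximation[of MM x0 "ennreal \<epsilon>"])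
    show "sq_moment x0 M < \<infinity>" if "M \<in> MM" for M
    proof (cases "M = \<mu>")
      case False
      then obtain k where k: "k < n" "M = distr \<nu> borel (\<lambda>x. x k)" using \<open>M \<in> MM\<close> by (auto simp: MM_def)
      show ?thesis unfolding k(2)
        by (rule second_moment_component[OF mu nu S(2)[OF k(1)] _ K[OF k(1)] \<beta> le _ mom]) (use k(1) Ifin[OF k(1)] in \<open>auto simp: I_def\<close>)
    qed (use mom in simp)
  qed (use pm eps in \<open>auto simp: MM_def\<close>)
  have mT: "sq_err T \<mu> < ennreal \<epsilon>" by (rule Tl) (simp add: MM_def)
  have nT: "(\<integral>\<^sup>+x. sqd (x k) (T (x k)) \<partial>\<nu>) < ennreal \<epsilon>" if "k < n" for k
    using Tl[of "distr \<nu> borel (\<lambda>x. x k)"] that by (simp add: MM_def nn_integral_distr[OF cm[OF that]])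
  have mT': "sq_err T \<mu> < \<infinity>" using mT by (rule order_less_trans) simp
  have nT': "(\<integral>\<^sup>+x. sqd (x k) (T (x k)) \<partial>\<nu>) < \<infinity>" if "k < n" for k
    using nT[OF that] by (rule order_less_trans) simp
  obtain r where r: "map_pmf (map fst) r = law ?M (word T n)" "map_pmf (map snd) r = law \<nu> (word T n)"
    "\<And>w. w \<in> set_pmf r \<Longrightarrow> length w = n"
    "(\<integral>\<^sup>+w. list_cost w \<partial>measure_pmf r) \<le> (\<Sum>k<n. ennreal (1 + \<delta>) * I k
        + (ennreal \<kappa> * sq_err T \<mu> + ennreal \<kappa> * (\<integral>\<^sup>+x. sqd (x k) (T (x k)) \<partial>\<nu>)))"
    using chain_coupling_discrete[OF mu nu S K \<beta> le Ifin[unfolded I_def] T fin d(1) mT' nT', folded I_def \<kappa>_def] by blast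
  define c where "c = \<kappa> * \<epsilon> + \<kappa> * \<epsilon>"
  have c0: "0 \<le> c" unfolding c_def using k0 eps by simp
  have c: "ennreal \<kappa> * ennreal \<epsilon> + ennreal \<kappa> * ennreal \<epsilon> = ennreal c"
    unfolding c_def using k0 by (subst ennreal_plus) (use k0 eps in \<open>auto simp: ennreal_mult'\<close>)
  have "(\<integral>\<^sup>+w. list_cost w \<partial>measure_pmf r) \<le> (\<Sum>k<n. ennreal (1 + \<delta>) * I k + (ennreal \<kappa> * ennreal \<epsilon> + ennreal \<kappa> * ennreal \<epsilon>))"
    by (rule order_trans[OF r(4)])
       (auto intro!: sum_mono add_mono mult_left_mono mT[THEN less_imp_le] nT[THEN less_imp_le])
  also have "\<dots> = ennreal (1 + \<delta>) * ennreal b + of_nat n * ennreal c"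
    unfolding c sum.distrib sum_distrib_left[symmetric] b(1) by simp
  also have "\<dots> = ennreal ((1 + \<delta>) * b) + ennreal (n * c)"
    unfolding ennreal_of_nat_eq_real_of_nat using d by (subst (1 2) ennreal_mult') auto
  also have "\<dots> = ennreal ((1 + \<delta>) * b + n * (\<kappa> * \<epsilon> + \<kappa> * \<epsilon>))"
    unfolding c_def[symmetric] using d b c0 by (intro ennreal_plus[symmetric]) auto
  finally have cr: "(\<integral>\<^sup>+w. list_cost w \<partial>measure_pmf r) \<le> ennreal ((1 + \<delta>) * b + n * (\<kappa> * \<epsilon> + \<kappa> * \<epsilon>))" .
  have sM: "simple_function ?M (word T n)" by (rule simple_function_word[OF T fin M]) simp
  have sN: "simple_function \<nu> (word T n)" by (rule simple_function_word[OF T fin nu]) simp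
  define r' where "r' = map_pmf (\<lambda>w. (map fst w, map snd w)) r"
  have r': "map_pmf fst r' = law ?M (word T n)" "map_pmf snd r' = law \<nu> (word T n)"
    unfolding r'_def by (simp_all add: pmf.map_comp comp_def r)
  have "\<exists>\<gamma>\<in>couplings ?M \<nu>. \<forall>f. (\<integral>\<^sup>+z. f (word T n (fst z), word T n (snd z)) \<partial>\<gamma>) = (\<integral>\<^sup>+z. f z \<partial>measure_pmf r')"
    by (rule lift_coupling[OF pM pn sM sN r']) blast
  then obtain \<gamma> where g: "\<gamma> \<in> couplings ?M \<nu>"
    and gr: "\<And>f. (\<integral>\<^sup>+z. f (word T n (fst z), word T n (snd z)) \<partial>\<gamma>) = (\<integral>\<^sup>+z. f z \<partial>measure_pmf r')"
    by blast
  have sg[measurable_cong]: "sets \<gamma> = sets (?M \<Otimes>\<^sub>M \<nu>)" using g by (simp add: couplings_def)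
  have [measurable]: "(\<lambda>z. fst z i) \<in> borel_measurable \<gamma>" if "i < n" for i
    by (rule measurable_compose[OF _ cM[OF that]]) (simp add: measurable_cong_sets[OF sg refl])
  have [measurable]: "(\<lambda>z. snd z i) \<in> borel_measurable \<gamma>" if "i < n" for i
    by (rule measurable_compose[OF _ cm[OF that]]) (simp add: measurable_cong_sets[OF sg refl])
  let ?A = "\<integral>\<^sup>+z. (\<Sum>i<n. sqd (T (fst z i)) (T (snd z i))) \<partial>\<gamma>"
  let ?B = "\<integral>\<^sup>+z. (\<Sum>i<n. sqd (fst z i) (T (fst z i))) \<partial>\<gamma>"
  let ?C = "\<integral>\<^sup>+z. (\<Sum>i<n. sqd (snd z i) (T (snd z i))) \<partial>\<gamma>"
  have "?A = (\<integral>\<^sup>+z. (\<Sum>i<n. sqd (fst z ! i) (snd z ! i)) \<partial>measure_pmf r')"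
    using gr[of "\<lambda>z. \<Sum>i<n. sqd (fst z ! i) (snd z ! i)"] by simp
  also have "\<dots> = (\<integral>\<^sup>+w. list_cost w \<partial>measure_pmf r)"
    unfolding r'_def nn_integral_map_pmf
    by (rule nn_integral_cong_AE) (auto simp: AE_measure_pmf_iff list_cost_eq_sum[OF r(3)])
  finally have A: "?A \<le> ennreal ((1 + \<delta>) * b + n * (\<kappa> * \<epsilon> + \<kappa> * \<epsilon>))" using cr by simp
  have "?B = (\<Sum>i<n. \<integral>\<^sup>+x. sqd (x i) (T (x i)) \<partial>?M)"
  proof -
    have "?B = (\<Sum>i<n. \<integral>\<^sup>+z. sqd (fst z i) (T (fst z i)) \<partial>\<gamma>)" by (rule nn_integral_sum) measurable
    also have "\<dots> = (\<Sum>i<n. \<integral>\<^sup>+x. sqd (x i) (T (x i)) \<partial>?M)"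
      by (intro sum.cong refl nn_integral_coupling_fst[OF g, where u="\<lambda>x. sqd (x _) (T (x _))"]) auto
    finally show ?thesis .
  qed
  also have "\<dots> = (\<Sum>i<n. \<integral>\<^sup>+x. sqd x (T x) \<partial>\<mu>)"
    by (intro sum.cong refl nn_integral_pow_measure_component[OF pm, where g="\<lambda>x. sqd x (T x)"]) auto
  also have "\<dots> \<le> (\<Sum>i<n. ennreal \<epsilon>)" by (intro sum_mono less_imp_le mT)
  finally have B: "?B \<le> ennreal (n * \<epsilon>)" using eps by (simp add: ennreal_mult' ennreal_of_nat_eq_real_of_nat)
  have "?C = (\<Sum>i<n. \<integral>\<^sup>+x. sqd (x i) (T (x i)) \<partial>\<nu>)"
  proof -
    have "?C = (\<Sum>i<n. \<integral>\<^sup>+z. sqd (snd z i) (T (snd z i)) \<partial>\<gamma>)" by (rule nn_integral_sum) measurable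
    also have "\<dots> = (\<Sum>i<n. \<integral>\<^sup>+x. sqd (x i) (T (x i)) \<partial>\<nu>)"
      by (intro sum.cong refl nn_integral_coupling_snd[OF g, where u="\<lambda>x. sqd (x _) (T (x _))"]) auto
    finally show ?thesis .
  qed
  also have "\<dots> \<le> (\<Sum>i<n. ennreal \<epsilon>)" by (intro sum_mono less_imp_le nT) simp
  finally have C: "?C \<le> ennreal (n * \<epsilon>)" using eps by (simp add: ennreal_mult' ennreal_of_nat_eq_real_of_nat)
  have "(\<integral>\<^sup>+z. ennreal ((dist_n n (fst z) (snd z))\<^sup>2) \<partial>\<gamma>)
    \<le> (\<integral>\<^sup>+z. ennreal (1 + \<delta>) * (\<Sum>i<n. sqd (T (fst z i)) (T (snd z i)))
        + (ennreal \<kappa> * (\<Sum>i<n. sqd (fst z i) (T (fst z i))) + ennreal \<kappa> * (\<Sum>i<n. sqd (snd z i) (T (snd z i)))) \<partial>\<gamma>)"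
    unfolding ennreal_dist_n_power2 sum_distrib_left sum.distrib[symmetric] \<kappa>_def
    by (intro nn_integral_mono sum_mono ennreal_dist_power2_le d)
  also have "\<dots> = ennreal (1 + \<delta>) * ?A + (ennreal \<kappa> * ?B + ennreal \<kappa> * ?C)"
    by (simp add: nn_integral_add nn_integral_cmult)
  also have "\<dots> \<le> ennreal (1 + \<delta>) * ennreal ((1 + \<delta>) * b + n * (\<kappa> * \<epsilon> + \<kappa> * \<epsilon>)) + (ennreal \<kappa> * ennreal (n * \<epsilon>) + ennreal \<kappa> * ennreal (n * \<epsilon>))"
    by (intro add_mono mult_left_mono A B C) auto
  also have "\<dots> = ennreal ((1 + \<delta>) * ((1 + \<delta>) * b + n * (\<kappa> * \<epsilon> + \<kappa> * \<epsilon>)) + (\<kappa> * (n * \<epsilon>) + \<kappa> * (n * \<epsilon>)))"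
    by (rule ennreal_weighted_sum3) (use d k0 eps b in auto)
  also have "\<dots> \<le> ennreal (b + e)"
  proof (rule ennreal_leI)
    have "(1 + \<delta>) * (1 + \<delta>) * b \<le> (1 + 3 * \<delta>) * b"
      using d b by (intro mult_right_mono) (auto simp: algebra_simps)
    moreover have "(1 + \<delta>) * (n * (\<kappa> * \<epsilon> + \<kappa> * \<epsilon>)) \<le> 2 * (n * (\<kappa> * \<epsilon> + \<kappa> * \<epsilon>))"
      using d k0 eps by (intro mult_right_mono) auto
    moreover have "3 * \<delta> * b \<le> e / 2" using db d by (simp add: algebra_simps)
    ultimately show "(1 + \<delta>) * ((1 + \<delta>) * b + n * (\<kappa> * \<epsilon> + \<kappa> * \<epsilon>)) + (\<kappa> * (n * \<epsilon>) + \<kappa> * (n * \<epsilon>)) \<le> b + e"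
      using epsb by (simp add: algebra_simps)
  qed
  also have "\<dots> = (\<Sum>k<n. I k) + ennreal e" unfolding b(1) using b(2) e by simp
  finally show ?thesis using g unfolding I_def by blast
qed

section \<open>The equivalences\<close>

lemma enn_powr_one: "enn_powr x 1 = x"
  by (cases x) (auto simp: enn_powr_def)

lemma enn_powr_half_power2: "(enn_powr x (1 / 2))\<^sup>2 = x"
  by (cases x) (auto simp: enn_powr_def powr_half_sqrt ennreal_power power2_eq_square ennreal_mult_top
    simp flip: ennreal_mult)

definition coupling_cost2 :: "'a::metric_space measure \<Rightarrow> 'a measure \<Rightarrow> ennreal" where
  "coupling_cost2 M N = (INF \<pi>\<in>couplings M N. \<integral>\<^sup>+z. sqd (fst z) (snd z) \<partial>\<pi>)"

lemma wasserstein_2_power2: "(wasserstein 2 dist M N)\<^sup>2 = coupling_cost2 M N"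
  unfolding wasserstein_def enn_powr_half_power2 coupling_cost2_def by simp

lemma wasserstein_1_dist_n:
  "wasserstein 1 (dist_n n) M N = (INF \<pi>\<in>couplings M N. \<integral>\<^sup>+z. ennreal (dist_n n (fst z) (snd z)) \<partial>\<pi>)"
  unfolding wasserstein_def by (simp add: enn_powr_one dist_n_nonneg)

lemma enn2ereal_ennreal_mult: "0 \<le> C \<Longrightarrow> enn2ereal (ennreal C * x) = ereal C * enn2ereal x"
  by (simp add: times_ennreal.rep_eq)

lemma eintegral_nonneg:
  assumes "\<And>x. x \<in> space M \<Longrightarrow> f x = enn2ereal (g x)"
  shows "eintegral M f = enn2ereal (\<integral>\<^sup>+x. g x \<partial>M)"
proof -
  have "(\<integral>\<^sup>+x. e2ennreal (f x) \<partial>M) = (\<integral>\<^sup>+x. g x \<partial>M)"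
    by (rule nn_integral_cong) (simp add: assms)
  moreover have "(\<integral>\<^sup>+x. e2ennreal (- f x) \<partial>M) = (\<integral>\<^sup>+x. 0 \<partial>M)"
    by (rule nn_integral_cong) (simp add: assms e2ennreal_neg)
  ultimately show ?thesis by (simp add: eintegral_def zero_ennreal.rep_eq)
qed

lemma eintegral_AE_const:
  assumes M: "prob_space M" and f: "AE x in M. f x = ereal c"
  shows "eintegral M f = ereal c"
proof -
  have "(\<integral>\<^sup>+x. e2ennreal (f x) \<partial>M) = (\<integral>\<^sup>+x. ennreal c \<partial>M)"
    by (rule nn_integral_cong_AE) (use f in eventually_elim, simp)
  moreover have "(\<integral>\<^sup>+x. e2ennreal (- f x) \<partial>M) = (\<integral>\<^sup>+x. ennreal (- c) \<partial>M)"
    by (rule nn_integral_cong_AE) (use f in eventually_elim, simp)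
  ultimately show ?thesis using prob_space.emeasure_space_1[OF M]
    by (cases "c \<ge> 0") (simp_all add: eintegral_def ennreal_neg zero_ennreal.rep_eq)
qed

text \<open>Common form of the two functionals, with \<open>S n k\<close> the coordinates
  conditioned on. For \<open>k = 0\<close> the sequential choice conditions on no coordinate, so the
  first marginal needs no separate clause.\<close>

definition alpha_along :: "('a::topological_space measure \<Rightarrow> ereal) \<Rightarrow> (nat \<Rightarrow> nat \<Rightarrow> nat set) \<Rightarrow> nat \<Rightarrow> (nat \<Rightarrow> 'a) measure \<Rightarrow> ereal" where
  "alpha_along \<alpha> S n \<nu> = eintegral \<nu> (\<lambda>x. \<Sum>k<n. \<alpha> (cond_law \<nu> (S n k) k (restrict x (S n k))))"

lemma alpha_n_eq_along: "alpha_n \<alpha> = alpha_along \<alpha> (\<lambda>n k. {..<n} - {k})"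
  by (intro ext) (simp add: alpha_n_def alpha_along_def)

lemma alpha_hat_n_eq_along: "alpha_hat_n \<alpha> = alpha_along \<alpha> (\<lambda>n k. {..<k})"
  by (intro ext) (simp add: alpha_hat_n_def alpha_along_def)

lemma wasserstein_1_le_if_transport:
  fixes \<mu> :: "'a::polish_space measure" and \<alpha> :: "'a measure \<Rightarrow> ereal"
  assumes meas[measurable]: "\<alpha> \<in> borel_measurable (prob_algebra borel)" and C: "C > 0"
    and mu: "\<mu> \<in> probs borel" and mom: "sq_moment x0 \<mu> < \<infinity>"
    and S: "\<And>k. k < n \<Longrightarrow> {..<k} \<subseteq> S n k" "\<And>k. k < n \<Longrightarrow> S n k \<subseteq> {..<n}"
    and transport: "\<And>p. p \<in> probs borel \<Longrightarrow> enn2ereal ((wasserstein 2 dist \<mu> p)\<^sup>2) \<le> ereal C * \<alpha> p"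
    and nu: "\<nu> \<in> probs (prodE {..<n})"
  shows "enn2ereal ((wasserstein 1 (dist_n n) (pow_measure \<mu> n) \<nu>)\<^sup>2) \<le> ereal C * alpha_along \<alpha> S n \<nu>"
proof -
  define a where "a p = e2ennreal (\<alpha> p)" for p
  have am[measurable]: "a \<in> borel_measurable (prob_algebra borel)" unfolding a_def by measurable
  \<comment> \<open>Nonnegativity of \<alpha> is a consequence: a negative value would lie above a
    squared distance after multiplication by \<open>C\<close>. From here on \<alpha> can be handled
    as an \<open>ennreal\<close>-valued function.\<close>
  have \<alpha>0: "0 \<le> \<alpha> p" if "p \<in> probs borel" for p
  proof (rule ccontr)
    assume "\<not> 0 \<le> \<alpha> p"
    then have "ereal C * \<alpha> p < 0" using C by (cases "\<alpha> p") (auto simp: mult_pos_neg)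
    then show False using transport[OF that] enn2ereal_nonneg by (meson not_le order_trans)
  qed
  have a: "\<alpha> p = enn2ereal (a p)" if "p \<in> probs borel" for p
    unfolding a_def using \<alpha>0[OF that] by (simp add: enn2ereal_e2ennreal)
  define \<beta> where "\<beta> p = ennreal C * a p" for p
  have \<beta>m: "\<beta> \<in> borel_measurable (prob_algebra borel)" unfolding \<beta>_def by measurable
  have le: "\<exists>\<gamma>\<in>couplings \<mu> p. sq_cost \<gamma> \<le> \<beta> p + ennreal e"
    if p: "p \<in> probs borel" "\<beta> p < \<infinity>" "e > 0" for p and e :: real
  proof -
    have "enn2ereal (coupling_cost2 \<mu> p) \<le> enn2ereal (\<beta> p)"
      using transport[OF p(1)] C unfolding wasserstein_2_power2 a[OF p(1)] \<beta>_def by (simp add: enn2ereal_ennreal_mult)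
    then have "coupling_cost2 \<mu> p \<le> \<beta> p" by (simp add: less_eq_ennreal.rep_eq)
    also have "\<beta> p < \<beta> p + ennreal e" using p(2,3) by (cases "\<beta> p") (auto simp flip: ennreal_plus simp: ennreal_less_iff)
    finally show ?thesis unfolding coupling_cost2_def INF_less_iff by (auto intro: less_imp_le)
  qed
  define K where "K k = cond_law \<nu> (S n k) k" for k
  have K: "is_cond_law \<nu> (S n k) k (K k)" if "k < n" for k
    unfolding K_def by (rule is_cond_law_cond_law[OF nu S(2)[OF that]]) (use that in simp)
  have kern: "(\<lambda>x. K k (restrict x (S n k))) \<in> \<nu> \<rightarrow>\<^sub>M prob_algebra borel" if "k < n" for k
    by (rule measurable_cond_kernel[OF nu S(2)[OF that] K[OF that]])
  have "alpha_along \<alpha> S n \<nu> = enn2ereal (\<integral>\<^sup>+x. (\<Sum>k<n. a (K k (restrict x (S n k)))) \<partial>\<nu>)"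
    unfolding alpha_along_def K_def[symmetric]
  proof (rule eintegral_nonneg)
    fix x assume "x \<in> space \<nu>"
    then have "(\<Sum>k<n. \<alpha> (K k (restrict x (S n k)))) = (\<Sum>k<n. enn2ereal (a (K k (restrict x (S n k)))))"
      by (intro sum.cong refl a measurable_space[OF kern]) auto
    then show "(\<Sum>k<n. \<alpha> (K k (restrict x (S n k)))) = enn2ereal (\<Sum>k<n. a (K k (restrict x (S n k))))"
      by simp
  qed
  also have "(\<integral>\<^sup>+x. (\<Sum>k<n. a (K k (restrict x (S n k)))) \<partial>\<nu>) = (\<Sum>k<n. \<integral>\<^sup>+x. a (K k (restrict x (S n k))) \<partial>\<nu>)"
    by (rule nn_integral_sum) (rule measurable_compose[OF kern am], simp)
  finally have "ereal C * alpha_along \<alpha> S n \<nu> = enn2ereal (ennreal C * (\<Sum>k<n. \<integral>\<^sup>+x. a (K k (restrict x (S n k))) \<partial>\<nu>))"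
    using C by (simp add: enn2ereal_ennreal_mult)
  also have "ennreal C * (\<Sum>k<n. \<integral>\<^sup>+x. a (K k (restrict x (S n k))) \<partial>\<nu>) = (\<Sum>k<n. \<integral>\<^sup>+x. \<beta> (K k (restrict x (S n k))) \<partial>\<nu>)"
    unfolding sum_distrib_left \<beta>_def
    by (intro sum.cong refl nn_integral_cmult[symmetric] measurable_compose[OF kern am]) auto
  finally have eq: "ereal C * alpha_along \<alpha> S n \<nu> = enn2ereal (\<Sum>k<n. \<integral>\<^sup>+x. \<beta> (K k (restrict x (S n k))) \<partial>\<nu>)" .
  let ?M = "pow_measure \<mu> n"
  have "(wasserstein 1 (dist_n n) ?M \<nu>)\<^sup>2 \<le> (\<Sum>k<n. \<integral>\<^sup>+x. \<beta> (K k (restrict x (S n k))) \<partial>\<nu>)"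
  proof (rule ennreal_le_epsilon)
    fix e :: real assume fin: "(\<Sum>k<n. \<integral>\<^sup>+x. \<beta> (K k (restrict x (S n k))) \<partial>\<nu>) < \<top>" and e: "0 < e"
    obtain \<gamma> where g: "\<gamma> \<in> couplings ?M \<nu>" "(\<integral>\<^sup>+z. ennreal ((dist_n n (fst z) (snd z))\<^sup>2) \<partial>\<gamma>)
       \<le> (\<Sum>k<n. \<integral>\<^sup>+x. \<beta> (K k (restrict x (S n k))) \<partial>\<nu>) + ennreal e"
      using tensorised_coupling[of \<mu> \<nu> n "S n" K \<beta> x0 e, OF mu nu S K \<beta>m le _ mom e] fin by auto
    have sg: "sets \<gamma> = sets (?M \<Otimes>\<^sub>M \<nu>)" using g(1) by (simp add: couplings_def)
    have f1: "fst \<in> \<gamma> \<rightarrow>\<^sub>M ?M" unfolding measurable_cong_sets[OF sg refl] by (rule measurable_fst)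
    have f2: "snd \<in> \<gamma> \<rightarrow>\<^sub>M \<nu>" unfolding measurable_cong_sets[OF sg refl] by (rule measurable_snd)
    have M: "?M \<in> probs (prodE {..<n})" by (rule pow_measure_in_prob_algebra[OF mu])
    have [measurable]: "(\<lambda>z. fst z i) \<in> borel_measurable \<gamma>" "(\<lambda>z. snd z i) \<in> borel_measurable \<gamma>" if "i < n" for i
      by (rule measurable_compose[OF f1 measurable_component_prob_algebra[OF M]], use that in simp,
          rule measurable_compose[OF f2 measurable_component_prob_algebra[OF nu]], use that in simp)
    have "prob_space (distr \<gamma> ?M fst)" using g(1) M by (simp add: couplings_def space_prob_algebra)
    then interpret G: prob_space \<gamma> by (rule prob_space_distrD[OF f1])
    have "(wasserstein 1 (dist_n n) ?M \<nu>)\<^sup>2 \<le> (\<integral>\<^sup>+z. ennreal (dist_n n (fst z) (snd z)) \<partial>\<gamma>)\<^sup>2"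
      unfolding wasserstein_1_dist_n by (intro power_mono INF_lower g(1)) simp
    also have "\<dots> \<le> (\<integral>\<^sup>+z. (ennreal (dist_n n (fst z) (snd z)))\<^sup>2 \<partial>\<gamma>)"
      by (rule G.nn_integral_power2_le) (unfold dist_n_def, measurable)
    also have "\<dots> = (\<integral>\<^sup>+z. ennreal ((dist_n n (fst z) (snd z))\<^sup>2) \<partial>\<gamma>)"
      by (simp add: ennreal_power dist_n_nonneg)
    finally show "(wasserstein 1 (dist_n n) ?M \<nu>)\<^sup>2 \<le> (\<Sum>k<n. \<integral>\<^sup>+x. \<beta> (K k (restrict x (S n k))) \<partial>\<nu>) + ennreal e"
      using g(2) by (rule order_trans)
  qed
  then show ?thesis unfolding eq by (simp add: less_eq_ennreal.rep_eq)
qed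

text \<open>The easy half of Kantorovich-Rubinstein duality: integrate the Lipschitz bound against
  an arbitrary coupling.\<close>

lemma abs_integral_diff_le_wasserstein_1:
  assumes M: "M \<in> probs (prodE {..<n})" and N: "N \<in> probs (prodE {..<n})" and f: "bdd_lip1 n f"
  shows "ennreal \<bar>(\<integral>x. f x \<partial>N) - (\<integral>x. f x \<partial>M)\<bar> \<le> wasserstein 1 (dist_n n) M N"
  unfolding wasserstein_1_dist_n
proof (rule INF_greatest)
  fix \<gamma> assume g: "\<gamma> \<in> couplings M N"
  have sM: "sets M = sets (prodE {..<n})" and sN: "sets N = sets (prodE {..<n})" using M N by (auto simp: space_prob_algebra)
  have sg: "sets \<gamma> = sets (M \<Otimes>\<^sub>M N)" and d: "distr \<gamma> M fst = M" "distr \<gamma> N snd = N" using g by (auto simp: couplings_def)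
  have f1: "fst \<in> \<gamma> \<rightarrow>\<^sub>M M" unfolding measurable_cong_sets[OF sg refl] by (rule measurable_fst)
  have f2: "snd \<in> \<gamma> \<rightarrow>\<^sub>M N" unfolding measurable_cong_sets[OF sg refl] by (rule measurable_snd)
  have fM: "integrable M f" and fN: "integrable N f" by (rule integrable_bdd_lip1[OF f M], rule integrable_bdd_lip1[OF f N])
  have i1: "integrable \<gamma> (\<lambda>z. f (fst z))" using integrable_distr[OF f1, of f] fM d by simp
  have i2: "integrable \<gamma> (\<lambda>z. f (snd z))" using integrable_distr[OF f2, of f] fN d by simp
  have e1: "(\<integral>x. f x \<partial>M) = (\<integral>z. f (fst z) \<partial>\<gamma>)"
    using integral_distr[OF f1 borel_measurable_integrable[OF fM]] d by simp
  have e2: "(\<integral>x. f x \<partial>N) = (\<integral>z. f (snd z) \<partial>\<gamma>)"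
    using integral_distr[OF f2 borel_measurable_integrable[OF fN]] d by simp
  have "ennreal \<bar>(\<integral>x. f x \<partial>N) - (\<integral>x. f x \<partial>M)\<bar> = ennreal \<bar>\<integral>z. f (snd z) - f (fst z) \<partial>\<gamma>\<bar>"
    unfolding e1 e2 using i1 i2 by simp
  also have "\<dots> \<le> (\<integral>\<^sup>+z. ennreal \<bar>f (snd z) - f (fst z)\<bar> \<partial>\<gamma>)"
    using integral_norm_bound_ennreal[of \<gamma> "\<lambda>z. f (snd z) - f (fst z)"] i1 i2 by simp
  also have "\<dots> \<le> (\<integral>\<^sup>+z. ennreal (dist_n n (fst z) (snd z)) \<partial>\<gamma>)"
  proof (intro nn_integral_mono ennreal_leI)
    fix z assume "z \<in> space \<gamma>"
    then have "fst z \<in> space (prodE {..<n})" "snd z \<in> space (prodE {..<n})"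
      using measurable_space[OF f1] measurable_space[OF f2] sets_eq_imp_space_eq[OF sM] sets_eq_imp_space_eq[OF sN] by auto
    then show "\<bar>f (snd z) - f (fst z)\<bar> \<le> dist_n n (fst z) (snd z)"
      using f by (metis abs_minus_commute bdd_lip1_def)
  qed
  finally show "ennreal \<bar>(\<integral>x. f x \<partial>N) - (\<integral>x. f x \<partial>M)\<bar> \<le> (\<integral>\<^sup>+z. ennreal (dist_n n (fst z) (snd z)) \<partial>\<gamma>)" .
qed

lemma rho_bound_if_wasserstein_1:
  assumes M: "M \<in> probs (prodE {..<n})" and N: "N \<in> probs (prodE {..<n})" and f: "bdd_lip1 n f"
    and C: "C > 0" and W: "enn2ereal ((wasserstein 1 (dist_n n) M N)\<^sup>2) \<le> ereal C * A"
  shows "ereal (\<integral>x. lam * f x \<partial>N) - A \<le> ereal (lam * (\<integral>x. f x \<partial>M) + C * lam\<^sup>2 / 4)"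
proof (cases A)
  case (real a)
  define \<Delta> where "\<Delta> = (\<integral>x. f x \<partial>N) - (\<integral>x. f x \<partial>M)"
  have "ennreal (\<Delta>\<^sup>2) = (ennreal \<bar>\<Delta>\<bar>)\<^sup>2" by (simp add: ennreal_power)
  also have "\<dots> \<le> (wasserstein 1 (dist_n n) M N)\<^sup>2"
    unfolding \<Delta>_def by (intro power_mono abs_integral_diff_le_wasserstein_1[OF M N f]) simp
  finally have "enn2ereal (ennreal (\<Delta>\<^sup>2)) \<le> enn2ereal ((wasserstein 1 (dist_n n) M N)\<^sup>2)" by (simp add: less_eq_ennreal.rep_eq)
  then have "ereal (\<Delta>\<^sup>2) \<le> ereal C * A" using W by (metis enn2ereal_ennreal order_trans zero_le_power2)
  then have \<Delta>: "\<Delta>\<^sup>2 \<le> C * a" using real by simp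
  \<comment> \<open>Completing the square: this is \<open>C\<close> times the inequality \<open>lam
    * \<Delta> \<le> \<Delta>\<^sup>2 / C + C * lam\<^sup>2 / 4\<close>, the origin of the factor
    1/4.\<close>
  have "0 \<le> (C * lam / 2 - \<Delta>)\<^sup>2" by simp
  also have "\<dots> = C * (C * lam\<^sup>2 / 4 - lam * \<Delta>) + \<Delta>\<^sup>2" by (simp add: power2_eq_square algebra_simps)
  finally have "0 \<le> C * (C * lam\<^sup>2 / 4 - lam * \<Delta> + a)" using \<Delta> by (simp add: algebra_simps)
  then have "0 \<le> C * lam\<^sup>2 / 4 - lam * \<Delta> + a" using C by (simp add: zero_le_mult_iff)
  then show ?thesis using real by (simp add: \<Delta>_def algebra_simps)
next
  \<comment> \<open>Excluded, since a squared distance cannot lie below minus infinity; for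
    \<open>A\<close> equal to plus infinity the claim is trivial.\<close>
  case MInf
  have e: "ereal C * A = - \<infinity>" using C MInf by simp
  have "enn2ereal ((wasserstein 1 (dist_n n) M N)\<^sup>2) \<le> - \<infinity>" using W unfolding e .
  then show ?thesis using enn2ereal_nonneg[of "(wasserstein 1 (dist_n n) M N)\<^sup>2"] by auto
qed simp

text \<open>The chosen versions of the conditional laws agree with \<nu> only almost everywhere, but
  there are finitely many of them. The linear growth in \<open>n\<close> is what later matches the
  scale \<open>sqrt n\<close> of distances.\<close>

lemma alpha_along_pow_measure:
  fixes \<nu> :: "'a::polish_space measure"
  assumes nu: "\<nu> \<in> probs borel" and S: "\<And>k. k < n \<Longrightarrow> S n k \<subseteq> {..<n} - {k}" and a: "\<alpha> \<nu> = ereal a"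
  shows "alpha_along \<alpha> S n (pow_measure \<nu> n) = ereal (n * a)"
  unfolding alpha_along_def
proof (rule eintegral_AE_const)
  let ?P = "pow_measure \<nu> n"
  have P: "?P \<in> probs (prodE {..<n})" by (rule pow_measure_in_prob_algebra[OF nu])
  then show "prob_space ?P" by (simp add: space_prob_algebra)
  have "AE x in ?P. \<forall>k\<in>{..<n}. cond_law ?P (S n k) k (restrict x (S n k)) = \<nu>"
  proof (rule AE_finite_allI)
    fix k assume "k \<in> {..<n}"
    then have k: "k < n" "S n k \<subseteq> {..<n}" "k \<notin> S n k" "k \<in> {..<n}" using S by auto
    show "AE x in ?P. cond_law ?P (S n k) k (restrict x (S n k)) = \<nu>"
      by (rule is_cond_law_unique_AE[OF P k(2) is_cond_law_cond_law[OF P k(2,4)] is_cond_law_pow_measure[OF nu k(2,1,3)]])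
  qed simp
  then show "AE x in ?P. (\<Sum>k<n. \<alpha> (cond_law ?P (S n k) k (restrict x (S n k)))) = ereal (n * a)"
  proof eventually_elim
    case (elim x)
    then have "(\<Sum>k<n. \<alpha> (cond_law ?P (S n k) k (restrict x (S n k)))) = (\<Sum>k<n. ereal a)"
      by (intro sum.cong) (auto simp: a)
    then show ?case by simp
  qed
qed

text \<open>Only product measures are inserted into the supremum. On them the functional equals
  \<open>n * a\<close>, and optimising over \<open>lam\<close> yields the concentration hypothesis
  of \<open>transport_le_if_concentration\<close> with \<open>c = sqrt (C * a)\<close>.\<close>

lemma transport_if_rho_bound:
  fixes \<mu> :: "'a::polish_space measure" and \<alpha> :: "'a measure \<Rightarrow> ereal"
  assumes C: "C > 0" and mu: "\<mu> \<in> probs borel" and mom: "sq_moment x0 \<mu> < \<infinity>"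
    and S: "\<And>n k. k < n \<Longrightarrow> S n k \<subseteq> {..<n} - {k}"
    and rho: "\<And>n lam f. n \<ge> 1 \<Longrightarrow> bdd_lip1 n f \<Longrightarrow>
       (SUP \<nu>\<in>probs (prodE {..<n}). ereal (\<integral>x. lam * f x \<partial>\<nu>) - alpha_along \<alpha> S n \<nu>)
         \<le> ereal (lam * (\<integral>x. f x \<partial>pow_measure \<mu> n) + C * lam\<^sup>2 / 4)"
    and nu: "\<nu> \<in> probs borel" and bdd: "\<alpha> \<nu> \<noteq> - \<infinity>"
  shows "enn2ereal ((wasserstein 2 dist \<mu> \<nu>)\<^sup>2) \<le> ereal C * \<alpha> \<nu>"
proof (cases "\<alpha> \<nu>")
  case (real a)
  have key: "lam * (\<integral>x. f x \<partial>pow_measure \<nu> n) - n * a \<le> lam * (\<integral>x. f x \<partial>pow_measure \<mu> n) + C * lam\<^sup>2 / 4"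
    if "n \<ge> 1" "bdd_lip1 n f" for n lam and f :: "(nat \<Rightarrow> 'a) \<Rightarrow> real"
  proof -
    have "ereal (\<integral>x. lam * f x \<partial>pow_measure \<nu> n) - alpha_along \<alpha> S n (pow_measure \<nu> n)
      \<le> ereal (lam * (\<integral>x. f x \<partial>pow_measure \<mu> n) + C * lam\<^sup>2 / 4)"
      using rho[OF that, of lam] pow_measure_in_prob_algebra[OF nu, of n] unfolding SUP_le_iff by blast
    then show ?thesis by (simp add: alpha_along_pow_measure[of \<nu> n S \<alpha> a, OF nu S real])
  qed
  \<comment> \<open>The zero function with \<open>lam = 0\<close> and \<open>n = 1\<close> shows
    \<open>0 \<le> a\<close>, so the square root defining \<open>c\<close> is meaningful.\<close>
  have "bdd_lip1 1 (\<lambda>x::nat \<Rightarrow> 'a. 0)" unfolding bdd_lip1_def by (auto simp: dist_n_nonneg intro: boundedI[where B=0])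
  from key[OF _ this, of 0] have a0: "0 \<le> a" by simp
  define c where "c = sqrt (C * a)"
  have c0: "0 \<le> c" and c2: "c\<^sup>2 = C * a" unfolding c_def using C a0 by auto
  have conc: "(\<integral>x. f x \<partial>pow_measure \<nu> n) - (\<integral>x. f x \<partial>pow_measure \<mu> n) \<le> sqrt n * c"
    if "n \<ge> 1" "bdd_lip1 n f" for n and f :: "(nat \<Rightarrow> 'a) \<Rightarrow> real"
  proof -
    define \<Delta> where "\<Delta> = (\<integral>x. f x \<partial>pow_measure \<nu> n) - (\<integral>x. f x \<partial>pow_measure \<mu> n)"
    have "lam * \<Delta> - n * a \<le> C * lam\<^sup>2 / 4" for lam
      using key[OF that, of lam] unfolding \<Delta>_def by (simp add: right_diff_distrib)
    \<comment> \<open>The value \<open>2 * \<Delta> / C\<close> maximises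
      \<open>lam * \<Delta> - C * lam\<^sup>2 / 4\<close>, the maximum being
      \<open>\<Delta>\<^sup>2 / C\<close>.\<close>
    from this[of "2 * \<Delta> / C"] have "2 * \<Delta> / C * \<Delta> - n * a \<le> C * (2 * \<Delta> / C)\<^sup>2 / 4" .
    then have "\<Delta>\<^sup>2 / C \<le> n * a" using C by (simp add: power2_eq_square field_simps)
    then have "\<Delta>\<^sup>2 \<le> n * (C * a)" using C by (simp add: pos_divide_le_eq mult_ac)
    then have "\<Delta> \<le> sqrt (n * (C * a))" by (rule real_le_rsqrt)
    then show ?thesis unfolding \<Delta>_def c_def by (simp add: real_sqrt_mult)
  qed
  have "coupling_cost2 \<mu> \<nu> \<le> ennreal (C * a)"
  proof (rule ennreal_le_epsilon)
    fix e :: real assume e: "0 < e"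
    obtain \<gamma> where "\<gamma> \<in> couplings \<mu> \<nu>" "sq_cost \<gamma> \<le> ennreal (c\<^sup>2 + e)"
      using transport_le_if_concentration[OF mu nu mom c0 e conc] by blast
    then have "coupling_cost2 \<mu> \<nu> \<le> ennreal (c\<^sup>2 + e)" unfolding coupling_cost2_def by (rule INF_lower2)
    then show "coupling_cost2 \<mu> \<nu> \<le> ennreal (C * a) + ennreal e" using C a0 e by (simp add: c2)
  qed
  then have "enn2ereal (coupling_cost2 \<mu> \<nu>) \<le> enn2ereal (ennreal (C * a))" by (simp add: less_eq_ennreal.rep_eq)
  then show ?thesis using C a0 real by (simp add: wasserstein_2_power2)
qed (use C bdd in auto)

text \<open>The implications form a cycle for every admissible \<open>S\<close>. The lower bound on
  \<alpha> enters in the last of them, where it excludes the value minus infinity.\<close>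

lemma transport_equivalences:
  fixes \<mu> :: "'a::polish_space measure" and \<alpha> :: "'a measure \<Rightarrow> ereal"
  assumes meas: "\<alpha> \<in> borel_measurable (prob_algebra borel)"
    and bdd_below: "\<exists>b::real. \<forall>\<nu> \<in> probs borel. ereal b \<le> \<alpha> \<nu>"
    and mu: "\<mu> \<in> probs borel"
    and moment: "\<exists>x0. sq_moment x0 \<mu> < \<infinity>" and C: "C > 0"
    and S: "\<And>n k. k < n \<Longrightarrow> {..<k} \<subseteq> S n k" "\<And>n k. k < n \<Longrightarrow> S n k \<subseteq> {..<n} - {k}"
  defines "T2 \<equiv> \<forall>\<nu> \<in> probs borel. enn2ereal ((wasserstein 2 dist \<mu> \<nu>)\<^sup>2) \<le> ereal C * \<alpha> \<nu>"
  shows "T2 \<longleftrightarrow> (\<forall>n\<ge>1. \<forall>\<nu> \<in> probs (prodE {..<n}).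
        enn2ereal ((wasserstein 1 (dist_n n) (pow_measure \<mu> n) \<nu>)\<^sup>2) \<le> ereal C * alpha_along \<alpha> S n \<nu>)" (is "_ \<longleftrightarrow> ?W")
    and "T2 \<longleftrightarrow> (\<forall>n\<ge>1. \<forall>lam::real. \<forall>f. bdd_lip1 n f \<longrightarrow>
        (SUP \<nu>\<in>probs (prodE {..<n}). ereal (\<integral>x. lam * f x \<partial>\<nu>) - alpha_along \<alpha> S n \<nu>)
          \<le> ereal (lam * (\<integral>x. f x \<partial>pow_measure \<mu> n) + C * lam\<^sup>2 / 4))" (is "_ \<longleftrightarrow> ?R")
proof -
  obtain x0 where mom: "sq_moment x0 \<mu> < \<infinity>" using moment by blast
  have 12: ?W if T2
  proof (intro allI impI ballI)
    fix n :: nat and \<nu> :: "(nat \<Rightarrow> 'a) measure" assume nu: "\<nu> \<in> probs (prodE {..<n})"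
    have S': "\<And>k. k < n \<Longrightarrow> S n k \<subseteq> {..<n}" using S(2) by blast
    show "enn2ereal ((wasserstein 1 (dist_n n) (pow_measure \<mu> n) \<nu>)\<^sup>2) \<le> ereal C * alpha_along \<alpha> S n \<nu>"
      by (rule wasserstein_1_le_if_transport[where n=n and S=S, OF meas C mu mom S(1) S' _ nu]) (use that in \<open>auto simp: T2_def\<close>)
  qed
  have 23: ?R if ?W
  proof (intro allI impI SUP_least)
    fix n :: nat and lam :: real and f :: "(nat \<Rightarrow> 'a) \<Rightarrow> real" and \<nu> :: "(nat \<Rightarrow> 'a) measure"
    assume n: "1 \<le> n" and f: "bdd_lip1 n f"
      and nu: "\<nu> \<in> probs (prodE {..<n})"
    show "ereal (\<integral>x. lam * f x \<partial>\<nu>) - alpha_along \<alpha> S n \<nu> \<le> ereal (lam * (\<integral>x. f x \<partial>pow_measure \<mu> n) + C * lam\<^sup>2 / 4)"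
      by (rule rho_bound_if_wasserstein_1[OF pow_measure_in_prob_algebra[OF mu] nu f C]) (use that n nu in blast)
  qed
  have 31: T2 if ?R
    unfolding T2_def
  proof
    fix \<nu> :: "'a measure" assume nu: "\<nu> \<in> probs borel"
    have rho: "(SUP \<nu>\<in>probs (prodE {..<n}). ereal (\<integral>x. lam * f x \<partial>\<nu>) - alpha_along \<alpha> S n \<nu>)
         \<le> ereal (lam * (\<integral>x. f x \<partial>pow_measure \<mu> n) + C * lam\<^sup>2 / 4)"
      if "n \<ge> 1" "bdd_lip1 n f" for n lam f using \<open>?R\<close> that by blast
    have "\<alpha> \<nu> \<noteq> - \<infinity>" using bdd_below nu by fastforce
    from transport_if_rho_bound[where \<mu>=\<mu> and \<nu>=\<nu> and S=S and \<alpha>=\<alpha>, OF C mu mom S(2) rho nu this]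
    show "enn2ereal ((wasserstein 2 dist \<mu> \<nu>)\<^sup>2) \<le> ereal C * \<alpha> \<nu>" .
  qed
  show "T2 \<longleftrightarrow> ?W" "T2 \<longleftrightarrow> ?R" using 12 23 31 by blast+
qed

theorem mainTheorem5:
  fixes \<alpha> :: "'a::polish_space measure \<Rightarrow> ereal" and \<mu> :: "'a measure" and C :: real
  assumes meas: "\<alpha> \<in> borel_measurable (prob_algebra borel)"
    and bdd_below: "\<exists>b::real. \<forall>\<nu> \<in> space (prob_algebra borel). ereal b \<le> \<alpha> \<nu>"
    and not_inf: "\<exists>\<nu> \<in> space (prob_algebra borel). \<alpha> \<nu> \<noteq> \<infinity>"
    and mu: "\<mu> \<in> space (prob_algebra borel)"
    and moment: "\<exists>x0. (\<integral>\<^sup>+ x. ennreal ((dist x x0)\<^sup>2) \<partial>\<mu>) < \<infinity>"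
    and C: "C > 0"
  shows
   "((\<forall>\<nu> \<in> space (prob_algebra borel).
        enn2ereal ((wasserstein 2 dist \<mu> \<nu>)\<^sup>2) \<le> ereal C * \<alpha> \<nu>)
     \<longleftrightarrow> (\<forall>n\<ge>1. \<forall>\<nu> \<in> space (prob_algebra (prodE {..<n})).
        enn2ereal ((wasserstein 1 (dist_n n) (pow_measure \<mu> n) \<nu>)\<^sup>2) \<le> ereal C * alpha_n \<alpha> n \<nu>))
  \<and> ((\<forall>\<nu> \<in> space (prob_algebra borel).
        enn2ereal ((wasserstein 2 dist \<mu> \<nu>)\<^sup>2) \<le> ereal C * \<alpha> \<nu>)
     \<longleftrightarrow> (\<forall>n\<ge>1. \<forall>\<nu> \<in> space (prob_algebra (prodE {..<n})).
        enn2ereal ((wasserstein 1 (dist_n n) (pow_measure \<mu> n) \<nu>)\<^sup>2) \<le> ereal C * alpha_hat_n \<alpha> n \<nu>))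
  \<and> ((\<forall>\<nu> \<in> space (prob_algebra borel).
        enn2ereal ((wasserstein 2 dist \<mu> \<nu>)\<^sup>2) \<le> ereal C * \<alpha> \<nu>)
     \<longleftrightarrow> (\<forall>n\<ge>1. \<forall>lam::real. \<forall>f. bdd_lip1 n f \<longrightarrow>
        rho_n \<alpha> n (\<lambda>x. lam * f x) \<le> ereal (lam * (\<integral>x. f x \<partial>pow_measure \<mu> n) + C * lam\<^sup>2 / 4)))
  \<and> ((\<forall>\<nu> \<in> space (prob_algebra borel).
        enn2ereal ((wasserstein 2 dist \<mu> \<nu>)\<^sup>2) \<le> ereal C * \<alpha> \<nu>)
     \<longleftrightarrow> (\<forall>n\<ge>1. \<forall>lam::real. \<forall>f. bdd_lip1 n f \<longrightarrow>
        rho_hat_n \<alpha> n (\<lambda>x. lam * f x) \<le> ereal (lam * (\<integral>x. f x \<partial>pow_measure \<mu> n) + C * lam\<^sup>2 / 4)))"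
proof -
  \<comment> \<open>The smallest and the largest admissible conditioning sets: the past alone, and
    all other coordinates.\<close>
  note past = transport_equivalences[OF meas bdd_below mu moment C, of "\<lambda>n k. {..<k}"]
    and others = transport_equivalences[OF meas bdd_below mu moment C, of "\<lambda>n k. {..<n} - {k}"]
  show ?thesis
    unfolding rho_n_def rho_hat_n_def alpha_n_eq_along alpha_hat_n_eq_along
    by (intro conjI past others) auto
qed

end
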